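(* Let $\alpha\in(0,1)$. Let $f\in\mathcal{S}^{1,\alpha}$ and let $\varphi$ be a univalent function with $\varphi(\infty)=\infty$ such that $f$ and $\varphi$ are matching, and let $\gamma:=f^{-1}\circ\varphi$ be the induced homeomorphism of $S^1$. Put $\psi:=\varphi^{-1}$ and $v_0(z):=\frac1z\,\frac{\psi(f(z))}{f'(z)\,\psi'(f(z))}$ for $z\in S^1$. Then the kernel of the operator $I_f:\mathrm{Lip}_\alpha(S^1,\mathbb{C})\to\mathrm{Hol}(\mathbb{D})$ coincides with the set of all functions of the form $$v(z)=v_0(z)\,(h\circ\gamma^{-1})(z),\qquad z\in S^1,$$ where $h$ ranges over $\mathrm{Hol}_C(\mathbb{D}^* )\cap\mathrm{Lip}_\alpha(S^1,\mathbb{C})$.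
   Context: $\mathbb{D}=\{z:|z|<1\}$, $S^1=\partial\mathbb{D}$, $\mathbb{D}^*=\overline{\mathbb{C}}\setminus\overline{\mathbb{D}}$. $\mathcal{S}$ is the class of univalent holomorphic $f$ in $\mathbb{D}$ with $f(0)=0$, $f'(0)=1$; $\mathcal{S}^{1,\alpha}$ is the set of $f\in\mathcal{S}$ mapping $\mathbb{D}$ onto a domain bounded by a $C^{1,\alpha}$-smooth Jordan curve (equivalently $f$ extends continuously to $S^1$ with $f|_{S^1}$ having $\alpha$-Hölder continuous derivative which does not vanish). $\mathrm{Lip}_\alpha(S^1,\mathbb{C})$ is the space of complex-valued $\alpha$-Hölder continuous functions on $S^1$; $\mathrm{Hol}(\mathbb{D})$ the holomorphic functions on $\mathbb{D}$; $\mathrm{Hol}_C(\mathbb{D}^* )$ the continuous functions $h:\mathbb{D}^*\cup S^1\to\mathbb{C}$ analytic in $\mathbb{D}^*$. A conformal map $f$ of $\mathbb{D}$ onto a Jordan domain $D$ and a conformal map $\varphi$ of $\mathbb{D}^*$ onto a Jordan domain $D^*$ are matching if $D\cap D^*=\emptyset$ and $\partial D=\partial D^*$; both extend continuously to $S^1$, so $\gamma=f^{-1}\circ\varphi$ is a homeomorphism of $S^1$. The operator $I_f$ is $$I_f[v](z):=-\frac{1}{2\pi i}\int_{S^1}\left(\frac{s f'(s)}{f(s)}\right)^2\frac{v(s)}{f(s)-f(z)}\frac{ds}{s},\qquad z\in\mathbb{D}.$$ *)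

theory Defs
  imports "HOL-Complex_Analysis.Complex_Analysis"
begin

definition disc :: "complex set" where "disc = ball 0 1"
definition circle :: "complex set" where "circle = sphere 0 1"
definition ext_open :: "complex set" where "ext_open = {z. 1 < norm z}"
definition ext_closed :: "complex set" where "ext_closed = {z. 1 \<le> norm z}"

definition bderiv :: "(complex \<Rightarrow> complex) \<Rightarrow> complex set \<Rightarrow> complex \<Rightarrow> complex" where
  "bderiv g S w = (THE d. (g has_field_derivative d) (at w within S))"

definition lip_circle :: "real \<Rightarrow> (complex \<Rightarrow> complex) \<Rightarrow> bool" where
  "lip_circle \<alpha> v \<longleftrightarrow>
     (\<exists>C. \<forall>x\<in>circle. \<forall>y\<in>circle. norm (v x - v y) \<le> C * dist x y powr \<alpha>)"

definition class_S :: "(complex \<Rightarrow> complex) \<Rightarrow> bool" where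
  "class_S f \<longleftrightarrow> f holomorphic_on disc \<and> inj_on f disc \<and> f 0 = 0 \<and> deriv f 0 = 1"

text \<open>The class S^{1,alpha}: f extends continuously and injectively (Jordan boundary curve)
  to the closed disc, and f restricted to the circle has an alpha-Hoelder continuous,
  nonvanishing derivative.\<close>
definition class_S1 :: "real \<Rightarrow> (complex \<Rightarrow> complex) \<Rightarrow> bool" where
  "class_S1 \<alpha> f \<longleftrightarrow> class_S f \<and> continuous_on (cball 0 1) f \<and> inj_on f (cball 0 1) \<and>
     (\<exists>g. (\<forall>s\<in>circle. (f has_field_derivative g s) (at s within circle) \<and> g s \<noteq> 0)
          \<and> lip_circle \<alpha> g)"

definition fder :: "(complex \<Rightarrow> complex) \<Rightarrow> complex \<Rightarrow> complex" where
  "fder f s = bderiv f circle s"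

definition I_op :: "(complex \<Rightarrow> complex) \<Rightarrow> (complex \<Rightarrow> complex) \<Rightarrow> complex \<Rightarrow> complex" where
  "I_op f v z = - (1 / (2 * pi * \<i>)) *
     contour_integral (circlepath 0 1)
       (\<lambda>s. (s * fder f s / f s)^2 * (v s / (f s - f z)) / s)"

text \<open>Hol_C(D^*): continuous on the closed exterior including the point at infinity,
  holomorphic in the open exterior.\<close>
definition HolC_ext :: "(complex \<Rightarrow> complex) \<Rightarrow> bool" where
  "HolC_ext h \<longleftrightarrow> h holomorphic_on ext_open \<and> continuous_on ext_closed h \<and>
     (\<exists>L. (h \<longlongrightarrow> L) at_infinity)"

definition matching :: "(complex \<Rightarrow> complex) \<Rightarrow> (complex \<Rightarrow> complex) \<Rightarrow> bool" where
  "matching f \<phi> \<longleftrightarrow> f ` disc \<inter> \<phi> ` ext_open = {} \<and>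
     frontier (f ` disc) = frontier (\<phi> ` ext_open)"

end

theory Submission
  imports Defs
begin

text \<open>Put \<open>A(s) = s f'(s) v(s) / f(s)\<^sup>2\<close>. Then \<open>I_op f v z\<close> is minus the Cauchy integral, at the point \<open>f z\<close>, of
  the function \<open>A \<circ> f\<inverse>\<close> on the boundary curve. It vanishes on the inner domain iff \<open>A \<circ> f\<inverse>\<close> is the boundary
  function of a function that is holomorphic outside, continuous up to the curve, and zero at infinity. One
  direction is the Plemelj jump relation, for which the value at an exterior point is compared with the value
  \<open>0\<close> at a reflected interior point; in the other direction the integrand has a primitive. Passing to the
  coordinate of \<open>\<phi>\<close> gives the factor \<open>v0\<close>.

  For \<open>v0\<close> to be Hoelder continuous the derivative of \<open>\<phi>\<close> must extend to the circle as a zero free Hoelder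
  continuous function, which is Kellogg's theorem. It rests on three facts: a Jordan boundary makes \<open>\<phi>\<close>
  injective on the circle; the argument of the derivative has the tangent angle of the curve as boundary
  values (Lindeloef); and a Hoelder condition on these boundary values passes to the logarithm of the derivative
  by the Schwarz formula and the Hardy--Littlewood lemma.\<close>

section \<open>Integrals over the circle against Cauchy type kernels\<close>

text \<open>The boundary curve is given through the parametrisation \<open>f\<close>, while
  \<open>v0\<close> and the exterior function live in the coordinate of \<open>\<phi>\<close>. All
  work is therefore done on the closed unit disc: inversion makes infinity the interior point 0, and
  the regularity of the curve enters through the divided difference of \<open>f\<close>, which is
  continuous and zero free on the product of two closed discs, diagonal included. With
  \<open>F x = 1 / \<phi> (1 / x)\<close>, its derivative \<open>F1\<close>, and \<open>u s\<close>
  the point of the circle with \<open>F (u s) = 1 / f s\<close>, one finds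
  \<open>v0 s = u s * F1 (u s) * (f s)^2 / (s * f1 s)\<close>. Hence \<open>v\<close> has the
  asserted form iff \<open>A\<close> equals \<open>x * F1 x * h (1 / x)\<close> at
  \<open>x = u s\<close>. As \<open>F1\<close> has no zero in the closed disc, the factor
  \<open>x * F1 x\<close> accounts exactly for the zero of the exterior function at infinity, which
  is why \<open>h\<close> may have any finite limit there. The jump relation is estimated for radial
  approach only; a uniform rate together with continuous boundary values then gives continuity on
  the closed disc.\<close>

lemma integral_abs_powr_bound:
  fixes a d c l u :: real
  assumes a: "0 \<le> a" "a < 1" and d: "0 < d"
  shows "(\<lambda>t. (\<bar>t - c\<bar> / 2 + d) powr (a - 2)) integrable_on {l..u}"
    and "integral {l..u} (\<lambda>t. (\<bar>t - c\<bar> / 2 + d) powr (a - 2)) \<le> 4 * d powr (a - 1) / (1 - a)"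
proof -
  define k where "k = (\<lambda>t. (\<bar>t - c\<bar> / 2 + d) powr (a - 2))"
  \<comment> \<open>The symmetric interval \<open>{c-R..c+R}\<close> contains \<open>{l..u}\<close>,
    and on each of its halves the absolute value resolves, so that \<open>P\<close> is an explicit
    primitive. The slope 1/2 is that of the chord bound \<open>dist_circlepath_ge\<close>.\<close>
  define R where "R = \<bar>l - c\<bar> + \<bar>u - c\<bar>"
  define P where "P = (\<lambda>x. 2 / (a - 1) * (x / 2 + d) powr (a - 1))"
  have R: "0 \<le> R" by (simp add: R_def)
  have int: "k integrable_on {x..y}" for x y
    unfolding k_def by (intro integrable_continuous_real continuous_intros) (use d in \<open>auto simp: add_nonneg_eq_0_iff\<close>)
  show "(\<lambda>t. (\<bar>t - c\<bar> / 2 + d) powr (a - 2)) integrable_on {l..u}"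
    using int by (simp add: k_def)
  have derP: "(P has_real_derivative (x / 2 + d) powr (a - 2)) (at x within S)" if "0 \<le> x" for x S
  proof -
    have "a - 1 - 1 = a - 2" by simp
    moreover have "(P has_real_derivative
        2 / (a - 1) * ((a - 1) * (x / 2 + d) powr (a - 1 - 1) * (1 / 2))) (at x within S)"
      unfolding P_def
      by (rule DERIV_cmult, rule DERIV_chain2[where f = "\<lambda>y. y powr (a - 1)"],
          rule has_real_derivative_powr) (use that d in \<open>auto intro!: derivative_eq_intros\<close>)
    ultimately show ?thesis using a by simp
  qed
  have h1: "(k has_integral (P (c + R - c) - P (c - c))) {c..c+R}"
  proof (rule fundamental_theorem_of_calculus)
    fix t assume t: "t \<in> {c..c+R}"
    have "((\<lambda>t. P (t - c)) has_real_derivative ((t - c) / 2 + d) powr (a - 2) * 1) (at t within {c..c+R})"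
      by (rule DERIV_chain2[where f = P]) (use t in \<open>auto intro!: derP derivative_eq_intros\<close>)
    then show "((\<lambda>t. P (t - c)) has_vector_derivative k t) (at t within {c..c+R})"
      using t by (simp add: k_def has_real_derivative_iff_has_vector_derivative)
  qed (use R in simp)
  have h2: "(k has_integral (- P (c - c) - - P (c - (c - R)))) {c-R..c}"
  proof (rule fundamental_theorem_of_calculus)
    fix t assume t: "t \<in> {c-R..c}"
    have "((\<lambda>t. P (c - t)) has_real_derivative ((c - t) / 2 + d) powr (a - 2) * -1) (at t within {c-R..c})"
      by (rule DERIV_chain2[where f = P]) (use t in \<open>auto intro!: derP derivative_eq_intros\<close>)
    from DERIV_minus[OF this]
    show "((\<lambda>t. - P (c - t)) has_vector_derivative k t) (at t within {c-R..c})"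
      using t by (simp add: k_def has_real_derivative_iff_has_vector_derivative abs_minus_commute)
  qed (use R in simp)
  have h: "(k has_integral (2 * (P R - P 0))) {c-R..c+R}"
    using has_integral_combine[OF _ _ h2 h1] R by (simp add: algebra_simps)
  have "integral {l..u} k \<le> integral {c-R..c+R} k"
    by (rule integral_subset_le) (use int in \<open>auto simp: k_def R_def\<close>)
  also have "\<dots> = 2 * (P R - P 0)" using h by (rule integral_unique)
  also have "\<dots> \<le> - 2 * P 0"
    using a R d by (simp add: P_def divide_nonneg_neg)
  also have "\<dots> = 4 * d powr (a - 1) / (1 - a)"
    using a by (simp add: P_def field_simps)
  finally show "integral {l..u} (\<lambda>t. (\<bar>t - c\<bar> / 2 + d) powr (a - 2)) \<le> 4 * d powr (a - 1) / (1 - a)"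
    by (simp add: k_def)
qed

text \<open>Up to \<open>pi / 3\<close> the function \<open>sin x - x / 2\<close> increases, since
  \<open>cos\<close> is at least 1/2 there; beyond, \<open>sin x\<close> is at least
  \<open>sqrt 3 / 2\<close>, which exceeds \<open>pi / 4\<close>.\<close>

lemma sin_ge_half:
  fixes x :: real
  assumes "0 \<le> x" "x \<le> pi / 2"
  shows "x / 2 \<le> sin x"
proof (cases "x \<le> pi / 3")
  case True
  have "sin 0 - 0 / 2 \<le> sin x - x / 2"
  proof (rule DERIV_nonneg_imp_nondecreasing[OF assms(1)])
    fix y assume y: "0 \<le> y" "y \<le> x"
    have "cos (pi/3) \<le> cos y"
      by (rule cos_monotone_0_pi_le) (use y True in auto)
    then show "\<exists>z. ((\<lambda>x. sin x - x / 2) has_real_derivative z) (at y) \<and> 0 \<le> z"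
      by (intro exI[of _ "cos y - 1/2"]) (auto intro!: derivative_eq_intros simp: cos_60)
  qed
  then show ?thesis by simp
next
  case False
  have "sin (pi/3) \<le> sin x"
    by (rule sin_monotone_2pi_le) (use False assms in auto)
  moreover have "sin (pi/3) \<ge> pi/4"
  proof -
    have "pi/4 \<le> 0.85" using pi_less_4 pi_approx by simp
    moreover have "(0.85::real) \<le> sqrt 3 / 2" using real_le_rsqrt[of "1.7" 3] by (simp add: power2_eq_square)
    ultimately show ?thesis by (simp add: sin_60)
  qed
  ultimately show ?thesis using assms by simp
qed

lemma vector_derivative_unit_circlepath:
  "vector_derivative (circlepath 0 1) (at t) = 2 * pi * \<i> * circlepath 0 1 t"
  by (simp only: vector_derivative_circlepath) (simp add: circlepath)

text \<open>Parameters near the two ends of \<open>{0..1}\<close> belong to neighbouring points of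
  the circle, so \<open>t - t0\<close> has to be reduced modulo 1. The shift \<open>m\<close> brings
  it into \<open>[-1/2, 1/2]\<close>, where the chord \<open>2 * sin (pi * \<bar>y\<bar>)\<close> is
  comparable with \<open>\<bar>y\<bar>\<close>.\<close>

lemma dist_circlepath_ge:
  fixes t t0 :: real
  assumes "t \<in> {0..1}" "t0 \<in> {0..1}"
  shows "\<exists>m\<in>{-1,0,1}. \<bar>t - t0 + m\<bar> / 2 \<le> dist (circlepath 0 1 t) (circlepath 0 1 t0)"
proof -
  obtain m :: real where m: "m \<in> {-1,0,1}" "\<bar>t - t0 + m\<bar> \<le> 1/2"
  proof (cases "\<bar>t - t0\<bar> \<le> 1/2")
    case True then show ?thesis using that[of 0] by simp
  next
    case False then show ?thesis using that[of 1] that[of "-1"] assms by (auto simp: abs_if split: if_splits)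
  qed
  define y where "y = t - t0 + m"
  have e: "cis (2 * pi * (t - t0)) = cis (2 * pi * y)"
  proof -
    have "cis (2 * pi * m) = 1"
      using m(1) cis_2pi by (auto simp: cis_cnj[symmetric])
    then show ?thesis by (simp add: y_def distrib_left cis_mult[symmetric])
  qed
  have "dist (circlepath 0 1 t) (circlepath 0 1 t0) = cmod (cis (2*pi*t) - cis (2*pi*t0))"
    by (simp add: circlepath dist_norm cis_conv_exp mult_ac)
  also have "cis (2*pi*t) - cis (2*pi*t0) = cis (2*pi*t0) * (cis (2*pi*y) - 1)"
  proof -
    have "cis (2*pi*t0) * cis (2*pi*y) = cis (2*pi*t)"
      unfolding e[symmetric] by (simp add: cis_mult right_diff_distrib)
    then show ?thesis by (simp add: right_diff_distrib)
  qed
  also have "cmod \<dots> = cmod (cis (2*pi*y) - 1)" by (simp add: norm_mult)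
  also have "cis (2*pi*y) - 1 = cis (pi*y) * (cis (pi*y) - cis (-(pi*y)))"
    by (simp add: right_diff_distrib cis_mult mult.assoc)
  also have "cmod \<dots> = 2 * \<bar>sin (pi*y)\<bar>"
  proof -
    have "cis (pi*y) - cis (-(pi*y)) = 2 * \<i> * sin (pi*y)"
      by (simp add: complex_eq_iff)
    then show ?thesis by (simp add: norm_mult)
  qed
  also have "\<bar>sin (pi*y)\<bar> = sin (pi * \<bar>y\<bar>)"
  proof -
    have "sin (pi * \<bar>y\<bar>) \<ge> 0" by (rule sin_ge_zero) (use m in \<open>auto simp: y_def\<close>)
    then show ?thesis by (auto simp: abs_if)
  qed
  finally have "dist (circlepath 0 1 t) (circlepath 0 1 t0) = 2 * sin (pi * \<bar>y\<bar>)" .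
  moreover have "pi * \<bar>y\<bar> / 2 \<le> sin (pi * \<bar>y\<bar>)"
    by (rule sin_ge_half) (use m in \<open>auto simp: y_def\<close>)
  moreover have "\<bar>y\<bar> / 2 \<le> pi * \<bar>y\<bar>"
    using pi_ge_two by (intro order_trans[OF _ mult_right_mono[of 2 pi "\<bar>y\<bar>"]]) auto
  ultimately show ?thesis using m by (intro bexI[of _ m]) (auto simp: y_def)
qed

text \<open>The common estimate for Cauchy type integrals near the circle. In the applications
  \<open>d\<close> is the distance of a point of the disc from the circle and \<open>s0\<close> its
  radial projection. The \<open>N\<close> term admits densities with no better modulus of continuity
  than \<open>N + M r^a\<close>; the \<open>M\<close> term is the Hoelder part. The constant is
  \<open>2 pi\<close> for the speed of the path, times 3 shifts, times the 4 of
  \<open>integral_abs_powr_bound\<close>.\<close>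

lemma contour_integral_circle_kernel_bound:
  fixes k :: "complex \<Rightarrow> complex"
  assumes a: "0 \<le> a" "a < 1" and d: "0 < d" and N: "0 \<le> N" and M: "0 \<le> M"
    and s0: "s0 \<in> sphere 0 1"
    and k: "continuous_on (sphere 0 1) k"
    and bd: "\<And>s. s \<in> sphere 0 1 \<Longrightarrow>
      norm (k s) \<le> N * (dist s s0 + d) powr (-2) + M * (dist s s0 + d) powr (a - 2)"
  shows "norm (contour_integral (circlepath 0 1) k) \<le>
    24 * pi * (N / d + M / (1 - a) * d powr (a - 1))"
proof -
  have "s0 \<in> path_image (circlepath 0 1)" using s0 by simp
  then obtain t0 where t0: "t0 \<in> {0..1}" "s0 = circlepath 0 1 t0"
    by (auto simp: path_image_def)
  define w where "w = (\<lambda>a m t. (\<bar>t - (t0 - m)\<bar> / 2 + d) powr (a - 2))"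
  \<comment> \<open>Which shift applies depends on \<open>t\<close>; the sum of all three is a
    single integrable majorant.\<close>
  define W where "W = (\<lambda>a t. w a (-1) t + w a 0 t + w a 1 t)"
  have wi: "w a m integrable_on {0..1}" "integral {0..1} (w a m) \<le> 4 * d powr (a - 1) / (1 - a)"
    if "0 \<le> a" "a < 1" for a m
    using integral_abs_powr_bound[OF that d] by (simp_all add: w_def)
  have Wi: "W a integrable_on {0..1}" "integral {0..1} (W a) \<le> 12 * d powr (a - 1) / (1 - a)"
    if "0 \<le> a" "a < 1" for a
  proof -
    show "W a integrable_on {0..1}" unfolding W_def using wi(1)[OF that] by (intro integrable_add)
    have "integral {0..1} (W a) = integral {0..1} (w a (-1)) + integral {0..1} (w a 0) + integral {0..1} (w a 1)"
      unfolding W_def using wi(1)[OF that] by (simp add: integral_add integrable_add)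
    then show "integral {0..1} (W a) \<le> 12 * d powr (a - 1) / (1 - a)"
      using wi(2)[OF that, of "-1"] wi(2)[OF that, of 0] wi(2)[OF that, of 1] by simp
  qed
  have W: "(dist (circlepath 0 1 t) s0 + d) powr (a - 2) \<le> W a t" if t: "t \<in> {0..1}" and a: "a < 1" for t a
  proof -
    obtain m :: real where m: "m \<in> {-1,0,1}" "\<bar>t - t0 + m\<bar> / 2 \<le> dist (circlepath 0 1 t) (circlepath 0 1 t0)"
      using dist_circlepath_ge[OF t t0(1)] by blast
    have "(dist (circlepath 0 1 t) s0 + d) powr (a - 2) \<le> w a m t"
      unfolding w_def by (rule powr_mono2') (use m a d t0 in \<open>auto simp: algebra_simps add_pos_nonneg\<close>)
    moreover have "w a j t \<ge> 0" for j by (simp add: w_def)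
    ultimately show ?thesis using m(1) unfolding W_def
      by (smt (verit) insertE empty_iff)
  qed
  note vd = vector_derivative_unit_circlepath
  have cp: "circlepath 0 1 t \<in> sphere 0 1" if "t \<in> {0..1}" for t
    using that path_image_circlepath_nonneg[of 1 0] by (force simp: path_image_def)
  have ci: "k contour_integrable_on (circlepath 0 1)"
    by (rule contour_integrable_continuous_circlepath) (use k in simp)
  have "norm (contour_integral (circlepath 0 1) k) =
      norm (integral {0..1} (\<lambda>t. k (circlepath 0 1 t) * vector_derivative (circlepath 0 1) (at t)))"
    by (simp add: contour_integral_integral)
  also have "\<dots> \<le> integral {0..1} (\<lambda>t. 2 * pi * N * W 0 t + 2 * pi * M * W a t)"
  proof (rule integral_norm_bound_integral)
    show "(\<lambda>t. k (circlepath 0 1 t) * vector_derivative (circlepath 0 1) (at t)) integrable_on {0..1}"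
      using ci by (simp add: contour_integrable_on)
    show "(\<lambda>t. 2 * pi * N * W 0 t + 2 * pi * M * W a t) integrable_on {0..1}"
      by (intro integrable_on_mult_right integrable_add Wi a) auto
    fix t :: real assume t: "t \<in> {0..1}"
    have "norm (k (circlepath 0 1 t) * vector_derivative (circlepath 0 1) (at t))
          = 2 * pi * norm (k (circlepath 0 1 t))"
      using cp[OF t] by (simp add: vd norm_mult)
    also have "\<dots> \<le> 2 * pi * (N * (dist (circlepath 0 1 t) s0 + d) powr (0-2)
                           + M * (dist (circlepath 0 1 t) s0 + d) powr (a - 2))"
      using bd[OF cp[OF t]] by simp
    also have "\<dots> \<le> 2 * pi * (N * W 0 t + M * W a t)"
      using W[OF t, of 0] W[OF t a(2)] N M by (intro mult_left_mono add_mono) auto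
    finally show "norm (k (circlepath 0 1 t) * vector_derivative (circlepath 0 1) (at t))
        \<le> 2 * pi * N * W 0 t + 2 * pi * M * W a t"
      by (simp add: algebra_simps)
  qed
  also have "\<dots> = 2 * pi * N * integral {0..1} (W 0) + 2 * pi * M * integral {0..1} (W a)"
    using Wi(1)[of 0] Wi(1)[OF a] by (simp add: integral_add integrable_on_mult_right)
  also have "\<dots> \<le> 2 * pi * N * (12 * d powr (0 - 1) / (1 - 0)) + 2 * pi * M * (12 * d powr (a - 1) / (1 - a))"
    using N M by (intro add_mono mult_left_mono Wi a) auto
  also have "\<dots> = 24 * pi * (N / d + M / (1 - a) * d powr (a - 1))"
    using d by (simp add: powr_minus field_simps)
  finally show ?thesis .
qed

lemma circle_point_radial:
  fixes z :: complex
  assumes "norm z \<le> 1"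
  obtains s0 where "s0 \<in> sphere 0 1" "z = of_real (norm z) * s0"
proof (cases "z = 0")
  case True
  then show ?thesis by (intro that[of 1]) auto
next
  case False
  then show ?thesis by (intro that[of "z / of_real (norm z)"]) (auto simp: norm_divide)
qed

text \<open>The distance from \<open>s\<close> to \<open>r * s0\<close> is at least
  \<open>1 - r\<close>, so the detour from \<open>r * s0\<close> to \<open>s0\<close> at most
  doubles it; adding \<open>1 - r\<close> once more gives the factor 3.\<close>

lemma dist_radial_le:
  fixes s s0 :: complex
  assumes "s0 \<in> sphere 0 1" "s \<in> sphere 0 1" "0 \<le> r" "r \<le> 1"
  shows "dist s s0 + (1 - r) \<le> 3 * norm (s - of_real r * s0)"
proof -
  have "norm (s0 - of_real r * s0) = 1 - r"
  proof -
    have "s0 - of_real r * s0 = of_real (1 - r) * s0" by (simp add: algebra_simps)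
    then show ?thesis using assms by (simp only: norm_mult norm_of_real) simp
  qed
  moreover have "norm (s - s0) \<le> norm (s - of_real r * s0) + norm (s0 - of_real r * s0)"
    using norm_triangle_ineq4[of "s - of_real r * s0" "s0 - of_real r * s0"] by simp
  moreover have "1 - r \<le> norm (s - of_real r * s0)"
    using norm_triangle_ineq2[of s "of_real r * s0"] assms by (simp add: norm_mult)
  ultimately show ?thesis by (simp add: dist_norm)
qed

lemma has_contour_integral_inverse_square:
  assumes "norm z < 1"
  shows "((\<lambda>s. 1 / (s - z)^2) has_contour_integral 0) (circlepath 0 1)"
proof (rule Cauchy_theorem_primitive[where S = "sphere 0 1" and f = "\<lambda>s. - 1 / (s - z)"])
  fix s :: complex assume "s \<in> sphere 0 1"
  then have "s - z \<noteq> 0" using assms by auto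
  then show "((\<lambda>s. - 1 / (s - z)) has_field_derivative 1 / (s - z)\<^sup>2) (at s within sphere 0 1)"
    by (auto intro!: derivative_eq_intros simp: power2_eq_square)
qed auto

text \<open>The kernel has a primitive on the circle, so the value of \<open>b\<close> at the radial
  projection \<open>s0\<close> of \<open>z\<close> can be subtracted before taking norms. The
  constant is \<open>24 * 9\<close>, with 9 the square of the factor in
  \<open>dist_radial_le\<close>.\<close>

lemma norm_Cauchy_square_integral_le:
  fixes b :: "complex \<Rightarrow> complex"
  assumes a: "0 \<le> a" "a < 1" and N: "0 \<le> N" and M: "0 \<le> M"
    and b: "continuous_on (sphere 0 1) b"
    and bd: "\<And>s t. s \<in> sphere 0 1 \<Longrightarrow> t \<in> sphere 0 1 \<Longrightarrow> norm (b s - b t) \<le> N + M * dist s t powr a"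
    and z: "norm z < 1"
  shows "norm (contour_integral (circlepath 0 1) (\<lambda>s. b s / (s - z)^2))
     \<le> 216 * pi * (N / (1 - norm z) + M / (1 - a) * (1 - norm z) powr (a - 1))"
proof -
  obtain s0 where s0: "s0 \<in> sphere 0 1" "z = of_real (norm z) * s0"
    using circle_point_radial[of z] z by auto
  define d where "d = 1 - norm z"
  have d: "0 < d" using z by (simp add: d_def)
  have nz: "s - z \<noteq> 0" if "s \<in> sphere 0 1" for s using that z by auto
  have low: "dist s s0 + d \<le> 3 * norm (s - z)" if "s \<in> sphere 0 1" for s
    using dist_radial_le[OF s0(1) that, of "norm z"] z s0(2) by (simp add: d_def)
  from has_contour_integral_lmul[OF has_contour_integral_inverse_square[OF z], of "b s0"]
  have z0: "((\<lambda>s. b s0 / (s - z)^2) has_contour_integral 0) (circlepath 0 1)" by simp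
  have ci: "(\<lambda>s. b s / (s - z)^2) contour_integrable_on (circlepath 0 1)"
    by (rule contour_integrable_continuous_circlepath)
       (use nz in \<open>auto intro!: continuous_intros b\<close>)
  have eq: "contour_integral (circlepath 0 1) (\<lambda>s. b s / (s - z)^2)
     = contour_integral (circlepath 0 1) (\<lambda>s. (b s - b s0) / (s - z)^2)"
    using contour_integral_diff[OF ci has_contour_integral_integrable[OF z0]] contour_integral_unique[OF z0]
    by (simp add: diff_divide_distrib)
  have "norm (contour_integral (circlepath 0 1) (\<lambda>s. (b s - b s0) / (s - z)^2))
     \<le> 24 * pi * (9 * N / d + 9 * M / (1 - a) * d powr (a - 1))"
  proof (rule contour_integral_circle_kernel_bound[OF a d _ _ s0(1)])
    show "continuous_on (sphere 0 1) (\<lambda>s. (b s - b s0) / (s - z)\<^sup>2)"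
      by (use nz in \<open>auto intro!: continuous_intros b\<close>)
    fix s :: complex assume s: "s \<in> sphere 0 1"
    define x where "x = dist s s0 + d"
    have x: "0 < x" "dist s s0 \<le> x" using d by (auto simp: x_def add_nonneg_pos)
    have "x^2 \<le> 9 * norm (s - z)^2"
      using power_mono[OF low[OF s], of 2] x(1) by (simp add: x_def power_mult_distrib)
    then have "norm ((b s - b s0) / (s - z)\<^sup>2) \<le> norm (b s - b s0) * (9 / x^2)"
      using mult_left_mono[of "x^2" "9 * norm (s - z)^2" "norm (b s - b s0)"] x(1) nz[OF s]
      by (simp add: norm_divide norm_power field_simps)
    also have "\<dots> \<le> (N + M * x powr a) * (9 / x^2)"
      using bd[OF s s0(1)] x M a powr_mono2[OF a(1) _ x(2)]
      by (intro mult_right_mono) (auto intro: order_trans add_left_mono mult_left_mono)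
    also have "\<dots> = 9 * N * x powr -2 + 9 * M * x powr (a - 2)"
      using x(1) by (simp add: powr_minus powr_diff field_simps)
    finally show "norm ((b s - b s0) / (s - z)\<^sup>2) \<le> 9 * N * (dist s s0 + d) powr - 2 + 9 * M * (dist s s0 + d) powr (a - 2)"
      by (simp add: x_def)
  qed (use N M in auto)
  also have "\<dots> = 216 * pi * (N / d + M / (1 - a) * d powr (a - 1))"
    by (simp add: algebra_simps)
  finally show ?thesis by (simp add: eq d_def)
qed

section \<open>Growth of the derivative and Hoelder continuity in the disc\<close>

lemma Hardy_Littlewood_segment:
  fixes G :: "complex \<Rightarrow> complex"
  assumes T: "ball 0 1 \<subseteq> T" "T \<subseteq> cball 0 1" and G: "continuous_on T G"
    and hol: "G holomorphic_on ball 0 1"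
    and bd: "\<And>z. norm z < 1 \<Longrightarrow> norm (deriv G z) \<le> C * (1 - norm z) powr (a - 1)"
    and a: "0 < a" "a \<le> 1" and C: "0 \<le> C"
    and z: "z \<in> T" and m: "norm m \<le> 1 - d / 2" and zm: "norm (m - z) \<le> d" and d: "0 < d"
  shows "norm (G m - G z) \<le> 2 * C / a * d powr a"
proof -
  \<comment> \<open>At time \<open>t\<close> the segment from \<open>z\<close> to \<open>m\<close>
    is at distance at least \<open>t * d / 2\<close> from the circle, because \<open>m\<close> lies
    \<open>d / 2\<close> inside. The derivative bound thus becomes a multiple of
    \<open>t powr (a - 1)\<close>, integrable at 0 even if \<open>z\<close> is on the circle;
    \<open>\<phi>\<close> is its integral.\<close>
  define p where "p = (\<lambda>t::real. z + of_real t * (m - z))"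
  define \<phi> where "\<phi> = (\<lambda>t. C * d * (d / 2) powr (a - 1) / a * t powr a)"
  have nz: "norm z \<le> 1" using z T by auto
  have pn: "norm (p t) \<le> 1 - t * d / 2" if "0 \<le> t" "t \<le> 1" for t
  proof -
    have "p t = of_real (1 - t) * z + of_real t * m" by (simp add: p_def algebra_simps)
    then have "norm (p t) \<le> norm (of_real (1 - t) * z) + norm (of_real t * m)"
      by (metis norm_triangle_ineq)
    also have "\<dots> = (1 - t) * norm z + t * norm m"
      using that by (simp only: norm_mult norm_of_real abs_of_nonneg)
    also have "\<dots> \<le> (1 - t) * 1 + t * (1 - d / 2)"
      using that nz m by (intro add_mono mult_left_mono) auto
    finally show ?thesis by (simp add: algebra_simps)
  qed
  have pT: "p t \<in> T" if "0 \<le> t" "t \<le> 1" for t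
  proof (cases "t = 0")
    case False
    then have "t * d > 0" using that d by simp
    then have "norm (p t) < 1" using pn[OF that] by linarith
    then show ?thesis using T by auto
  qed (use z in \<open>simp add: p_def\<close>)
  have "norm ((G \<circ> p) 1 - (G \<circ> p) 0) \<le> \<phi> 1 - \<phi> 0"
  proof (rule differentiable_bound_general)
    show "continuous_on {0..1} (G \<circ> p)"
      unfolding p_def o_def
      by (rule continuous_on_compose2[OF G]) (use pT in \<open>auto intro!: continuous_intros simp: p_def\<close>)
    show "continuous_on {0..1} \<phi>"
      unfolding \<phi>_def by (intro continuous_intros continuous_on_powr') (use a in auto)
    fix t :: real assume t: "0 < t" "t < 1"
    have td: "0 < t * d" using t d by simp
    have pt: "norm (p t) < 1" using pn[of t] t td by linarith
    have "(G has_field_derivative deriv G (p t)) (at (p t))"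
      by (rule holomorphic_derivI[OF hol]) (use pt in auto)
    moreover have "(p has_vector_derivative (m - z)) (at t)"
      unfolding p_def has_vector_derivative_def
      by (auto intro!: derivative_eq_intros simp: scaleR_conv_of_real)
    ultimately show "((G \<circ> p) has_vector_derivative (m - z) * deriv G (p t)) (at t)"
      using field_vector_diff_chain_at by blast
    show "(\<phi> has_vector_derivative C * d * (d / 2) powr (a - 1) * t powr (a - 1)) (at t)"
      unfolding \<phi>_def has_real_derivative_iff_has_vector_derivative[symmetric]
      using t a by (auto intro!: derivative_eq_intros simp: field_simps)
    have "norm ((m - z) * deriv G (p t)) \<le> d * (C * (1 - norm (p t)) powr (a - 1))"
      unfolding norm_mult using d zm bd[OF pt] by (intro mult_mono) auto
    also have "\<dots> \<le> d * (C * (t * d / 2) powr (a - 1))"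
      using d C by (intro mult_left_mono powr_mono2') (use a td pn[of t] t in auto)
    also have "(t * d / 2) powr (a - 1) = (d / 2) powr (a - 1) * t powr (a - 1)"
      using t d by (simp add: powr_mult[symmetric] mult.commute)
    finally show "norm ((m - z) * deriv G (p t)) \<le> C * d * (d / 2) powr (a - 1) * t powr (a - 1)"
      by (simp add: algebra_simps)
  qed auto
  also have "\<phi> 1 - \<phi> 0 = C / a * (d * (d / 2) powr (a - 1))"
    using a by (simp add: \<phi>_def)
  also have "d * (d / 2) powr (a - 1) = 2 powr (1 - a) * d powr a"
    using d by (simp add: powr_divide powr_diff field_simps)
  also have "C / a * (2 powr (1 - a) * d powr a) \<le> C / a * (2 powr 1 * d powr a)"
    using a C by (intro mult_left_mono mult_right_mono powr_mono) auto
  finally show ?thesis by (simp add: p_def o_def algebra_simps)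
qed

text \<open>The direct segment may run too close to the circle, so the two points are joined through
  their midpoint pulled towards 0, at the price of two segments of length at most \<open>d\<close>.
  The set \<open>T\<close> is a parameter because the closed disc is used for \<open>F\<close> and
  the open disc for functions not yet known to extend.\<close>

lemma Hardy_Littlewood:
  fixes G :: "complex \<Rightarrow> complex"
  assumes T: "ball 0 1 \<subseteq> T" "T \<subseteq> cball 0 1" and G: "continuous_on T G"
    and hol: "G holomorphic_on ball 0 1"
    and bd: "\<And>z. norm z < 1 \<Longrightarrow> norm (deriv G z) \<le> C * (1 - norm z) powr (a - 1)"
    and a: "0 < a" "a \<le> 1" and C: "0 \<le> C"
    and z: "z \<in> T" and w: "w \<in> T"
  shows "norm (G z - G w) \<le> 4 * C / a * dist z w powr a"
proof (cases "z = w")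
  case False
  define d where "d = dist z w"
  define m where "m = of_real (1 - d / 2) * ((z + w) / 2)"
  have d: "0 < d" using False by (simp add: d_def)
  have nz: "norm z \<le> 1" "norm w \<le> 1" using z w T by auto
  have d2: "d \<le> 2" using nz norm_triangle_ineq4[of z w] by (simp add: d_def dist_norm)
  have hn: "norm ((z + w) / 2) \<le> 1" using nz norm_triangle_ineq[of z w] by simp
  have "norm m = (1 - d/2) * norm ((z + w) / 2)"
    unfolding m_def norm_mult norm_of_real using d2 by simp
  also have "\<dots> \<le> (1 - d/2) * 1" using d2 hn by (intro mult_left_mono) auto
  finally have m: "norm m \<le> 1 - d / 2" by simp
  have half: "norm ((z + w) / 2 - z) = d / 2" "norm ((z + w) / 2 - w) = d / 2"
  proof -
    have e: "(z + w) / 2 - z = (w - z) / 2" "(z + w) / 2 - w = (z - w) / 2" by (simp_all add: field_simps)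
    show "norm ((z + w) / 2 - z) = d / 2" "norm ((z + w) / 2 - w) = d / 2"
      unfolding e by (simp_all add: d_def dist_norm norm_divide norm_minus_commute)
  qed
  have mm: "norm (m - (z + w) / 2) \<le> d / 2"
  proof -
    have "m - (z + w) / 2 = - (of_real (d / 2) * ((z + w) / 2))" by (simp add: m_def algebra_simps)
    then have "norm (m - (z + w) / 2) = d / 2 * norm ((z + w) / 2)"
      using d by (simp only: norm_minus_cancel norm_mult norm_of_real)
    also have "\<dots> \<le> d / 2 * 1" using d hn by (intro mult_left_mono) auto
    finally show ?thesis by simp
  qed
  have dz: "norm (m - z) \<le> d"
    using norm_triangle_ineq[of "m - (z + w)/2" "(z + w)/2 - z"] half mm by simp
  have dw: "norm (m - w) \<le> d"
    using norm_triangle_ineq[of "m - (z + w)/2" "(z + w)/2 - w"] half mm by simp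
  have "norm (G m - G z) \<le> 2 * C / a * d powr a"
    by (rule Hardy_Littlewood_segment[OF T G hol _ a C z m dz d]) (rule bd)
  moreover have "norm (G m - G w) \<le> 2 * C / a * d powr a"
    by (rule Hardy_Littlewood_segment[OF T G hol _ a C w m dw d]) (rule bd)
  ultimately show ?thesis
    using norm_triangle_ineq4[of "G m - G w" "G m - G z"] by (simp add: d_def)
qed simp

lemma Hoelder_extension:
  fixes G :: "complex \<Rightarrow> complex"
  assumes a: "0 < a"
    and G: "\<And>z w. norm z < 1 \<Longrightarrow> norm w < 1 \<Longrightarrow> norm (G z - G w) \<le> C * dist z w powr a"
  obtains H where "continuous_on (cball 0 1) H" "\<And>z. norm z < 1 \<Longrightarrow> H z = G z"
    "\<And>z w. z \<in> cball 0 1 \<Longrightarrow> w \<in> cball 0 1 \<Longrightarrow> norm (H z - H w) \<le> C * dist z w powr a"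
proof -
  have "uniformly_continuous_on (ball 0 1) G"
    unfolding uniformly_continuous_on_def
  proof (intro allI impI)
    fix e :: real assume e: "0 < e"
    \<comment> \<open>\<open>C\<close> may be zero or negative, and the radius below divides by the
      constant.\<close>
    define K where "K = max C 1"
    have K: "0 < K" "C \<le> K" by (auto simp: K_def)
    show "\<exists>d>0. \<forall>x\<in>ball 0 1. \<forall>x'\<in>ball 0 1. dist x' x < d \<longrightarrow> dist (G x') (G x) < e"
    proof (intro exI conjI ballI impI)
      show "0 < (e / K) powr (1 / a)" using e K by simp
      fix x y :: complex assume xy: "x \<in> ball 0 1" "y \<in> ball 0 1" and d: "dist y x < (e / K) powr (1 / a)"
      have "dist y x powr a < ((e / K) powr (1 / a)) powr a"
        using d a by (intro powr_less_mono2) auto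
      also have "\<dots> = e / K" using a e K by (simp add: powr_powr)
      finally have *: "K * dist y x powr a < e" using K by (simp add: field_simps)
      have "dist (G y) (G x) \<le> C * dist y x powr a"
        using G[of y x] xy by (simp add: dist_norm)
      also have "\<dots> \<le> K * dist y x powr a" using K by (intro mult_right_mono) auto
      finally show "dist (G y) (G x) < e" using * by simp
    qed
  qed
  then obtain H where H: "uniformly_continuous_on (closure (ball 0 1)) H" "\<And>x. x \<in> ball 0 1 \<Longrightarrow> G x = H x"
    using uniformly_continuous_on_extension_on_closure by metis
  have cH: "continuous_on (cball 0 1) H"
    using uniformly_continuous_imp_continuous[OF H(1)] by simp
  show ?thesis
  proof (rule that[OF cH])
    show "H z = G z" if "norm z < 1" for z using H(2)[of z] that by simp
    fix z w :: complex assume zw: "z \<in> cball 0 1" "w \<in> cball 0 1"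
    define r where "r = (\<lambda>n. complex_of_real (1 - 1 / real (Suc n)))"
    have rlim: "r \<longlonglongrightarrow> 1"
      unfolding r_def
      using tendsto_of_real[OF LIMSEQ_inverse_real_of_nat_add_minus[of 1], where ?'a = complex]
      by (simp add: inverse_eq_divide del: of_nat_Suc)
    have rb: "norm (r n * x) < 1" if "x \<in> cball 0 1" for x :: complex and n
    proof -
      have "norm (r n * x) = (1 - 1 / real (Suc n)) * norm x"
        unfolding r_def norm_mult norm_of_real by (simp add: field_simps)
      also have "\<dots> \<le> (1 - 1 / real (Suc n)) * 1" using that by (intro mult_left_mono) auto
      also have "\<dots> < 1" by simp
      finally show ?thesis .
    qed
    have lim: "(\<lambda>n. H (r n * x)) \<longlonglongrightarrow> H x" if "x \<in> cball 0 1" for x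
    proof (rule continuous_on_tendsto_compose[OF cH])
      show "(\<lambda>n. r n * x) \<longlonglongrightarrow> x" using tendsto_mult[OF rlim tendsto_const[of x]] by simp
    qed (use that rb[OF that] in \<open>auto simp: mem_cball_0 intro!: always_eventually less_imp_le\<close>)
    have d1: "(\<lambda>n. norm (H (r n * z) - H (r n * w))) \<longlonglongrightarrow> norm (H z - H w)"
      by (intro tendsto_intros lim zw)
    have d2: "(\<lambda>n. C * dist (r n * z) (r n * w) powr a) \<longlonglongrightarrow> C * dist (1 * z) (1 * w) powr a"
      using a by (intro tendsto_mult tendsto_const tendsto_powr' tendsto_dist rlim) auto
    show "norm (H z - H w) \<le> C * dist z w powr a"
      using LIMSEQ_le[OF d1 d2] G[OF rb[OF zw(1)] rb[OF zw(2)]] H(2) rb[OF zw(1)] rb[OF zw(2)] by auto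
  qed
qed

text \<open>A primitive of \<open>G\<close> on the closed disc differs from \<open>F\<close> by a
  constant inside, hence by continuity also on the circle. So a continuous extension of the
  derivative is automatically the derivative at boundary points.\<close>

lemma has_field_derivative_within_cball:
  fixes F G :: "complex \<Rightarrow> complex"
  assumes F: "continuous_on (cball 0 1) F" and G: "continuous_on (cball 0 1) G"
    and der: "\<And>z. norm z < 1 \<Longrightarrow> (F has_field_derivative G z) (at z)"
    and x: "x \<in> cball 0 1"
  shows "(F has_field_derivative G x) (at x within cball 0 1)"
proof -
  have "G holomorphic_on ball 0 1"
    by (rule holomorphic_on_subset[OF derivative_is_holomorphic[of "ball 0 1" F]]) (use der in auto)
  then obtain P where P: "\<And>x. x \<in> cball 0 1 \<Longrightarrow> (P has_field_derivative G x) (at x within cball 0 1)"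
    using holomorphic_convex_primitive[of "cball 0 1" "{}" G] G
    by (auto simp: holomorphic_on_imp_differentiable_at)
  have cP: "continuous_on (cball 0 1) P"
    using P by (rule DERIV_continuous_on)
  have "\<exists>c. \<forall>z\<in>ball 0 1. F z - P z = c"
  proof (rule has_field_derivative_zero_constant)
    fix z :: complex assume z: "z \<in> ball 0 1"
    have "(P has_field_derivative G z) (at z)"
      using P[of z] z at_within_interior[of z "cball 0 1"] by (auto simp: less_imp_le)
    then show "((\<lambda>z. F z - P z) has_field_derivative 0) (at z within ball 0 1)"
      using DERIV_diff[OF der[of z], of P "G z"] z has_field_derivative_at_within[of _ 0 z "ball 0 1"] by simp
  qed auto
  then obtain c where c: "\<forall>z\<in>ball 0 1. F z - P z = c" by blast
  have "F z - P z = c" if "z \<in> cball 0 1" for z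
  proof -
    have "F z - P z = c" if "z \<in> closure (ball 0 1)" for z
      by (rule continuous_constant_on_closure[where S = "ball 0 1" and f = "\<lambda>z. F z - P z", OF _ _ that])
         (use c in \<open>auto intro!: continuous_intros F cP\<close>)
    then show ?thesis using that by simp
  qed
  then have eq: "F z = P z + c" if "z \<in> cball 0 1" for z using that by (metis add.commute diff_add_cancel)
  have "((\<lambda>z. P z + c) has_field_derivative G x + 0) (at x within cball 0 1)"
    by (intro DERIV_add P x DERIV_const)
  then show ?thesis
    using has_field_derivative_transform_within[of _ _ x "cball 0 1" 1 F] eq x by auto
qed

section \<open>Divided differences and the Schwarz formula\<close>

text \<open>Averaging the derivative over the segment from \<open>x\<close> to \<open>y\<close>
  gives a quotient that is jointly continuous across the diagonal; convexity keeps the segment in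
  the disc.\<close>

lemma divided_difference_cball:
  fixes F G :: "complex \<Rightarrow> complex"
  assumes G: "continuous_on (cball 0 1) G"
    and der: "\<And>x. x \<in> cball 0 1 \<Longrightarrow> (F has_field_derivative G x) (at x within cball 0 1)"
  obtains D where "continuous_on (cball 0 1 \<times> cball 0 1) D"
    "\<And>x. x \<in> cball 0 1 \<Longrightarrow> D (x, x) = G x"
    "\<And>x y. x \<in> cball 0 1 \<Longrightarrow> y \<in> cball 0 1 \<Longrightarrow> F y - F x = D (x, y) * (y - x)"
proof -
  let ?B = "cball (0::complex) 1"
  define D where "D = (\<lambda>p. integral (cbox 0 1) (\<lambda>t::real. G (linepath (fst p) (snd p) t)))"
  have lp: "linepath x y t \<in> ?B" if "x \<in> ?B" "y \<in> ?B" "t \<in> {0..1}" for x y t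
    using that by (metis closed_segment_subset convex_cball in_mono linepath_in_path)
  show ?thesis
  proof (rule that[of D])
    show "continuous_on (?B \<times> ?B) D"
      unfolding D_def
    proof (rule integral_continuous_on_param[where f = "\<lambda>p t. G (linepath (fst p) (snd p) t)"],
        unfold case_prod_unfold, rule continuous_on_compose2[OF G])
      show "continuous_on ((?B \<times> ?B) \<times> cbox (0::real) 1)
          (\<lambda>x. linepath (fst (fst x)) (snd (fst x)) (snd x))"
        unfolding linepath_def by (intro continuous_intros)
    qed (use lp in auto)
    show "D (x, x) = G x" for x by (simp add: D_def linepath_refl)
    fix x y assume xy: "x \<in> ?B" "y \<in> ?B"
    have "(G has_contour_integral (F y - F x)) (linepath x y)"
      using contour_integral_primitive[where S = ?B and f = F and f' = G and g = "linepath x y", OF der] xy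
      by (simp add: closed_segment_subset)
    then have "((\<lambda>t. G (linepath x y t) * (y - x)) has_integral (F y - F x)) {0..1}"
      by (simp add: has_contour_integral_linepath)
    moreover have "(\<lambda>t. G (linepath x y t)) integrable_on {0..1}"
      by (rule integrable_continuous_real, rule continuous_on_compose2[OF G])
         (use lp xy in \<open>auto intro: continuous_on_linepath\<close>)
    ultimately show "F y - F x = D (x, y) * (y - x)"
      unfolding D_def by (simp add: integral_unique flip: integral_mult_left)
  qed
qed

text \<open>The divided difference has no zeros: off the diagonal by injectivity, on it because
  \<open>G\<close> has none. The constants are the extreme values of its modulus on a compact
  set.\<close>

lemma bilipschitz_cball:
  fixes F G :: "complex \<Rightarrow> complex"
  assumes G: "continuous_on (cball 0 1) G"
    and der: "\<And>x. x \<in> cball 0 1 \<Longrightarrow> (F has_field_derivative G x) (at x within cball 0 1)"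
    and inj: "inj_on F (cball 0 1)" and nz: "\<And>x. x \<in> cball 0 1 \<Longrightarrow> G x \<noteq> 0"
  obtains c C where "0 < c" "0 < C"
    "\<And>x y. x \<in> cball 0 1 \<Longrightarrow> y \<in> cball 0 1 \<Longrightarrow> c * dist x y \<le> dist (F x) (F y)"
    "\<And>x y. x \<in> cball 0 1 \<Longrightarrow> y \<in> cball 0 1 \<Longrightarrow> dist (F x) (F y) \<le> C * dist x y"
proof -
  let ?B = "cball (0::complex) 1"
  obtain D where D: "continuous_on (?B \<times> ?B) D" "\<And>x. x \<in> ?B \<Longrightarrow> D (x, x) = G x"
    "\<And>x y. x \<in> ?B \<Longrightarrow> y \<in> ?B \<Longrightarrow> F y - F x = D (x, y) * (y - x)"
    using divided_difference_cball[OF G der] by blast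
  have cB: "compact (?B \<times> ?B)" "?B \<times> ?B \<noteq> {}" by (auto intro: compact_Times)
  have cD: "continuous_on (?B \<times> ?B) (\<lambda>p. norm (D p))" by (intro continuous_intros D)
  obtain p where p: "p \<in> ?B \<times> ?B" "\<And>q. q \<in> ?B \<times> ?B \<Longrightarrow> norm (D p) \<le> norm (D q)"
    using continuous_attains_inf[OF cB cD] by blast
  obtain p' where p': "p' \<in> ?B \<times> ?B" "\<And>q. q \<in> ?B \<times> ?B \<Longrightarrow> norm (D q) \<le> norm (D p')"
    using continuous_attains_sup[OF cB cD] by blast
  have Dnz: "D q \<noteq> 0" if q: "q \<in> ?B \<times> ?B" for q
  proof (cases "fst q = snd q")
    case True
    then show ?thesis using D(2)[of "fst q"] nz q by (cases q) auto
  next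
    case False
    then have "F (snd q) - F (fst q) \<noteq> 0" using inj q by (auto simp: inj_on_def)
    then show ?thesis using D(3)[of "fst q" "snd q"] q by (cases q) auto
  qed
  have eq: "dist (F x) (F y) = norm (D (x, y)) * dist x y" if "x \<in> ?B" "y \<in> ?B" for x y
    using D(3)[OF that] by (simp add: dist_norm norm_minus_commute[of "F x"] norm_minus_commute[of x] norm_mult)
  show ?thesis
  proof (rule that[of "norm (D p)" "norm (D p')"])
    show "0 < norm (D p)" "0 < norm (D p')" using Dnz p p' by auto
    fix x y assume xy: "x \<in> ?B" "y \<in> ?B"
    show "norm (D p) * dist x y \<le> dist (F x) (F y)" "dist (F x) (F y) \<le> norm (D p') * dist x y"
      unfolding eq[OF xy] using p(2)[of "(x,y)"] p'(2)[of "(x,y)"] xy by (auto intro: mult_right_mono)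
  qed
qed

text \<open>The imaginary part is \<open>(L - cnj L) / (2 * \<i>)\<close>. The first summand is
  Cauchy's formula for the derivative. The second contributes nothing: on the circle conjugation is
  inversion, and the conjugate of its integral is minus the integral of a function holomorphic in
  the disc.\<close>

lemma deriv_eq_Schwarz_integral:
  fixes L :: "complex \<Rightarrow> complex"
  assumes L: "continuous_on (cball 0 1) L" and hol: "L holomorphic_on ball 0 1" and z: "norm z < 1"
  shows "((\<lambda>s. of_real (Im (L s)) / (s - z)^2) has_contour_integral pi * deriv L z) (circlepath 0 1)"
proof -
  have zb: "z \<in> ball 0 1" using z by simp
  have nz: "s - z \<noteq> 0" if "norm s = 1" for s using that z by auto
  have cL: "continuous_on (sphere 0 1) L" by (rule continuous_on_subset[OF L]) auto
  have C1: "((\<lambda>s. L s / (s - z)^2) has_contour_integral 2 * pi * \<i> * deriv L z) (circlepath 0 1)"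
    using Cauchy_has_contour_integral_higher_derivative_circlepath[OF L hol zb, of 1]
    by (simp add: numeral_2_eq_2)
  have ci: "(\<lambda>s. cnj (L s) / (s - z)^2) contour_integrable_on (circlepath 0 1)"
    by (rule contour_integrable_continuous_circlepath)
       (use nz in \<open>auto intro!: continuous_intros cL\<close>)
  have nz': "1 - cnj z * s \<noteq> 0" if "norm s \<le> 1" for s
  proof
    assume "1 - cnj z * s = 0"
    then have "norm (cnj z * s) = 1" by simp
    moreover have "norm (cnj z * s) \<le> norm z * 1"
      unfolding norm_mult using that by (intro mult_mono) auto
    ultimately show False using z by simp
  qed
  have C2: "((\<lambda>s. L s / (1 - cnj z * s)^2) has_contour_integral 0) (circlepath 0 1)"
  proof (rule Cauchy_theorem_convex[where S = "cball 0 1" and K = "{}"])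
    show "continuous_on (cball 0 1) (\<lambda>s. L s / (1 - cnj z * s)\<^sup>2)"
      using nz' by (intro continuous_intros L) auto
    fix x :: complex assume "x \<in> interior (cball 0 1) - {}"
    then have x: "x \<in> ball 0 1" by simp
    have "(\<lambda>s. L s / (1 - cnj z * s)\<^sup>2) holomorphic_on ball 0 1"
      using nz' by (intro holomorphic_intros hol) (auto simp: less_imp_le)
    then show "(\<lambda>s. L s / (1 - cnj z * s)\<^sup>2) field_differentiable at x"
      using x by (auto simp: holomorphic_on_imp_differentiable_at)
  qed auto
  let ?e = "circlepath 0 1"
  note vd = vector_derivative_unit_circlepath
  have "cnj (contour_integral ?e (\<lambda>s. cnj (L s) / (s - z)^2))
      = integral {0..1} (\<lambda>t. cnj (cnj (L (?e t)) / (?e t - z)^2 * vector_derivative ?e (at t)))"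
    by (simp add: contour_integral_integral integral_cnj)
  also have "\<dots> = integral {0..1} (\<lambda>t. - (L (?e t) / (1 - cnj z * ?e t)^2 * vector_derivative ?e (at t)))"
  proof (rule integral_cong)
    fix t :: real assume "t \<in> {0..1}"
    define s where "s = ?e t"
    have s: "norm s = 1" by (simp add: s_def circlepath)
    then have s0: "s \<noteq> 0" and cs: "cnj s = 1 / s"
      by (auto simp: complex_div_cnj[of 1 s])
    have "cnj (cnj (L s) / (s - z)^2 * (2 * pi * \<i> * s)) = L s / (1 / s - cnj z)^2 * (- 2 * pi * \<i> / s)"
      by (simp add: cs)
    also have "1 / s - cnj z = (1 - cnj z * s) / s" using s0 by (simp add: field_simps)
    also have "L s / ((1 - cnj z * s) / s)^2 * (- 2 * pi * \<i> / s)
        = - (L s / (1 - cnj z * s)^2 * (2 * pi * \<i> * s))"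
      using s0 nz'[of s] s by (simp add: power_divide field_simps power2_eq_square)
    finally show "cnj (cnj (L (?e t)) / (?e t - z)^2 * vector_derivative ?e (at t))
      = - (L (?e t) / (1 - cnj z * ?e t)^2 * vector_derivative ?e (at t))"
      by (simp add: vd s_def)
  qed
  also have "\<dots> = 0"
    using contour_integral_unique[OF C2] by (simp add: contour_integral_integral)
  finally have "contour_integral ?e (\<lambda>s. cnj (L s) / (s - z)^2) = 0" by simp
  then have C3: "((\<lambda>s. cnj (L s) / (s - z)^2) has_contour_integral 0) ?e"
    using has_contour_integral_integral[OF ci] by simp
  have "((\<lambda>s. (L s / (s - z)^2 - cnj (L s) / (s - z)^2) / (2 * \<i>)) has_contour_integral
         (2 * pi * \<i> * deriv L z - 0) / (2 * \<i>)) ?e"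
    by (intro has_contour_integral_div has_contour_integral_diff C1 C3)
  moreover have "(L s / (s - z)^2 - cnj (L s) / (s - z)^2) / (2 * \<i>) = of_real (Im (L s)) / (s - z)^2" for s
  proof -
    have "L s - cnj (L s) = 2 * \<i> * of_real (Im (L s))" by (simp add: complex_eq_iff)
    then show ?thesis by (simp add: diff_divide_distrib[symmetric])
  qed
  moreover have "(2 * pi * \<i> * deriv L z - 0) / (2 * \<i>) = pi * deriv L z" by (simp add: field_simps)
  ultimately show ?thesis by (simp only:)
qed

section \<open>Boundary injectivity of conformal maps onto Jordan domains\<close>

lemma sphere_eq_mult_cis:
  fixes a s :: complex
  assumes "norm a = 1" "norm s = 1"
  obtains t where "0 \<le> t" "t < 2 * pi" "s = a * cis t"
proof -
  define t where "t = Arg2pi (s / a)"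
  have "a \<noteq> 0" using assms by auto
  have "s / a = cis t"
    using Arg2pi_eq[of "s / a"] assms by (simp add: t_def norm_divide cis_conv_exp)
  then have "a * cis t = a * (s / a)" by (simp only:)
  then have "s = a * cis t" using \<open>a \<noteq> 0\<close> by simp
  moreover have "0 \<le> t" "t < 2 * pi" using Arg2pi[of "s / a"] by (simp_all add: t_def)
  ultimately show ?thesis using that by blast
qed

text \<open>A product \<open>P\<close> of sufficiently many rotated copies of \<open>F - p\<close>
  vanishes on the whole circle, hence in the disc by the maximum modulus principle. But each factor
  has at most one zero there, by injectivity.\<close>

lemma no_boundary_constant_arc:
  fixes F :: "complex \<Rightarrow> complex"
  assumes F: "continuous_on (cball 0 1) F" and hol: "F holomorphic_on ball 0 1"
    and inj: "inj_on F (ball 0 1)" and a: "norm a = 1" and lh: "lo < hi"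
    and const: "\<And>t. lo < t \<Longrightarrow> t < hi \<Longrightarrow> F (a * cis t) = p"
  shows False
proof -
  obtain n :: nat where n: "2 * pi / (hi - lo) < real n" using reals_Archimedean2 by blast
  have "0 < 2 * pi / (hi - lo)" using lh by simp
  then have n0: "0 < n" using n by (metis less_trans of_nat_0_less_iff)
  have nn: "2 * pi / n < hi - lo" using n n0 lh by (simp add: field_simps)
  define c where "c = (\<lambda>k::nat. cis (2 * pi * k / n))"
  define P where "P = (\<lambda>z. \<Prod>k<n. (F (z * c k) - p))"
  have nc: "norm (c k) = 1" for k by (simp add: c_def)
  have cP: "continuous_on (cball 0 1) P"
    unfolding P_def
    by (intro continuous_on_prod continuous_on_diff continuous_on_const continuous_on_compose2[OF F] continuous_intros)
       (auto simp: norm_mult nc)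
  have hP: "P holomorphic_on ball 0 1"
  proof -
    have "(\<lambda>z. F (z * c k)) holomorphic_on ball 0 1" for k
      by (rule holomorphic_on_compose_gen[OF _ hol, of "\<lambda>z. z * c k" "ball 0 1", unfolded o_def])
         (auto simp: norm_mult nc intro!: holomorphic_intros)
    then show ?thesis unfolding P_def by (intro holomorphic_on_prod holomorphic_on_diff holomorphic_on_const)
  qed
  have "\<exists>k<n. F (s * c k) = p" if s: "norm s = 1" for s
  proof -
    obtain \<theta> where sa: "s = a * cis \<theta>" using sphere_eq_mult_cis[OF a s] by blast
    \<comment> \<open>\<open>j\<close> is the least integer with
      \<open>\<theta> + 2 * pi * j / n\<close> beyond \<open>lo\<close>; the step
      \<open>2 * pi / n\<close> is shorter than the arc, so this angle has not yet reached
      \<open>hi\<close>. Reduction modulo \<open>n\<close> selects the factor of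
      \<open>P\<close>.\<close>
    define j where "j = \<lfloor>(lo - \<theta>) * n / (2 * pi)\<rfloor> + 1"
    have j1: "(lo - \<theta>) * n / (2 * pi) < of_int j" unfolding j_def by linarith
    have j2: "of_int j \<le> (lo - \<theta>) * n / (2 * pi) + 1" by (simp add: j_def)
    have "lo - \<theta> < 2 * pi * of_int j / n" using j1 n0 by (simp add: field_simps)
    moreover have "2 * pi * of_int j / n \<le> lo - \<theta> + 2 * pi / n" using j2 n0 by (simp add: field_simps)
    ultimately have in_arc: "lo < \<theta> + 2 * pi * of_int j / n" "\<theta> + 2 * pi * of_int j / n < hi"
      using nn by linarith+
    define k where "k = nat (j mod int n)"
    have k: "k < n" "int k = j mod int n" using n0 by (auto simp: k_def nat_less_iff)
    have "real_of_int j = real n * of_int (j div int n) + real k"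
    proof -
      have "j = int n * (j div int n) + int k" using k by simp
      then show ?thesis by (metis of_int_add of_int_mult of_int_of_nat_eq)
    qed
    then have "2 * pi * of_int j / n = 2 * pi * of_int (j div int n) + 2 * pi * k / n"
      using n0 by (simp add: field_simps)
    then have "cis (2 * pi * of_int j / n) = c k"
      by (simp add: c_def cis_mult[symmetric])
    then have "s * c k = a * cis (\<theta> + 2 * pi * of_int j / n)"
      by (simp add: sa cis_mult[symmetric])
    then show ?thesis using const[OF in_arc] k by auto
  qed
  then have P0: "P s = 0" if "norm s = 1" for s
    using that n0 by (fastforce simp: P_def)
  have "P z = 0" if z: "z \<in> ball 0 1" for z
  proof -
    have "norm (P z) \<le> 0"
      by (rule maximum_modulus_frontier[where S = "cball 0 1" and f = P])
         (use hP cP P0 z in \<open>auto simp: frontier_cball\<close>)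
    then show ?thesis by simp
  qed
  then have "ball 0 1 \<subseteq> (\<Union>k<n. (\<lambda>z. F (z * c k)) -` {p} \<inter> ball 0 1)"
    by (fastforce simp: P_def)
  moreover have "finite ((\<lambda>z. F (z * c k)) -` {p} \<inter> ball 0 1)" for k
  proof (rule finite_vimage_IntI)
    show "inj_on (\<lambda>z. F (z * c k)) (ball 0 1)"
    proof (rule inj_onI)
      fix x y assume xy: "x \<in> ball 0 1" "y \<in> ball 0 1" "F (x * c k) = F (y * c k)"
      then have "x * c k = y * c k" by (intro inj_onD[OF inj xy(3)]) (auto simp: norm_mult nc)
      moreover have "c k \<noteq> 0" by (simp add: c_def)
      ultimately show "x = y" by simp
    qed
  qed simp
  ultimately have "finite (ball (0::complex) 1)"
    by (meson finite_UN finite_lessThan finite_subset)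
  then show False using finite_imp_not_open[of "ball (0::complex) 1"] by simp
qed

lemma cis_eq_imp_eq:
  assumes "cis t = cis t'" "\<bar>t - t'\<bar> < 2 * pi"
  shows "t = t'"
proof -
  have "cis (t - t') = 1" using assms(1) by (simp add: cis_divide[symmetric])
  then have "cos (t - t') = 1" by (simp add: complex_eq_iff)
  then obtain n :: int where n: "t - t' = n * 2 * pi" by (auto simp: cos_one_2pi_int)
  then have "\<bar>real_of_int n\<bar> * (2 * pi) < 1 * (2 * pi)" using assms(2) by (simp add: abs_mult)
  then have "\<bar>real_of_int n\<bar> < 1" by (subst (asm) mult_less_cancel_right_pos) auto
  then have "n = 0" by linarith
  then show ?thesis using n by simp
qed

lemma connected_circle_minus_point:
  fixes a :: complex
  assumes "norm a = 1"
  shows "connected (sphere 0 1 - {a})"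
proof -
  have "sphere 0 1 - {a} = (\<lambda>t. a * cis t) ` {0<..<2*pi}"
  proof (intro equalityI subsetI)
    fix s assume s: "s \<in> sphere 0 1 - {a}"
    obtain t where t: "0 \<le> t" "t < 2 * pi" "s = a * cis t"
      using sphere_eq_mult_cis[OF assms, of s] s by auto
    moreover have "t \<noteq> 0" using s t by auto
    ultimately show "s \<in> (\<lambda>t. a * cis t) ` {0<..<2*pi}"
      by (intro image_eqI[of _ _ t]) auto
  next
    fix s assume "s \<in> (\<lambda>t. a * cis t) ` {0<..<2*pi}"
    then obtain t where t: "0 < t" "t < 2*pi" "s = a * cis t" by auto
    moreover have "cis t \<noteq> 1" using cis_eq_imp_eq[of t 0] t by auto
    ultimately show "s \<in> sphere 0 1 - {a}" using assms by (auto simp: norm_mult)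
  qed
  then show ?thesis by (auto intro!: connected_continuous_image continuous_intros)
qed

text \<open>A boundary identification \<open>F a = F b\<close> makes the image of the two radii a Jordan curve \<open>K\<close> that
  meets the boundary curve only in \<open>F a\<close>; the image sectors lie on different sides of \<open>K\<close>, the boundary
  curve on one side only, so \<open>F\<close> collapses one of the two boundary arcs.\<close>

lemma inj_on_cball_of_Jordan_boundary:
  fixes F e :: "complex \<Rightarrow> complex"
  assumes F: "continuous_on (cball 0 1) F" and hol: "F holomorphic_on ball 0 1"
    and inj: "inj_on F (ball 0 1)"
    and e: "continuous_on (sphere 0 1) e" "inj_on e (sphere 0 1)"
    and bdry: "F ` sphere 0 1 \<subseteq> e ` sphere 0 1" and disj: "F ` ball 0 1 \<inter> e ` sphere 0 1 = {}"
  shows "inj_on F (cball 0 1)"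
proof -
  have circ: "a = b" if a: "norm a = 1" and b: "norm b = 1" and ab: "F a = F b" for a b
  proof (rule ccontr)
    assume "a \<noteq> b"
    obtain \<tau> where \<tau>: "0 \<le> \<tau>" "\<tau> < 2 * pi" "b = a * cis \<tau>"
      using sphere_eq_mult_cis[OF a b] by blast
    have \<tau>0: "0 < \<tau>" using \<tau> \<open>a \<noteq> b\<close> by (cases "\<tau> = 0") auto
    have a0: "a \<noteq> 0" and b0: "b \<noteq> 0" using a b by auto
    define p where "p = F a"
    have "F a \<in> F ` sphere 0 1" using a by (intro imageI) simp
    then have "p \<in> e ` sphere 0 1" unfolding p_def by (rule subsetD[OF bdry])
    \<comment> \<open>Removing the parameter \<open>s1\<close> of \<open>p\<close> leaves a
      connected part of the boundary curve that avoids \<open>K\<close> and so lies on one side of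
      it.\<close>
    then obtain s1 where s1: "p = e s1" "s1 \<in> sphere 0 1" by (rule imageE)
    define g where "g = linepath a 0 +++ linepath 0 b"
    define Sg where "Sg = closed_segment a 0 \<union> closed_segment 0 b"
    have Sg: "x \<in> Sg \<longleftrightarrow> (\<exists>r. 0 \<le> r \<and> r \<le> 1 \<and> (x = of_real r * a \<or> x = of_real r * b))" for x
    proof -
      have "x \<in> closed_segment a 0 \<longleftrightarrow> (\<exists>r. 0 \<le> r \<and> r \<le> 1 \<and> x = of_real r * a)"
        by (subst closed_segment_commute) (auto simp: in_segment scaleR_conv_of_real)
      moreover have "x \<in> closed_segment 0 b \<longleftrightarrow> (\<exists>r. 0 \<le> r \<and> r \<le> 1 \<and> x = of_real r * b)"
        by (auto simp: in_segment scaleR_conv_of_real)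
      ultimately show ?thesis by (auto simp: Sg_def)
    qed
    have pig: "path_image g = Sg"
      by (simp add: g_def Sg_def path_image_join)
    have Sgb: "x \<in> ball 0 1 \<or> x = a \<or> x = b" if x: "x \<in> Sg" for x
    proof -
      obtain r where r: "0 \<le> r" "r \<le> 1" "x = of_real r * a \<or> x = of_real r * b"
        using x Sg by blast
      then show ?thesis using a b by (cases "r = 1") (auto simp: norm_mult)
    qed
    have arcg: "arc g"
      unfolding g_def
    proof (rule arc_join)
      show "arc (linepath a 0)" "arc (linepath 0 b)" using a0 b0 by (auto intro: arc_linepath)
      show "path_image (linepath a 0) \<inter> path_image (linepath 0 b) \<subseteq> {pathstart (linepath 0 b)}"
      proof clarsimp
        fix x assume x: "x \<in> closed_segment a 0" "x \<in> closed_segment 0 b"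
        obtain u where u: "0 \<le> u" "x = of_real u * a"
          using x(1) by (subst (asm) closed_segment_commute) (auto simp: in_segment scaleR_conv_of_real)
        obtain v where v: "0 \<le> v" "x = of_real v * b"
          using x(2) by (auto simp: in_segment scaleR_conv_of_real)
        have "u = v" using u v a b by (metis abs_of_nonneg mult.right_neutral norm_mult norm_of_real)
        then show "x = 0" using u v \<open>a \<noteq> b\<close> by auto
      qed
    qed simp
    have g01: "g 0 = a" "g 1 = b" by (simp_all add: g_def joinpaths_def linepath_def)
    define c where "c = F \<circ> g"
    define K where "K = path_image c"
    have K: "K = F ` Sg" by (simp add: K_def c_def path_image_compose pig)
    have Sgc: "Sg \<subseteq> cball 0 1" using Sgb a b by fastforce
    have pnb: "p \<notin> F ` ball 0 1" using disj bdry a by (force simp: p_def)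
    have "simple_path c"
      unfolding simple_path_def
    proof
      show "path c" unfolding c_def
        by (rule path_continuous_image) (use arcg F Sgc pig in \<open>auto simp: arc_imp_path intro: continuous_on_subset\<close>)
      show "loop_free c"
        unfolding loop_free_def
      proof (intro ballI impI)
        fix x y :: real assume xy: "x \<in> {0..1}" "y \<in> {0..1}" "c x = c y"
        have ginj: "u = v" if "u \<in> {0..1}" "v \<in> {0..1}" "g u = g v" for u v
          using arcg that by (auto simp: arc_def inj_on_def)
        have gS: "g x \<in> Sg" "g y \<in> Sg" using xy pig by (auto simp: path_image_def)
        have Fxy: "F (g x) = F (g y)" using xy by (simp add: c_def)
        have pp: "F a = p" "F b = p" using ab by (simp_all add: p_def)
        have ends: "t = 0 \<or> t = 1" if "t \<in> {0..1}" "g t = a \<or> g t = b" for t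
          using ginj[of t 0] ginj[of t 1] that g01 by auto
        show "x = y \<or> x = 0 \<and> y = 1 \<or> x = 1 \<and> y = 0"
        proof (cases "g x \<in> ball 0 1 \<and> g y \<in> ball 0 1")
          case True
          then have "g x = g y" using Fxy inj by (auto simp: inj_on_def)
          then show ?thesis using ginj xy by auto
        next
          case False
          then have "g x \<notin> ball 0 1 \<and> g y \<notin> ball 0 1"
            using Sgb[OF gS(1)] Sgb[OF gS(2)] Fxy pp pnb by (metis imageI)
          then have "g x = a \<or> g x = b" "g y = a \<or> g y = b"
            using Sgb[OF gS(1)] Sgb[OF gS(2)] by auto
          then show ?thesis using ends xy by blast
        qed
      qed
    qed
    moreover have "pathfinish c = pathstart c"
      using ab g01 by (simp add: c_def pathfinish_def pathstart_def)
    ultimately have J: "open (inside K)" "open (outside K)" "frontier (inside K) = K" "frontier (outside K) = K"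
      using Jordan_inside_outside[of c] by (auto simp: K_def)
    have IO: "inside K \<inter> outside K = {}" "inside K \<union> outside K = - K" 
      by (auto simp: inside_Int_outside inside_Un_outside)
    have side: "X \<subseteq> inside K \<or> X \<subseteq> outside K" if "connected X" "X \<inter> K = {}" for X
      using connectedD[OF that(1) J(1,2)] IO that(2) by blast
    define S where "S = (\<lambda>lo hi. (\<lambda>q. of_real (fst q) * a * cis (snd q)) ` ({0<..<1::real} \<times> {lo<..<hi}))"
    have conS: "connected (F ` S lo hi)" for lo hi
    proof -
      have Sb: "S lo hi \<subseteq> ball 0 1" using a by (auto simp: S_def norm_mult)
      have "connected (S lo hi)" unfolding S_def
        by (rule connected_continuous_image) (auto intro!: continuous_intros connected_Times)
      then show ?thesis
        by (rule connected_continuous_image[rotated]) (rule continuous_on_subset[OF F], use Sb in auto)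
    qed
    have disS: "F ` S lo hi \<inter> K = {}" if lh: "0 \<le> lo" "hi \<le> 2 * pi" "\<tau> \<le> lo \<or> hi \<le> \<tau>" for lo hi
    proof -
      have "F x \<noteq> F y" if x: "x \<in> S lo hi" and y: "y \<in> Sg" for x y
      proof
        assume eq: "F x = F y"
        obtain r t where rt: "0 < r" "r < 1" "lo < t" "t < hi" "x = of_real r * a * cis t"
          using x by (auto simp: S_def)
        have xb: "x \<in> ball 0 1" using rt a by (simp add: norm_mult)
        have "y \<in> ball 0 1"
        proof (rule ccontr)
          assume "y \<notin> ball 0 1"
          then have "F y = p" using Sgb[OF y] ab by (auto simp: p_def)
          then show False using eq pnb xb by (metis imageI)
        qed
        then have xy: "x = y" using eq inj xb by (auto simp: inj_on_def)
        obtain u where u: "0 \<le> u" "y = of_real u * a \<or> y = of_real u * b" using y Sg by blast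
        have "norm x = r" "norm y = u" using rt u a b by (auto simp: norm_mult)
        then have "u = r" using xy by simp
        then have "cis t = cis 0 \<or> cis t = cis \<tau>" using u rt xy a0 \<tau> by auto
        then show False
          using cis_eq_imp_eq[of t 0] cis_eq_imp_eq[of t \<tau>] rt lh \<tau> \<tau>0 by auto
      qed
      then show ?thesis unfolding K by blast
    qed
    note dis1 = disS[of 0 \<tau>] and dis2 = disS[of \<tau> "2 * pi"]
    have cover: "x \<in> Sg \<or> x \<in> S 0 \<tau> \<or> x \<in> S \<tau> (2*pi)" if x: "x \<in> ball 0 1" for x
    proof (cases "x = 0")
      case True
      have "x \<in> Sg" unfolding Sg using True by (intro exI[of _ 0]) simp
      then show ?thesis ..
    next
      case False
      obtain s where s: "s \<in> sphere 0 1" "x = of_real (norm x) * s"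
        using circle_point_radial[of x] x by auto
      obtain t where t: "0 \<le> t" "t < 2 * pi" "s = a * cis t"
        using sphere_eq_mult_cis[OF a, of s] s(1) by auto
      have "0 < norm x" "norm x < 1" using False x by auto
      then obtain r where r: "0 < r" "r < 1" "x = of_real r * s" using s(2) by blast
      consider "t = 0" | "t = \<tau>" | "0 < t" "t < \<tau>" | "\<tau> < t" using t by linarith
      then show ?thesis
      proof cases
        case 1
        have "x \<in> Sg" unfolding Sg using 1 r t by (intro exI[of _ r]) simp
        then show ?thesis ..
      next
        case 2
        have "x \<in> Sg" unfolding Sg using 2 r t \<tau>(3) by (intro exI[of _ r]) simp
        then show ?thesis ..
      next
        case 3 then show ?thesis using r t unfolding S_def
          by (intro disjI2 disjI1 image_eqI[of _ _ "(r, t)"]) auto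
      next
        case 4 then show ?thesis using r t unfolding S_def
          by (intro disjI2 image_eqI[of _ _ "(r, t)"]) auto
      qed
    qed
    \<comment> \<open>The point \<open>F (a / 2)\<close> of \<open>K\<close> is a limit of points of
      \<open>W\<close> and has the open image of the disc as a neighbourhood, so this image meets
      \<open>W\<close> off \<open>K\<close>. The two image sectors therefore cannot both lie in
      \<open>V\<close>.\<close>
    have notboth: False
      if V: "F ` S 0 \<tau> \<subseteq> V" "F ` S \<tau> (2*pi) \<subseteq> V" "V \<inter> W = {}" "W \<inter> K = {}" "frontier W = K" for V W
    proof -
      define q where "q = F (a / 2)"
      have "a / 2 \<in> Sg" using Sg[of "a/2"] by (auto intro!: exI[of _ "1/2"])
      then have "q \<in> frontier W" using V K by (auto simp: q_def)
      then have qW: "q \<in> closure W" by (simp add: frontier_def)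
      have "open (F ` ball 0 1)" by (rule open_mapping_thm3[OF hol _ inj]) simp
      moreover have "q \<in> F ` ball 0 1" unfolding q_def using a by (intro imageI) (simp add: norm_divide)
      ultimately have "F ` ball 0 1 \<inter> W \<noteq> {}"
        using qW open_Int_closure_eq_empty by blast
      then obtain x where x: "x \<in> ball 0 1" "F x \<in> W" by blast
      have "F x \<notin> K" using x V(4) by blast
      then have "x \<notin> Sg" unfolding K by blast
      then have "F x \<in> V" using cover[OF x(1)] V(1,2) by blast
      then show False using x V(3) by blast
    qed
    \<comment> \<open>On the arc, \<open>F\<close> is a limit of values in \<open>V\<close>, so it
      lies in \<open>V\<close> or on \<open>K\<close>. It also lies on the boundary curve, which
      apart from \<open>p\<close> is in \<open>W\<close>; only \<open>p\<close> remains.\<close>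
    have arc_const: False
      if lh: "0 \<le> lo" "lo < hi" and V: "F ` S lo hi \<subseteq> V" "V \<inter> W = {}" "frontier V = K"
        and Z: "e ` (sphere 0 1 - {s1}) \<subseteq> W" "W \<inter> K = {}" for V W lo hi
    proof (rule no_boundary_constant_arc[OF F hol inj a lh(2)])
      fix t assume t: "lo < t" "t < hi"
      have "a * cis t \<in> closure (S lo hi)"
      proof (rule closure_approachable[THEN iffD2], intro allI impI)
        fix \<epsilon> :: real assume "0 < \<epsilon>"
        define r where "r = max (1/2) (1 - \<epsilon>/2)"
        have r: "0 < r" "r < 1" "1 - r < \<epsilon>" using \<open>0 < \<epsilon>\<close> by (auto simp: r_def)
        have "of_real r * a * cis t \<in> S lo hi"
          unfolding S_def using r t by (intro image_eqI[of _ _ "(r, t)"]) auto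
        moreover have "dist (of_real r * a * cis t) (a * cis t) < \<epsilon>"
        proof -
          have "of_real r * a * cis t - a * cis t = of_real (r - 1) * (a * cis t)" by (simp add: algebra_simps)
          then show ?thesis using r a by (simp only: dist_norm norm_mult norm_of_real) simp
        qed
        ultimately show "\<exists>y\<in>S lo hi. dist y (a * cis t) < \<epsilon>" by blast
      qed
      moreover have "closure (S lo hi) \<subseteq> cball 0 1"
        by (rule closure_minimal) (use a in \<open>auto simp: S_def norm_mult\<close>)
      ultimately have "F (a * cis t) \<in> closure (F ` S lo hi)"
        using continuous_image_closure_subset[OF F] by blast
      then have "F (a * cis t) \<in> V \<union> K"
        using closure_mono[OF V(1)] V(3) closure_Un_frontier[of V] by auto
      moreover have "F (a * cis t) \<in> e ` sphere 0 1" using bdry a by (auto simp: norm_mult)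
      ultimately show "F (a * cis t) = p" using Z V s1 by blast
    qed
    have "connected (e ` (sphere 0 1 - {s1}))"
    proof (rule connected_continuous_image)
      show "continuous_on (sphere 0 1 - {s1}) e" by (rule continuous_on_subset[OF e(1)]) auto
      show "connected (sphere 0 1 - {s1})" by (rule connected_circle_minus_point) (use s1 in simp)
    qed
    moreover have "e ` (sphere 0 1 - {s1}) \<inter> K = {}"
    proof -
      have "F x \<in> F ` ball 0 1 \<union> {p}" if "x \<in> Sg" for x
      proof (cases "x \<in> ball 0 1")
        case False
        then have "F x = p" using Sgb[OF that] ab by (auto simp: p_def)
        then show ?thesis by simp
      qed (intro UnI1 imageI)
      then have "K \<subseteq> F ` ball 0 1 \<union> {p}" unfolding K by blast
      moreover have "p \<notin> e ` (sphere 0 1 - {s1})"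
        unfolding s1(1) using inj_on_image_mem_iff[OF e(2) s1(2), of "sphere 0 1 - {s1}"] by simp
      ultimately show ?thesis using disj by blast
    qed
    ultimately have Z: "e ` (sphere 0 1 - {s1}) \<subseteq> inside K \<or> e ` (sphere 0 1 - {s1}) \<subseteq> outside K"
      by (rule side)
    have X1: "F ` S 0 \<tau> \<subseteq> inside K \<or> F ` S 0 \<tau> \<subseteq> outside K"
      by (rule side[OF conS dis1]) (use \<tau> in auto)
    have X2: "F ` S \<tau> (2*pi) \<subseteq> inside K \<or> F ` S \<tau> (2*pi) \<subseteq> outside K"
      by (rule side[OF conS dis2]) (use \<tau> in auto)
    have IK: "inside K \<inter> K = {}" "outside K \<inter> K = {}" "outside K \<inter> inside K = {}"
      using IO by (blast, blast, simp add: Int_commute)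
    \<comment> \<open>\<open>nb\<close> puts the image sectors on different sides, so one of them is
      opposite to the boundary curve, and \<open>ac1\<close> or \<open>ac2\<close> collapses its
      arc.\<close>
    note nb = notboth[OF _ _ IO(1) IK(2) J(4)] notboth[OF _ _ IK(3) IK(1) J(3)]
    note ac1 = arc_const[OF order_refl \<tau>0 _ IO(1) J(3) _ IK(2)] arc_const[OF order_refl \<tau>0 _ IK(3) J(4) _ IK(1)]
    note ac2 = arc_const[OF \<tau>(1,2) _ IO(1) J(3) _ IK(2)] arc_const[OF \<tau>(1,2) _ IK(3) J(4) _ IK(1)]
    show False using X1 X2 Z nb ac1 ac2 by argo
  qed
  have mixed: "F x \<noteq> F y" if "norm x < 1" "norm y = 1" for x y
  proof
    assume "F x = F y"
    moreover have "F x \<in> F ` ball 0 1" by (rule imageI) (use that in simp)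
    moreover have "F y \<in> F ` sphere 0 1" by (rule imageI) (use that in simp)
    ultimately show False using bdry disj by auto
  qed
  show ?thesis
  proof (rule inj_onI)
    fix x y assume xy: "x \<in> cball 0 1" "y \<in> cball 0 1" "F x = F y"
    consider "norm x < 1" "norm y < 1" | "norm x = 1" "norm y = 1"
      | "norm x < 1" "norm y = 1" | "norm x = 1" "norm y < 1" using xy(1,2) by fastforce
    then show "x = y"
    proof cases
      case 1 then show ?thesis using inj_onD[OF inj xy(3)] by simp
    next
      case 2 then show ?thesis using circ xy(3) by blast
    next
      case 3 then show ?thesis using mixed xy(3) by blast
    next
      case 4 then show ?thesis using mixed[of y x] xy(3) by simp
    qed
  qed
qed

section \<open>The tangent angle\<close>

text \<open>Glues the value at a removable singularity to the formula valid elsewhere; both pieces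
  are relatively open in the closed disc.\<close>

lemma continuous_on_cball_puncture:
  fixes Q :: "complex \<Rightarrow> complex"
  assumes "continuous_on (ball 0 1) Q" "continuous_on (cball 0 1 - {0}) Q"
  shows "continuous_on (cball 0 1) Q"
proof -
  have un: "ball (0::complex) 1 \<union> (cball 0 1 - {0}) = cball 0 1" by auto
  have "continuous_on (ball 0 1 \<union> (cball 0 1 - {0})) Q"
  proof (rule continuous_on_Un_local_open)
    show "openin (top_of_set (ball 0 1 \<union> (cball 0 1 - {0}))) (ball (0::complex) 1)"
      by (rule open_subset) (auto simp: un)
    show "openin (top_of_set (ball 0 1 \<union> (cball 0 1 - {0}))) (cball 0 1 - {0::complex})"
    proof -
      have "open (- {0::complex})" by (intro open_Compl closed_singleton)
      from openin_open_Int[OF this, of "cball 0 1"] show ?thesis unfolding un by (simp add: Diff_eq)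
    qed
  qed (use assms in auto)
  then show ?thesis by (simp only: un)
qed

lemma quotient_by_identity:
  fixes k :: "complex \<Rightarrow> complex"
  assumes k: "continuous_on (cball 0 1) k" "k holomorphic_on ball 0 1" "k 0 = 0"
  obtains Q where "continuous_on (cball 0 1) Q" "Q holomorphic_on ball 0 1" "Q 0 = deriv k 0"
    "\<And>z. k z = z * Q z" "\<And>z. z \<noteq> 0 \<Longrightarrow> Q z = k z / z"
proof -
  define Q where "Q = (\<lambda>z. if z = 0 then deriv k 0 else (k z - k 0) / (z - 0))"
  have hol: "Q holomorphic_on ball 0 1"
    unfolding Q_def by (rule pole_lemma[OF k(2)]) auto
  have "continuous_on (cball 0 1 - {0}) (\<lambda>z. k z / z)"
    by (intro continuous_intros continuous_on_subset[OF k(1)]) auto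
  then have "continuous_on (cball 0 1 - {0}) Q"
    by (rule continuous_on_eq) (auto simp: Q_def k(3))
  with holomorphic_on_imp_continuous_on[OF hol] have "continuous_on (cball 0 1) Q"
    by (rule continuous_on_cball_puncture)
  then show ?thesis by (rule that[OF _ hol]) (auto simp: Q_def k(3))
qed

text \<open>Near \<open>z\<close> the function \<open>L\<close> is the principal logarithm of
  \<open>q w / q z\<close> plus \<open>L z\<close>: continuity keeps the imaginary part of
  \<open>L w - L z\<close> inside the principal strip.\<close>

lemma holomorphic_on_continuous_logarithm:
  fixes L q :: "complex \<Rightarrow> complex"
  assumes S: "open S" and L: "continuous_on S L" and q: "q holomorphic_on S"
    and eq: "\<And>z. z \<in> S \<Longrightarrow> q z = exp (L z)"
  shows "L holomorphic_on S"
proof -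
  have "L field_differentiable at z" if z: "z \<in> S" for z
  proof -
    have "isCont L z" using L S z continuous_on_eq_continuous_at by blast
    then obtain d where d: "0 < d" "\<And>w. dist w z < d \<Longrightarrow> dist (L w) (L z) < 1"
      unfolding continuous_at_eps_delta by (metis zero_less_one)
    obtain d' where d': "0 < d'" "ball z d' \<subseteq> S" using S z openE by blast
    define r where "r = min d d'"
    have r: "0 < r" "ball z r \<subseteq> S" using d d' by (auto simp: r_def)
    have Lw: "L w = Ln (q w / q z) + L z" if w: "w \<in> ball z r" for w
    proof -
      have "norm (L w - L z) < 1"
        using w d(2)[of w] by (simp add: r_def dist_norm dist_commute norm_minus_commute)
      then have "\<bar>Im (L w - L z)\<bar> < pi" using abs_Im_le_cmod[of "L w - L z"] pi_gt3 by linarith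
      then have "Ln (exp (L w - L z)) = L w - L z" by (intro Ln_exp) auto
      then show ?thesis using eq[of w] eq[of z] w r(2) z by (auto simp: exp_diff)
    qed
    have "(\<lambda>w. Ln (q w / q z) + L z) field_differentiable at z"
    proof -
      have "q field_differentiable at z" using q S z holomorphic_on_imp_differentiable_at by blast
      moreover have "q z \<noteq> 0" using eq[OF z] by simp
      ultimately show ?thesis
        by (intro field_differentiable_add field_differentiable_const
            field_differentiable_compose[of "\<lambda>w. q w / q z" z Ln, unfolded o_def] field_differentiable_divide
            field_differentiable_at_Ln) auto
    qed
    then show ?thesis
      by (rule field_differentiable_transform_within[OF r(1), rotated 2]) (use Lw in \<open>auto simp: dist_commute\<close>)
  qed
  then show ?thesis using S by (simp add: holomorphic_on_open field_differentiable_def)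
qed

text \<open>The quotient is the squared phase of the chord, unchanged when the end points are
  exchanged. On the circle conjugation is inversion, which turns it into an expression that stays
  continuous at \<open>a = b\<close>.\<close>

lemma circle_chord_phase:
  fixes a b :: complex
  assumes "norm a = 1" "norm b = 1" "a \<noteq> b"
  shows "(a - b) / cnj (a - b) = - a * b"
proof -
  have c: "cnj a = 1 / a" "cnj b = 1 / b"
    using complex_div_cnj[of 1 a] complex_div_cnj[of 1 b] assms by auto
  have nz: "a \<noteq> 0" "b \<noteq> 0" using assms by auto
  have e: "cnj (a - b) = - (a - b) / (a * b)" using nz by (simp add: c field_simps)
  have "d / (- d / (a * b)) = - a * b" if "d \<noteq> 0" for d
    using that nz by (simp add: field_simps)
  then show ?thesis unfolding e using assms(3) by (simp only: right_minus_eq not_False_eq_True)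
qed

lemma Ln_uniform_near_1:
  assumes "0 < \<epsilon>"
  obtains \<delta> where "0 < \<delta>"
    "\<And>w w'. norm (w - 1) \<le> 1/2 \<Longrightarrow> norm (w' - 1) \<le> 1/2 \<Longrightarrow> norm (w - w') < \<delta> \<Longrightarrow>
      norm (Ln w - Ln w') < \<epsilon>"
proof -
  have "continuous_on (cball 1 (1/2)) Ln"
  proof (rule continuous_on_Ln)
    fix z :: complex assume "z \<in> cball 1 (1/2)"
    then have "norm (1 - z) \<le> 1/2" by (simp add: dist_norm)
    then have "\<bar>Re (1 - z)\<bar> \<le> 1/2" using abs_Re_le_cmod order_trans by blast
    then have "Re z > 0" by (simp add: abs_if split: if_splits)
    then show "z \<notin> \<real>\<^sub>\<le>\<^sub>0" by (auto simp: complex_nonpos_Reals_iff)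
  qed
  then have "uniformly_continuous_on (cball 1 (1/2)) Ln"
    by (rule compact_uniformly_continuous) simp
  then obtain \<delta> where "0 < \<delta>" and
    *: "\<forall>x\<in>cball 1 (1/2). \<forall>x'\<in>cball 1 (1/2). dist x' x < \<delta> \<longrightarrow> dist (Ln x') (Ln x) < \<epsilon>"
    using assms unfolding uniformly_continuous_on_def by meson
  show ?thesis
  proof (rule that[OF \<open>0 < \<delta>\<close>])
    fix w w' :: complex
    assume w: "norm (w - 1) \<le> 1/2" "norm (w' - 1) \<le> 1/2" "norm (w - w') < \<delta>"
    have "w \<in> cball 1 (1/2)" "w' \<in> cball 1 (1/2)" using w by (simp_all add: dist_norm norm_minus_commute)
    then show "norm (Ln w - Ln w') < \<epsilon>" using * w(3) by (simp add: dist_norm)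
  qed
qed

text \<open>A rotation keeps \<open>z * w\<close> in the closed disc, so the quotient makes sense up
  to the circle. At 0 it extends by \<open>deriv F 0\<close>; elsewhere injectivity, including that
  on the circle, excludes zeros, and a zero free continuous function on the disc has a
  logarithm.\<close>

lemma difference_quotient_logarithm:
  fixes F :: "complex \<Rightarrow> complex"
  assumes F: "continuous_on (cball 0 1) F" and hol: "F holomorphic_on ball 0 1"
    and inj: "inj_on F (cball 0 1)" and w: "norm w = 1" "w \<noteq> 1"
  obtains L where "continuous_on (cball 0 1) L" "L holomorphic_on ball 0 1"
    "\<And>z. z \<in> cball 0 1 \<Longrightarrow> z \<noteq> 0 \<Longrightarrow> exp (L z) = (F (z * w) - F z) / (z * w - z)"
proof -
  define k where "k = (\<lambda>z. F (z * w) - F z)"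
  have k: "continuous_on (cball 0 1) k"
    unfolding k_def by (intro continuous_on_diff F continuous_on_compose2[OF F] continuous_intros) (auto simp: norm_mult w)
  have hk: "k holomorphic_on ball 0 1"
    unfolding k_def
    by (intro holomorphic_on_diff hol holomorphic_on_compose_gen[OF _ hol, of "\<lambda>z. z * w" "ball 0 1", unfolded o_def])
       (auto simp: norm_mult w intro!: holomorphic_intros)
  obtain Q where Q: "continuous_on (cball 0 1) Q" "Q holomorphic_on ball 0 1" "Q 0 = deriv k 0"
    "\<And>z. z \<noteq> 0 \<Longrightarrow> Q z = k z / z"
    using quotient_by_identity[OF k hk] by (metis diff_self k_def mult_zero_left)
  define q where "q = (\<lambda>z. Q z / (w - 1))"
  have q: "continuous_on (cball 0 1) q" "q holomorphic_on ball 0 1"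
    unfolding q_def by (intro continuous_intros holomorphic_intros Q; use w in simp)+
  have inj': "inj_on F (ball 0 1)" using inj by (rule inj_on_subset) auto
  have dF: "deriv F 0 \<noteq> 0"
    using holomorphic_injective_imp_regular[OF hol _ inj', of 0] by simp
  have d0: "(F has_field_derivative deriv F 0) (at 0)"
    using holomorphic_derivI[OF hol, of 0] by simp
  have "(k has_field_derivative deriv F 0 * w - deriv F 0) (at 0)"
    unfolding k_def using d0
    by (auto intro!: derivative_eq_intros DERIV_chain2[where f = F and g = "\<lambda>z. z * w"])
  then have "Q 0 = deriv F 0 * (w - 1)" using Q(3) by (simp add: DERIV_imp_deriv algebra_simps)
  then have q0: "q 0 \<noteq> 0" using dF w by (simp add: q_def)
  have qz: "q z = (F (z * w) - F z) / (z * w - z)" if "z \<noteq> 0" for z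
    using Q(4)[OF that] by (simp add: q_def k_def right_diff_distrib)
  have "q z \<noteq> 0" if z: "z \<in> cball 0 1" for z
  proof (cases "z = 0")
    case False
    have "z * w \<noteq> z" using False w by simp
    moreover have "z * w \<in> cball 0 1" using z w by (simp add: norm_mult)
    ultimately have "F (z * w) \<noteq> F z" using inj_onD[OF inj] z by blast
    then show ?thesis using qz[OF False] \<open>z * w \<noteq> z\<close> by simp
  qed (use q0 in simp)
  then obtain L where L: "continuous_on (cball 0 1) L" "\<And>z. z \<in> cball 0 1 \<Longrightarrow> q z = exp (L z)"
    using continuous_logarithm_on_cball[OF q(1)] by blast
  show ?thesis
  proof (rule that[OF L(1)])
    show "L holomorphic_on ball 0 1"
      by (rule holomorphic_on_continuous_logarithm[OF _ _ q(2)]) 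
         (use L in \<open>auto intro: continuous_on_subset\<close>)
  qed (metis L(2) qz)
qed

text \<open>Differentiating the quotient leaves, besides the difference quotient of
  \<open>deriv G\<close>, two terms with a factor \<open>1 / z\<close> that cancel in the limit.
  Rotations fix the point 0; it is recovered by continuity in
  \<open>norm_log_derivative_le\<close>.\<close>

lemma deriv_difference_quotient_logarithm:
  fixes L :: "nat \<Rightarrow> complex \<Rightarrow> complex" and G w
  assumes hol: "G holomorphic_on ball 0 1" and inj: "inj_on G (ball 0 1)"
    and z: "norm z < 1" "z \<noteq> 0"
    and w: "\<And>n. norm (w n) = 1" "\<And>n. w n \<noteq> 1" "w \<longlonglongrightarrow> 1"
    and L: "\<And>n. L n holomorphic_on ball 0 1"
      "\<And>n z. norm z < 1 \<Longrightarrow> z \<noteq> 0 \<Longrightarrow> exp (L n z) = (G (z * w n) - G z) / (z * w n - z)"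
  shows "(\<lambda>n. deriv (L n) z) \<longlonglongrightarrow> deriv (deriv G) z / deriv G z"
proof -
  define G1 where "G1 = deriv G"
  have hol1: "G1 holomorphic_on ball 0 1" unfolding G1_def by (rule holomorphic_deriv[OF hol]) simp
  have dG: "(G has_field_derivative G1 x) (at x)" if "norm x < 1" for x
    unfolding G1_def by (rule holomorphic_derivI[OF hol]) (use that in auto)
  have dG1: "(G1 has_field_derivative deriv G1 x) (at x)" if "norm x < 1" for x
    by (rule holomorphic_derivI[OF hol1]) (use that in auto)
  have nz: "G1 z \<noteq> 0"
    unfolding G1_def using holomorphic_injective_imp_regular[OF hol _ inj, of z] z by simp
  have zw: "(\<lambda>n. z * w n) \<longlonglongrightarrow> z" using tendsto_mult[OF tendsto_const[of z] w(3)] by simp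
  have zwne: "z * w n \<noteq> z" for n using w(2) z(2) by simp
  have fl: "filterlim (\<lambda>n. z * w n) (at z) sequentially"
    using zw zwne by (simp add: filterlim_at)
  have A: "(\<lambda>n. (G (z * w n) - G z) / (z * w n - z)) \<longlonglongrightarrow> G1 z"
    using filterlim_compose[OF dG[OF z(1), unfolded has_field_derivative_iff] fl] .
  have B: "(\<lambda>n. (G1 (z * w n) - G1 z) / (z * w n - z)) \<longlonglongrightarrow> deriv G1 z"
    using filterlim_compose[OF dG1[OF z(1), unfolded has_field_derivative_iff] fl] .
  have dL: "deriv (L n) z = (w n * ((G1 (z * w n) - G1 z) / (z * w n - z)) + G1 z / z
      - (G (z * w n) - G z) / (z * w n - z) / z) / ((G (z * w n) - G z) / (z * w n - z))" for n
  proof -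
    have "((\<lambda>x. (G (x * w n) - G x) / (x * w n - x)) has_field_derivative
        ((G1 (z * w n) * w n - G1 z) * (z * w n - z) - (G (z * w n) - G z) * (w n - 1))
        / ((z * w n - z) * (z * w n - z))) (at z)"
    proof (rule DERIV_divide[OF DERIV_diff DERIV_diff])
      show "((\<lambda>x. G (x * w n)) has_field_derivative G1 (z * w n) * w n) (at z)"
        by (rule DERIV_chain2[where f = G and g = "\<lambda>x. x * w n"])
           (use z w in \<open>auto intro!: dG derivative_eq_intros simp: norm_mult\<close>)
      show "(G has_field_derivative G1 z) (at z)" by (rule dG[OF z(1)])
      show "((\<lambda>x. x * w n) has_field_derivative w n) (at z)" by (auto intro!: derivative_eq_intros)
      show "((\<lambda>x. x) has_field_derivative 1) (at z)" by simp
    qed (use zwne in simp)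
    moreover have "((\<lambda>x. exp (L n x)) has_field_derivative exp (L n z) * deriv (L n) z) (at z)"
    proof -
      have "(L n has_field_derivative deriv (L n) z) (at z)"
        by (rule holomorphic_derivI[OF L(1)]) (use z in auto)
      then show ?thesis by (auto intro!: derivative_eq_intros)
    qed
    then have "((\<lambda>x. (G (x * w n) - G x) / (x * w n - x)) has_field_derivative exp (L n z) * deriv (L n) z) (at z)"
      by (rule has_field_derivative_transform_within_open[where S = "ball 0 1 - {0}"])
         (use z L(2) in \<open>auto intro!: open_Diff\<close>)
    ultimately have e: "exp (L n z) * deriv (L n) z =
        ((G1 (z * w n) * w n - G1 z) * (z * w n - z) - (G (z * w n) - G z) * (w n - 1))
        / ((z * w n - z) * (z * w n - z))"
      by (rule DERIV_unique[rotated])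
    define d where "d = z * w n - z"
    define k where "k = G (z * w n) - G z"
    have d: "d \<noteq> 0" using zwne by (simp add: d_def)
    have w1: "w n - 1 = d / z" using z(2) by (simp add: d_def field_simps)
    have "((G1 (z * w n) * w n - G1 z) * d - k * (d / z)) / (d * d)
        = (w n * (G1 (z * w n) - G1 z) + (w n - 1) * G1 z) / d - k / d / z"
      using d z(2) by (simp add: field_simps)
    also have "\<dots> = w n * ((G1 (z * w n) - G1 z) / d) + G1 z / z - k / d / z"
      unfolding w1 add_divide_distrib using d z(2) by simp
    finally have "exp (L n z) * deriv (L n) z = w n * ((G1 (z * w n) - G1 z) / d) + G1 z / z - k / d / z"
      using e unfolding d_def[symmetric] k_def[symmetric] w1 by simp
    moreover have "exp (L n z) = k / d" using L(2)[OF z] by (simp add: k_def d_def)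
    moreover have "exp (L n z) \<noteq> 0" by simp
    ultimately show ?thesis unfolding d_def[symmetric] k_def[symmetric]
      by (metis nonzero_mult_div_cancel_left)
  qed
  have "(\<lambda>n. deriv (L n) z) \<longlonglongrightarrow> (1 * deriv G1 z + G1 z / z - G1 z / z) / G1 z"
    unfolding dL using nz z(2) by (intro tendsto_intros A B w(3)) auto
  then show ?thesis by (simp add: G1_def)
qed

text \<open>The quotients \<open>(F (z w) - F z) / (z w - z)\<close> with \<open>w \<rightarrow> 1\<close> on the circle are continuous and zero free
  on the closed disc, so they have continuous logarithms. Squaring the phase of a chord of the circle gives
  \<open>- a b\<close>, without a choice of sign, so twice the boundary values of the imaginary parts converge modulo
  \<open>2 \<pi>\<close> uniformly, to the doubled tangent angle.\<close>

lemma tangent_angle: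
  fixes F \<eta> :: "complex \<Rightarrow> complex" and D :: "complex \<times> complex \<Rightarrow> complex"
  assumes F: "continuous_on (cball 0 1) F" and hol: "F holomorphic_on ball 0 1"
    and inj: "inj_on F (cball 0 1)"
    and \<eta>: "continuous_on (sphere 0 1) \<eta>" "\<And>s. s \<in> sphere 0 1 \<Longrightarrow> \<eta> s \<in> sphere 0 1"
    and D: "continuous_on (sphere 0 1 \<times> sphere 0 1) D" "\<And>p. p \<in> sphere 0 1 \<times> sphere 0 1 \<Longrightarrow> D p \<noteq> 0"
    and chord: "\<And>s t. s \<in> sphere 0 1 \<Longrightarrow> t \<in> sphere 0 1 \<Longrightarrow> F t - F s = D (\<eta> s, \<eta> t) * (\<eta> t - \<eta> s)"
  obtains b :: "complex \<Rightarrow> real" where "continuous_on (sphere 0 1) b"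
    "\<And>s. s \<in> sphere 0 1 \<Longrightarrow> cis (b s) = D (\<eta> s, \<eta> s) / cnj (D (\<eta> s, \<eta> s)) * (\<eta> s / s)^2"
    "\<And>z. norm z < 1 \<Longrightarrow> z \<noteq> 0 \<Longrightarrow> ((\<lambda>s. of_real (b s) / (s - z)^2) has_contour_integral
        2 * pi * (deriv (deriv F) z / deriv F z)) (circlepath 0 1)"
proof -
  let ?C = "sphere (0::complex) 1"
  \<comment> \<open>For \<open>s \<noteq> t\<close> this is the squared phase of
    \<open>(F t - F s) / (t - s)\<close>: the chord phases \<open>- \<eta> t * \<eta> s\<close> and
    \<open>- t * s\<close> lose their signs in the quotient. The formula is continuous across the
    diagonal.\<close>
  define V where "V = (\<lambda>p. D (\<eta> (fst p), \<eta> (snd p)) / cnj (D (\<eta> (fst p), \<eta> (snd p)))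
      * ((\<eta> (fst p) * \<eta> (snd p)) / (fst p * snd p)))"
  have Dn: "D (\<eta> s, \<eta> t) \<noteq> 0" if "s \<in> ?C" "t \<in> ?C" for s t
    using D(2)[of "(\<eta> s, \<eta> t)"] \<eta>(2) that by simp
  have nV: "norm (V (s, t)) = 1" if "s \<in> ?C" "t \<in> ?C" for s t
    using Dn[OF that] \<eta>(2)[OF that(1)] \<eta>(2)[OF that(2)] that
    by (simp add: V_def norm_mult norm_divide)
  have cV: "continuous_on (?C \<times> ?C) V"
  proof -
    have 1: "continuous_on (?C \<times> ?C) (\<lambda>p. \<eta> (fst p))" "continuous_on (?C \<times> ?C) (\<lambda>p. \<eta> (snd p))"
      by (rule continuous_on_compose2[OF \<eta>(1)]; auto intro!: continuous_intros)+
    have 2: "continuous_on (?C \<times> ?C) (\<lambda>p. D (\<eta> (fst p), \<eta> (snd p)))"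
      by (rule continuous_on_compose2[OF D(1)]) (use \<eta>(2) in \<open>auto intro!: continuous_intros 1\<close>)
    show ?thesis unfolding V_def using Dn by (intro continuous_intros 1 2) auto
  qed
  have uV: "uniformly_continuous_on (?C \<times> ?C) V"
    by (rule compact_uniformly_continuous[OF cV]) (intro compact_Times compact_sphere)
  define w where "w = (\<lambda>n. cis (1 / real (Suc n)))"
  have w: "norm (w n) = 1" "w n \<noteq> 1" for n
  proof -
    show "norm (w n) = 1" by (simp add: w_def)
    have "1 / real (Suc n) \<le> 1" "0 \<le> 1 / real (Suc n)" by simp_all
    then have "\<bar>1 / real (Suc n) - 0\<bar> < 2 * pi" using pi_gt3 by linarith
    then show "w n \<noteq> 1" using cis_eq_imp_eq[of "1 / real (Suc n)" 0] by (auto simp: w_def)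
  qed
  have wlim: "w \<longlonglongrightarrow> 1"
  proof -
    have "(\<lambda>n. cis (1 / real (Suc n))) \<longlonglongrightarrow> cis 0"
      by (intro tendsto_intros lim_1_over_n[THEN LIMSEQ_Suc])
    then show ?thesis by (simp add: w_def)
  qed
  have "\<exists>L. continuous_on (cball 0 1) L \<and> L holomorphic_on ball 0 1 \<and>
      (\<forall>z. z \<in> cball 0 1 \<longrightarrow> z \<noteq> 0 \<longrightarrow> exp (L z) = (F (z * w n) - F z) / (z * w n - z))" for n
    using difference_quotient_logarithm[OF F hol inj w[of n]] by metis
  then obtain L where L: "\<And>n. continuous_on (cball 0 1) (L n)" "\<And>n. L n holomorphic_on ball 0 1"
    "\<And>n z. z \<in> cball 0 1 \<Longrightarrow> z \<noteq> 0 \<Longrightarrow> exp (L n z) = (F (z * w n) - F z) / (z * w n - z)"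
    by metis
  define c where "c = (\<lambda>n s. 2 * Im (L n s))"
  have cc: "continuous_on ?C (c n)" for n
    unfolding c_def by (intro continuous_intros continuous_on_subset[OF L(1)]) auto
  have cw: "s * w n \<in> ?C" if "s \<in> ?C" for s n using that w by (simp add: norm_mult)
  have cisc: "cis (c n s) = V (s, s * w n)" if s: "s \<in> ?C" for n s
  proof -
    let ?t = "s * w n"
    have s0: "s \<noteq> 0" using s by auto
    have ne: "?t \<noteq> s" using w s0 by simp
    define X where "X = exp (L n s)"
    have X: "X = (F ?t - F s) / (?t - s)" using L(3)[of s n] s s0 by (simp add: X_def)
    have "exp (L n s) = of_real (exp (Re (L n s))) * cis (Im (L n s))"
      by (simp add: exp_eq_polar)
    then have "X / cnj X = cis (Im (L n s)) / cis (- Im (L n s))"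
      by (simp add: X_def cis_cnj)
    also have "\<dots> = cis (c n s)" by (simp add: cis_divide c_def)
    finally have 1: "cis (c n s) = X / cnj X" by simp
    have X0: "X \<noteq> 0" by (simp add: X_def)
    have eX: "X = D (\<eta> s, \<eta> ?t) * (\<eta> ?t - \<eta> s) / (?t - s)"
      using X chord[OF s cw[OF s]] by simp
    then have "\<eta> ?t \<noteq> \<eta> s" using X0 by auto
    then have p1: "(\<eta> ?t - \<eta> s) / cnj (\<eta> ?t - \<eta> s) = - \<eta> ?t * \<eta> s"
      by (intro circle_chord_phase) (use \<eta>(2)[OF s] \<eta>(2)[OF cw[OF s]] in auto)
    have p2: "(?t - s) / cnj (?t - s) = - ?t * s"
      by (rule circle_chord_phase) (use s ne w in \<open>auto simp: norm_mult\<close>)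
    have "X / cnj X = D (\<eta> s, \<eta> ?t) / cnj (D (\<eta> s, \<eta> ?t)) *
        ((\<eta> ?t - \<eta> s) / cnj (\<eta> ?t - \<eta> s)) / ((?t - s) / cnj (?t - s))"
      unfolding eX by (simp add: field_simps)
    also have "\<dots> = V (s, ?t)"
      unfolding p1 p2 by (simp add: V_def mult_ac)
    finally show ?thesis using 1 by simp
  qed
  have uw: "\<exists>N. \<forall>n\<ge>N. \<forall>s\<in>?C. norm (V (s, s * w n) - V (s, s)) < \<epsilon>" if "0 < \<epsilon>" for \<epsilon>
  proof -
    obtain \<delta> where \<delta>: "0 < \<delta>" "\<And>p q. p \<in> ?C \<times> ?C \<Longrightarrow> q \<in> ?C \<times> ?C \<Longrightarrow> dist q p < \<delta> \<Longrightarrow> dist (V q) (V p) < \<epsilon>"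
      using uV \<open>0 < \<epsilon>\<close> unfolding uniformly_continuous_on_def by metis
    obtain N where N: "\<And>n. n \<ge> N \<Longrightarrow> norm (w n - 1) < \<delta>"
      using LIMSEQ_D[OF wlim \<delta>(1)] by blast
    show ?thesis
    proof (intro exI[of _ N] allI impI ballI)
      fix n s assume n: "N \<le> n" and s: "s \<in> ?C"
      have "s * w n - s = s * (w n - 1)" by (simp add: algebra_simps)
      then have "dist (s * w n) s = norm (w n - 1)" using s by (simp add: dist_norm norm_mult)
      then have "dist (s, s * w n) (s, s) < \<delta>" using N[OF n] by (simp add: dist_Pair_Pair)
      then have "dist (V (s, s * w n)) (V (s, s)) < \<epsilon>" using s cw by (intro \<delta>(2)) auto
      then show "norm (V (s, s * w n) - V (s, s)) < \<epsilon>" by (simp add: dist_norm)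
    qed
  qed
  \<comment> \<open>\<open>N\<close> is a reference index: from there on the squared phases are
    within 1/4 of their limit, so after division by \<open>cis (c N s)\<close> they stay in a disc
    about 1 on which the principal logarithm is continuous.\<close>
  obtain N where N: "\<And>n s. n \<ge> N \<Longrightarrow> s \<in> ?C \<Longrightarrow> norm (V (s, s * w n) - V (s, s)) < 1/4"
    using uw[of "1/4"] by (metis zero_less_divide_1_iff zero_less_numeral)
  define U where "U = (\<lambda>n s. V (s, s * w n) / cis (c N s))"
  define U0 where "U0 = (\<lambda>s. V (s, s) / cis (c N s))"
  have cU: "continuous_on ?C (U n)" for n
    unfolding U_def using cw
    by (intro continuous_intros continuous_on_compose2[OF cV] cc) auto
  have cU0: "continuous_on ?C U0"
    unfolding U0_def by (intro continuous_intros continuous_on_compose2[OF cV] cc) auto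
  have dU: "norm (U n s - U0 s) = norm (V (s, s * w n) - V (s, s))" for n s
    by (simp add: U_def U0_def diff_divide_distrib[symmetric] norm_divide)
  have U1: "U N s = 1" if "s \<in> ?C" for s by (simp add: U_def cisc[OF that, symmetric])
  have bU0: "norm (U0 s - 1) \<le> 1/4" if "s \<in> ?C" for s
    using dU[of N s] N[of N s] U1[OF that] that by (simp add: norm_minus_commute)
  have bU: "norm (U n s - 1) \<le> 1/2" if "s \<in> ?C" "n \<ge> N" for n s
    using dU[of n s] N[of n s] bU0[OF that(1)] that norm_triangle_ineq[of "U n s - U0 s" "U0 s - 1"] by simp
  have Rpos: "x \<notin> \<real>\<^sub>\<le>\<^sub>0" if "norm (x - 1) \<le> 1/2" for x :: complex
  proof -
    have "\<bar>Re (x - 1)\<bar> \<le> 1/2" using that abs_Re_le_cmod order_trans by blast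
    then have "Re x > 0" by (simp add: abs_if split: if_splits)
    then show ?thesis by (auto simp: complex_nonpos_Reals_iff)
  qed
  have RU0: "U0 s \<notin> \<real>\<^sub>\<le>\<^sub>0" if "s \<in> ?C" for s
    by (rule Rpos) (use bU0[OF that] in linarith)
  have RU: "U n s \<notin> \<real>\<^sub>\<le>\<^sub>0" if "s \<in> ?C" "n \<ge> N" for n s
    by (rule Rpos) (use bU[OF that] in linarith)
  define b where "b = (\<lambda>s. c N s + Im (Ln (U0 s)))"
  have cb: "continuous_on ?C b"
    unfolding b_def using RU0 by (intro continuous_intros cc cU0)
  have cis_Ln: "cis (Im (Ln x)) = x" if "norm x = 1" for x
  proof -
    have "x \<noteq> 0" using that by auto
    have "exp (Ln x) = of_real (exp (Re (Ln x))) * cis (Im (Ln x))" by (simp add: exp_eq_polar)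
    then show ?thesis using that \<open>x \<noteq> 0\<close> by simp
  qed
  have nU: "norm (U n s) = 1" "norm (U0 s) = 1" if "s \<in> ?C" for n s
    using nV[OF that cw[OF that]] nV[OF that that] by (simp_all add: U_def U0_def norm_divide)
  have cisb: "cis (b s) = V (s, s)" if "s \<in> ?C" for s
  proof -
    have "cis (b s) = cis (c N s) * U0 s"
      using cis_Ln[OF nU(2)[OF that]] by (simp add: b_def cis_mult[symmetric])
    then show ?thesis by (simp add: U0_def)
  qed
  have conn: "connected ?C" by (rule connected_sphere) simp
  \<comment> \<open>Two continuous branches of the same angle differ by a constant on the connected
    circle. The constant disappears from the integral below, because \<open>1 / (s - z)^2\<close>
    integrates to 0.\<close>
  have k: "\<exists>k. \<forall>s\<in>?C. c n s - c N s - Im (Ln (U n s)) = k" if n: "n \<ge> N" for n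
  proof -
    define f where "f = (\<lambda>s. c n s - c N s - Im (Ln (U n s)))"
    have cf: "continuous_on ?C f"
      unfolding f_def using RU[OF _ n] by (intro continuous_intros cc cU)
    have cisf: "cis (f s) = 1" if "s \<in> ?C" for s
    proof -
      have "cis (f s) = cis (c n s) / cis (c N s) / U n s"
        using cis_Ln[OF nU(1)[OF that]] by (simp add: f_def cis_divide[symmetric])
      also have "\<dots> = 1" using nU(1)[OF that, of n] cisc[OF that, of n] by (auto simp: U_def)
      finally show ?thesis .
    qed
    have "f constant_on ?C"
    proof (rule continuous_discrete_range_constant[OF conn cf])
      fix x assume x: "x \<in> ?C"
      show "\<exists>e>0. \<forall>y. y \<in> ?C \<and> f y \<noteq> f x \<longrightarrow> e \<le> norm (f y - f x)"
      proof (intro exI[of _ "2 * pi"] conjI allI impI)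
        fix y assume y: "y \<in> ?C \<and> f y \<noteq> f x"
        then show "2 * pi \<le> norm (f y - f x)"
          using cis_eq_imp_eq[of "f y" "f x"] cisf x by (force simp: not_less)
      qed simp
    qed
    then show ?thesis by (auto simp: constant_on_def f_def)
  qed
  show ?thesis
  proof (rule that[OF cb])
    show "cis (b s) = D (\<eta> s, \<eta> s) / cnj (D (\<eta> s, \<eta> s)) * (\<eta> s / s)^2" if "s \<in> ?C" for s
      using cisb[OF that] by (simp add: V_def power2_eq_square)
    fix z :: complex assume z: "norm z < 1" "z \<noteq> 0"
    have nz: "s - z \<noteq> 0" if "s \<in> ?C" for s using that z by auto
    define I where "I = contour_integral (circlepath 0 1) (\<lambda>s. of_real (b s) / (s - z)^2)"
    have "(\<lambda>s. of_real (b s) / (s - z)^2) contour_integrable_on (circlepath 0 1)"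
      by (rule contour_integrable_continuous_circlepath)
         (use nz in \<open>auto intro!: continuous_intros cb\<close>)
    then have I: "((\<lambda>s. of_real (b s) / (s - z)^2) has_contour_integral I) (circlepath 0 1)"
      unfolding I_def by (rule has_contour_integral_integral)
    note one = has_contour_integral_inverse_square[OF z(1)]
    have S: "((\<lambda>s. of_real (c n s) / (s - z)^2) has_contour_integral 2 * pi * deriv (L n) z) (circlepath 0 1)" for n
      using has_contour_integral_lmul[OF deriv_eq_Schwarz_integral[OF L(1,2) z(1)], of 2 n]
      by (simp add: c_def mult.assoc)
    have "(\<lambda>n. 2 * pi * deriv (L n) z) \<longlonglongrightarrow> I"
    proof (rule LIMSEQ_I)
      fix \<epsilon> :: real assume \<epsilon>: "0 < \<epsilon>"
      \<comment> \<open>Chosen so that a pointwise error \<open>\<epsilon>'\<close> times the kernel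
        bound \<open>1 / (1 - norm z)^2\<close> times the length \<open>2 * pi\<close> is
        \<open>\<epsilon> / 2\<close>.\<close>
      define \<epsilon>' where "\<epsilon>' = \<epsilon> * (1 - norm z)^2 / (4 * pi)"
      have \<epsilon>': "0 < \<epsilon>'" using \<epsilon> z by (simp add: \<epsilon>'_def)
      obtain \<delta> where \<delta>: "0 < \<delta>" "\<And>w w'. norm (w - 1) \<le> 1/2 \<Longrightarrow> norm (w' - 1) \<le> 1/2 \<Longrightarrow> norm (w - w') < \<delta> \<Longrightarrow>
          norm (Ln w - Ln w') < \<epsilon>'" using Ln_uniform_near_1[OF \<epsilon>'] by metis
      obtain N1 where N1: "\<And>n s. n \<ge> N1 \<Longrightarrow> s \<in> ?C \<Longrightarrow> norm (V (s, s * w n) - V (s, s)) < \<delta>"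
        using uw[OF \<delta>(1)] by blast
      show "\<exists>no. \<forall>n\<ge>no. norm (2 * pi * deriv (L n) z - I) < \<epsilon>"
      proof (intro exI[of _ "max N N1"] allI impI)
        fix n assume "max N N1 \<le> n"
        then have n: "n \<ge> N" "n \<ge> N1" by auto
        obtain k where k: "\<And>s. s \<in> ?C \<Longrightarrow> c n s - c N s - Im (Ln (U n s)) = k" using k[OF n(1)] by blast
        have d: "((\<lambda>s. of_real (c n s) / (s - z)^2 - of_real (b s) / (s - z)^2 - of_real k * (1 / (s - z)^2))
            has_contour_integral 2 * pi * deriv (L n) z - I - of_real k * 0) (circlepath 0 1)"
          by (intro has_contour_integral_diff S I has_contour_integral_lmul one)
        have "norm (2 * pi * deriv (L n) z - I - of_real k * 0) \<le> \<epsilon>' / (1 - norm z)^2 * (2 * pi * 1)"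
        proof (rule has_contour_integral_bound_circlepath[OF d])
          fix s :: complex assume s1: "norm (s - 0) = 1"
          then have s: "s \<in> ?C" by simp
          have "norm (U n s - U0 s) < \<delta>" using dU N1[OF n(2) s] by simp
          then have "norm (Ln (U n s) - Ln (U0 s)) < \<epsilon>'"
            using \<delta>(2) bU[OF s n(1)] bU0[OF s] by auto
          then have 1: "\<bar>Im (Ln (U n s)) - Im (Ln (U0 s))\<bar> \<le> \<epsilon>'"
            using abs_Im_le_cmod[of "Ln (U n s) - Ln (U0 s)"] by simp
          have 2: "c n s - b s - k = Im (Ln (U n s)) - Im (Ln (U0 s))"
            using k[OF s] by (simp add: b_def)
          have 3: "1 - norm z \<le> norm (s - z)" using norm_triangle_ineq2[of s z] s1 by simp
          have "of_real (c n s) / (s - z)^2 - of_real (b s) / (s - z)^2 - of_real k * (1 / (s - z)^2)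
              = of_real (c n s - b s - k) / (s - z)^2" by (simp add: diff_divide_distrib)
          also have "norm \<dots> = \<bar>c n s - b s - k\<bar> / norm (s - z)^2"
            by (simp only: norm_divide norm_power norm_of_real)
          also have "\<dots> \<le> \<epsilon>' / (1 - norm z)^2"
            using 1 2 3 z by (intro frac_le power_mono) auto
          finally show "norm (of_real (c n s) / (s - z)^2 - of_real (b s) / (s - z)^2 - of_real k * (1 / (s - z)^2))
            \<le> \<epsilon>' / (1 - norm z)^2" .
        qed (use \<epsilon>' in auto)
        also have "\<dots> = \<epsilon> / 2" using z by (simp add: \<epsilon>'_def field_simps)
        also have "\<dots> < \<epsilon>" using \<epsilon> by simp
        finally show "norm (2 * pi * deriv (L n) z - I) < \<epsilon>" by simp
      qed
    qed
    moreover have "(\<lambda>n. 2 * pi * deriv (L n) z) \<longlonglongrightarrow> 2 * pi * (deriv (deriv F) z / deriv F z)"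
      by (intro tendsto_mult tendsto_const deriv_difference_quotient_logarithm[OF hol _ z w wlim L(2)])
         (use inj L(3) in \<open>auto intro: inj_on_subset\<close>)
    ultimately have "I = 2 * pi * (deriv (deriv F) z / deriv F z)" by (rule LIMSEQ_unique)
    then show "((\<lambda>s. of_real (b s) / (s - z)^2) has_contour_integral
        2 * pi * (deriv (deriv F) z / deriv F z)) (circlepath 0 1)" using I by simp
  qed
qed

section \<open>Kellogg's theorem\<close>

lemma abs_le_norm_cis_minus_1:
  assumes "\<bar>x\<bar> \<le> pi"
  shows "\<bar>x\<bar> \<le> 2 * norm (cis x - 1)"
proof -
  have "cis x - 1 = cis (x / 2) * (cis (x / 2) - cis (- (x / 2)))"
    by (simp add: right_diff_distrib cis_mult)
  also have "cis (x / 2) - cis (- (x / 2)) = 2 * \<i> * sin (x / 2)"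
    by (simp add: complex_eq_iff)
  finally have "norm (cis x - 1) = 2 * \<bar>sin (x / 2)\<bar>" by (simp add: norm_mult)
  moreover have "\<bar>x\<bar> / 2 / 2 \<le> sin (\<bar>x\<bar> / 2)"
    by (rule sin_ge_half) (use assms in auto)
  moreover have "sin (\<bar>x\<bar> / 2) \<le> \<bar>sin (x / 2)\<bar>"
    by (cases "x \<ge> 0") auto
  ultimately show ?thesis by linarith
qed

lemma norm_phase_diff_le:
  fixes x y :: complex
  assumes "x \<noteq> 0" "y \<noteq> 0"
  shows "norm (x / cnj x - y / cnj y) \<le> 2 * norm (x - y) / norm x"
proof -
  have "x / cnj x - y / cnj y = ((x - y) * cnj y - y * cnj (x - y)) / (cnj x * cnj y)"
    using assms by (simp add: field_simps)
  then have "norm (x / cnj x - y / cnj y) = norm ((x - y) * cnj y - y * cnj (x - y)) / (norm x * norm y)"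
    by (simp add: norm_divide norm_mult)
  also have "\<dots> \<le> (norm (x - y) * norm y + norm y * norm (x - y)) / (norm x * norm y)"
    by (intro divide_right_mono order_trans[OF norm_triangle_ineq4])
       (auto simp: norm_mult simp flip: complex_cnj_diff)
  also have "\<dots> = 2 * norm (x - y) / norm x"
    using assms by (simp add: field_simps)
  finally show ?thesis .
qed

text \<open>Chords of the unit circle have length at most 2; lowering the exponent by at most 1 then
  costs at most the factor 2.\<close>

lemma powr_le_twice_powr:
  fixes x :: real
  assumes "0 \<le> x" "x \<le> 2" "0 < q" "q \<le> p" "p \<le> 1"
  shows "x powr p \<le> 2 * x powr q"
proof (cases "x = 0")
  case False
  then have "x powr p = x powr (p - q) * x powr q" by (simp add: powr_add[symmetric])
  also have "x powr (p - q) \<le> 2 powr (p - q)" using assms by (intro powr_mono2) auto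
  also have "2 powr (p - q) \<le> 2 powr 1" using assms by (intro powr_mono) auto
  finally show ?thesis by (simp add: mult_right_mono)
qed simp

lemma dist_circle_le_2:
  assumes "s \<in> sphere (0::complex) 1" "t \<in> sphere 0 1"
  shows "dist s t \<le> 2"
  using assms norm_triangle_ineq4[of s t] by (simp add: dist_norm)

text \<open>Below the scale \<open>\<delta>\<close> of uniform continuity the difference is at most
  \<open>N\<close>; above it, twice the supremum of \<open>b\<close> is absorbed into the power.
  This lets the bootstrap start from mere continuity, with \<open>N\<close> as small as
  desired.\<close>

lemma continuous_on_circle_almost_Hoelder:
  fixes b :: "complex \<Rightarrow> real"
  assumes b: "continuous_on (sphere 0 1) b" and N: "0 < N" and a: "0 \<le> a"
  obtains M where "0 \<le> M"
    "\<And>s t. s \<in> sphere 0 1 \<Longrightarrow> t \<in> sphere 0 1 \<Longrightarrow> \<bar>b s - b t\<bar> \<le> N + M * dist s t powr a"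
proof -
  let ?C = "sphere (0::complex) 1"
  have "bounded (b ` ?C)" by (intro compact_imp_bounded compact_continuous_image b compact_sphere)
  then obtain B where B: "\<And>s. s \<in> ?C \<Longrightarrow> \<bar>b s\<bar> \<le> B"
    unfolding bounded_iff by (metis imageI real_norm_def)
  have B0: "0 \<le> B" using B[of 1] by simp
  have "uniformly_continuous_on ?C b" by (rule compact_uniformly_continuous[OF b compact_sphere])
  then obtain \<delta> where \<delta>: "0 < \<delta>" "\<And>s t. s \<in> ?C \<Longrightarrow> t \<in> ?C \<Longrightarrow> dist t s < \<delta> \<Longrightarrow> dist (b t) (b s) < N"
    using N unfolding uniformly_continuous_on_def by metis
  show ?thesis
  proof (rule that[of "2 * B / \<delta> powr a"])
    show "0 \<le> 2 * B / \<delta> powr a" using B0 by simp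
    fix s t assume st: "s \<in> ?C" "t \<in> ?C"
    show "\<bar>b s - b t\<bar> \<le> N + 2 * B / \<delta> powr a * dist s t powr a"
    proof (cases "dist s t < \<delta>")
      case True
      then have "\<bar>b s - b t\<bar> \<le> N" using \<delta>(2)[OF st(2,1)] by (simp add: dist_real_def)
      moreover have "0 \<le> 2 * B / \<delta> powr a * dist s t powr a" using B0 by simp
      ultimately show ?thesis by linarith
    next
      case False
      have "\<bar>b s - b t\<bar> \<le> 2 * B" using B[OF st(1)] B[OF st(2)] by linarith
      also have "\<dots> \<le> 2 * B * (dist s t powr a / \<delta> powr a)"
      proof -
        have "\<delta> powr a \<le> dist s t powr a" using False \<delta>(1) a by (intro powr_mono2) auto
        then have "1 \<le> dist s t powr a / \<delta> powr a" using \<delta>(1) by simp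
        then show ?thesis using mult_left_mono[of 1 "dist s t powr a / \<delta> powr a" "2 * B"] B0 by simp
      qed
      finally show ?thesis using N by simp
    qed
  qed
qed

text \<open>\<open>cis\<close> controls an angle difference only up to \<open>pi\<close>. Where
  \<open>M * d \<le> 1\<close> the almost Hoelder bound with \<open>N = 1\<close> keeps the
  difference below that; elsewhere this bound is itself at most \<open>2 * M * d\<close>.\<close>

lemma Hoelder_of_cis_Hoelder:
  fixes b :: "complex \<Rightarrow> real"
  assumes b: "continuous_on (sphere 0 1) b" and a: "0 < a" and K: "0 \<le> K"
    and h: "\<And>s t. s \<in> sphere 0 1 \<Longrightarrow> t \<in> sphere 0 1 \<Longrightarrow> norm (cis (b s) - cis (b t)) \<le> K * dist s t powr a"
  obtains M where "0 \<le> M"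
    "\<And>s t. s \<in> sphere 0 1 \<Longrightarrow> t \<in> sphere 0 1 \<Longrightarrow> \<bar>b s - b t\<bar> \<le> M * dist s t powr a"
proof -
  obtain M where M: "0 \<le> M" "\<And>s t. s \<in> sphere 0 1 \<Longrightarrow> t \<in> sphere 0 1 \<Longrightarrow> \<bar>b s - b t\<bar> \<le> 1 + M * dist s t powr a"
    using continuous_on_circle_almost_Hoelder[OF b zero_less_one, of a] a by auto
  show ?thesis
  proof (rule that[of "2 * K + 2 * M"])
    show "0 \<le> 2 * K + 2 * M" using K M by simp
    fix s t :: complex assume st: "s \<in> sphere 0 1" "t \<in> sphere 0 1"
    define d where "d = dist s t powr a"
    have d: "0 \<le> d" by (simp add: d_def)
    show "\<bar>b s - b t\<bar> \<le> (2 * K + 2 * M) * dist s t powr a"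
    proof (cases "M * d \<le> 1")
      case True
      then have "\<bar>b s - b t\<bar> \<le> pi" using M(2)[OF st] pi_gt3 by (simp add: d_def)
      then have "\<bar>b s - b t\<bar> \<le> 2 * norm (cis (b s - b t) - 1)" by (rule abs_le_norm_cis_minus_1)
      also have "norm (cis (b s - b t) - 1) = norm (cis (b s) - cis (b t))"
      proof -
        have "cis (b s) - cis (b t) = cis (b t) * (cis (b s - b t) - 1)"
          by (simp add: right_diff_distrib cis_mult)
        then show ?thesis by (simp add: norm_mult)
      qed
      also have "\<dots> \<le> K * d" unfolding d_def by (rule h[OF st])
      finally have "\<bar>b s - b t\<bar> \<le> 2 * K * d" by simp
      also have "\<dots> \<le> (2 * K + 2 * M) * d" using M d by (intro mult_right_mono) auto
      finally show ?thesis by (simp add: d_def)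
    next
      case False
      then have "\<bar>b s - b t\<bar> \<le> 2 * M * d" using M(2)[OF st] by (simp add: d_def)
      also have "\<dots> \<le> (2 * K + 2 * M) * d" using K d by (intro mult_right_mono) auto
      finally show ?thesis by (simp add: d_def)
    qed
  qed
qed

text \<open>Exponents multiply under composition: \<open>d\<close> contributes
  \<open>\<alpha>\<close> and the correspondence \<open>\<eta>\<close> contributes
  \<open>\<beta>\<close>. This is the link that converts regularity of the map into regularity of
  the angle.\<close>

lemma tangent_angle_Hoelder:
  fixes F \<eta> d :: "complex \<Rightarrow> complex" and b :: "complex \<Rightarrow> real"
  assumes b: "continuous_on (sphere 0 1) b"
    and cis: "\<And>s. s \<in> sphere 0 1 \<Longrightarrow> cis (b s) = d (\<eta> s) / cnj (d (\<eta> s)) * (\<eta> s / s)^2"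
    and \<eta>: "\<And>s. s \<in> sphere 0 1 \<Longrightarrow> \<eta> s \<in> sphere 0 1"
    and \<beta>: "0 < \<beta>" "\<beta> \<le> 1" and \<alpha>: "0 < \<alpha>" "\<alpha> \<le> 1" and K: "0 \<le> K" and H: "0 \<le> H" and c: "0 < c"
    and \<eta>h: "\<And>s t. s \<in> sphere 0 1 \<Longrightarrow> t \<in> sphere 0 1 \<Longrightarrow> dist (\<eta> s) (\<eta> t) \<le> K * dist s t powr \<beta>"
    and dh: "\<And>s t. s \<in> sphere 0 1 \<Longrightarrow> t \<in> sphere 0 1 \<Longrightarrow> norm (d s - d t) \<le> H * dist s t powr \<alpha>"
    and dc: "\<And>s. s \<in> sphere 0 1 \<Longrightarrow> c \<le> norm (d s)" and dB: "\<And>s. s \<in> sphere 0 1 \<Longrightarrow> norm (d s) \<le> B"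
  obtains M where "0 \<le> M"
    "\<And>s t. s \<in> sphere 0 1 \<Longrightarrow> t \<in> sphere 0 1 \<Longrightarrow> \<bar>b s - b t\<bar> \<le> M * dist s t powr (\<beta> * \<alpha>)"
proof -
  let ?C = "sphere (0::complex) 1"
  \<comment> \<open>Up to a real factor, \<open>m s\<close> is the boundary derivative that
    \<open>F\<close> ought to have: \<open>\<eta>\<close> maps the circle to itself, so its
    derivative at \<open>s\<close> would be a real multiple of \<open>\<eta> s / s\<close>. Hence
    \<open>m / cnj m\<close> is the squared phase.\<close>
  define m where "m = (\<lambda>s. d (\<eta> s) * (\<eta> s / s))"
  define R where "R = 2 * (H * K powr \<alpha> + B * (2 * K + 2)) / c"
  have B: "0 \<le> B" using dc[of 1] dB[of 1] c by simp
  have \<beta>\<alpha>: "0 < \<beta> * \<alpha>" "\<beta> * \<alpha> \<le> \<beta>" "\<beta> * \<alpha> \<le> 1" using \<beta> \<alpha> by (auto simp: mult_le_one)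
  have nm: "norm (m s) = norm (d (\<eta> s))" if "s \<in> ?C" for s
    using that \<eta>[OF that] by (simp add: m_def norm_mult norm_divide)
  have cm: "cis (b s) = m s / cnj (m s)" if s: "s \<in> ?C" for s
  proof -
    have "cnj s = 1 / s" "cnj (\<eta> s) = 1 / \<eta> s"
      using complex_div_cnj[of 1 s] complex_div_cnj[of 1 "\<eta> s"] \<eta>[OF s] s by auto
    then have "m s / cnj (m s) = d (\<eta> s) / cnj (d (\<eta> s)) * (\<eta> s / s)^2"
      by (simp add: m_def power2_eq_square mult_ac)
    then show ?thesis using cis[OF s] by simp
  qed
  have main: "norm (cis (b s) - cis (b t)) \<le> R * dist s t powr (\<beta> * \<alpha>)" if s: "s \<in> ?C" and t: "t \<in> ?C" for s t
  proof -
    define x where "x = dist s t"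
    have x: "0 \<le> x" "x \<le> 2" using dist_circle_le_2[OF s t] by (auto simp: x_def)
    have pos: "0 < norm (d (\<eta> s))" "0 < norm (d (\<eta> t))" using dc[OF \<eta>] s t c by (meson less_le_trans)+
    have nz: "m s \<noteq> 0" "m t \<noteq> 0" using nm[OF s] nm[OF t] pos by auto
    have 1: "norm (d (\<eta> s) - d (\<eta> t)) \<le> H * K powr \<alpha> * x powr (\<beta> * \<alpha>)"
    proof -
      have "norm (d (\<eta> s) - d (\<eta> t)) \<le> H * dist (\<eta> s) (\<eta> t) powr \<alpha>" by (rule dh[OF \<eta>[OF s] \<eta>[OF t]])
      also have "\<dots> \<le> H * (K * x powr \<beta>) powr \<alpha>"
        using \<eta>h[OF s t] \<alpha> H by (intro mult_left_mono powr_mono2) (auto simp: x_def)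
      also have "\<dots> = H * K powr \<alpha> * x powr (\<beta> * \<alpha>)" using K by (simp add: powr_mult powr_powr)
      finally show ?thesis .
    qed
    have 2: "norm (\<eta> s / s - \<eta> t / t) \<le> (2 * K + 2) * x powr (\<beta> * \<alpha>)"
    proof -
      have nzs: "s \<noteq> 0" "t \<noteq> 0" using s t by auto
      have "\<eta> s / s - \<eta> t / t = (\<eta> s - \<eta> t) / s + \<eta> t * (t - s) / (s * t)"
        using nzs by (simp add: field_simps)
      then have "norm (\<eta> s / s - \<eta> t / t) \<le> norm ((\<eta> s - \<eta> t) / s) + norm (\<eta> t * (t - s) / (s * t))"
        by (metis norm_triangle_ineq)
      also have "\<dots> = dist (\<eta> s) (\<eta> t) + x powr 1"
        using s t \<eta>[OF t] x by (simp add: norm_divide norm_mult dist_norm x_def norm_minus_commute)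
      also have "\<dots> \<le> K * x powr \<beta> + x powr 1" using \<eta>h[OF s t] by (simp add: x_def)
      also have "\<dots> \<le> K * (2 * x powr (\<beta> * \<alpha>)) + 2 * x powr (\<beta> * \<alpha>)"
        using K \<beta> \<beta>\<alpha> x by (intro add_mono mult_left_mono powr_le_twice_powr) auto
      finally show ?thesis by (simp add: algebra_simps)
    qed
    have "m s - m t = (d (\<eta> s) - d (\<eta> t)) * (\<eta> s / s) + d (\<eta> t) * (\<eta> s / s - \<eta> t / t)"
      by (simp add: m_def algebra_simps)
    then have "norm (m s - m t) \<le> norm ((d (\<eta> s) - d (\<eta> t)) * (\<eta> s / s)) + norm (d (\<eta> t) * (\<eta> s / s - \<eta> t / t))"
      by (metis norm_triangle_ineq)
    also have "\<dots> = norm (d (\<eta> s) - d (\<eta> t)) + norm (d (\<eta> t)) * norm (\<eta> s / s - \<eta> t / t)"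
      using \<eta>[OF s] s by (simp add: norm_mult norm_divide)
    also have "\<dots> \<le> H * K powr \<alpha> * x powr (\<beta> * \<alpha>) + B * ((2 * K + 2) * x powr (\<beta> * \<alpha>))"
      by (intro add_mono mult_mono 1 2 dB \<eta> t B) auto
    finally have 3: "norm (m s - m t) \<le> (H * K powr \<alpha> + B * (2 * K + 2)) * x powr (\<beta> * \<alpha>)"
      by (simp add: algebra_simps)
    have "norm (cis (b s) - cis (b t)) \<le> 2 * norm (m s - m t) / norm (m s)"
      unfolding cm[OF s] cm[OF t] by (rule norm_phase_diff_le[OF nz])
    also have "\<dots> \<le> 2 * ((H * K powr \<alpha> + B * (2 * K + 2)) * x powr (\<beta> * \<alpha>)) / c"
      using 3 order_trans[OF norm_ge_zero 3] c dc[OF \<eta>[OF s]] nm[OF s] by (intro frac_le) auto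
    finally show ?thesis by (simp add: R_def x_def algebra_simps)
  qed
  have R: "0 \<le> R" using c B H K by (simp add: R_def)
  show ?thesis by (rule Hoelder_of_cis_Hoelder[OF b \<beta>\<alpha>(1) R main that])
qed

text \<open>The integral formula carries a factor \<open>2 * pi\<close>, so the constant 216 is
  halved. The formula leaves out \<open>z = 0\<close>, where the bound follows by continuity of both
  sides.\<close>

lemma norm_log_derivative_le:
  fixes F :: "complex \<Rightarrow> complex" and b :: "complex \<Rightarrow> real"
  assumes hol: "F holomorphic_on ball 0 1" and inj: "inj_on F (ball 0 1)"
    and b: "continuous_on (sphere 0 1) b"
    and int: "\<And>z. norm z < 1 \<Longrightarrow> z \<noteq> 0 \<Longrightarrow> ((\<lambda>s. of_real (b s) / (s - z)^2) has_contour_integral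
        2 * pi * (deriv (deriv F) z / deriv F z)) (circlepath 0 1)"
    and a: "0 \<le> a" "a < 1" and N: "0 \<le> N" and M: "0 \<le> M"
    and bd: "\<And>s t. s \<in> sphere 0 1 \<Longrightarrow> t \<in> sphere 0 1 \<Longrightarrow> \<bar>b s - b t\<bar> \<le> N + M * dist s t powr a"
    and z: "norm z < 1"
  shows "norm (deriv (deriv F) z / deriv F z) \<le> 108 * (N / (1 - norm z) + M / (1 - a) * (1 - norm z) powr (a - 1))"
proof -
  define q where "q = (\<lambda>z. deriv (deriv F) z / deriv F z)"
  define R where "R = (\<lambda>z::complex. 108 * (N / (1 - norm z) + M / (1 - a) * (1 - norm z) powr (a - 1)))"
  have cq: "isCont q x" if "norm x < 1" for x
  proof -
    have "q holomorphic_on ball 0 1"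
      unfolding q_def using holomorphic_injective_imp_regular[OF hol _ inj]
      by (intro holomorphic_intros holomorphic_deriv hol) auto
    then show ?thesis using that
      by (metis continuous_on_eq_continuous_at holomorphic_on_imp_continuous_on mem_ball_0 open_ball)
  qed
  have nz: "norm (q x) \<le> R x" if x: "norm x < 1" "x \<noteq> 0" for x
  proof -
    have "2 * pi * norm (q x) = norm (2 * pi * q x)" by (simp add: norm_mult)
    also have "2 * pi * q x = contour_integral (circlepath 0 1) (\<lambda>s. of_real (b s) / (s - x)^2)"
      using contour_integral_unique[OF int[OF x]] by (simp add: q_def)
    also have "norm \<dots> \<le> 216 * pi * (N / (1 - norm x) + M / (1 - a) * (1 - norm x) powr (a - 1))"
    proof (rule norm_Cauchy_square_integral_le[OF a N M _ _ x(1)])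
      show "continuous_on (sphere 0 1) (\<lambda>s. complex_of_real (b s))" by (intro continuous_intros b)
      fix s t :: complex assume "s \<in> sphere 0 1" "t \<in> sphere 0 1"
      then show "norm (complex_of_real (b s) - complex_of_real (b t)) \<le> N + M * dist s t powr a"
        using bd by (simp only: of_real_diff[symmetric] norm_of_real)
    qed
    finally have "pi * (2 * norm (q x)) \<le> pi * (216 * (N / (1 - norm x) + M / (1 - a) * (1 - norm x) powr (a - 1)))"
      by (simp only: mult_ac)
    then have "2 * norm (q x) \<le> 216 * (N / (1 - norm x) + M / (1 - a) * (1 - norm x) powr (a - 1))"
      by (rule mult_left_le_imp_le) simp
    then show ?thesis by (simp add: R_def)
  qed
  have "norm (q z) \<le> R z"
  proof (cases "z = 0")
    case True
    have "(q \<longlongrightarrow> q 0) (at 0)" using cq[of 0] by (simp add: isCont_def)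
    then have 1: "((\<lambda>x. norm (q x)) \<longlongrightarrow> norm (q 0)) (at 0)" by (rule tendsto_norm)
    have "isCont R 0" unfolding R_def by (intro continuous_intros) auto
    then have 2: "(R \<longlongrightarrow> R 0) (at 0)" by (simp add: isCont_def)
    have "eventually (\<lambda>x. x \<in> ball (0::complex) 1) (at 0)" by (rule eventually_at_in_open') auto
    moreover have "eventually (\<lambda>x::complex. x \<noteq> 0) (at 0)" by (rule eventually_neq_at_within)
    ultimately have "eventually (\<lambda>x. norm (q x) \<le> R x) (at 0)"
      by eventually_elim (use nz in auto)
    from tendsto_le[OF _ 2 1 this] True show ?thesis by simp
  qed (rule nz[OF z])
  then show ?thesis by (simp add: q_def R_def)
qed

text \<open>The bound is integrated along a radius. The coefficient 1/2 of
  \<open>1 / (1 - norm z)\<close> becomes the exponent -1/2 of \<open>1 - norm z\<close> in the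
  exponential of \<open>l\<close>, while the term with \<open>K\<close> is integrable and only adds
  a constant.\<close>

lemma log_growth:
  fixes l :: "complex \<Rightarrow> complex"
  assumes hol: "l holomorphic_on ball 0 1" and K: "0 \<le> K"
    and bd: "\<And>z. norm z < 1 \<Longrightarrow> norm (deriv l z) \<le> 1/2 / (1 - norm z) + K * (1 - norm z) powr (-1/2)"
    and z: "norm z < 1"
  shows "norm (l z - l 0) \<le> - 1/2 * ln (1 - norm z) + 2 * K"
proof (cases "z = 0")
  case False
  define r where "r = norm z"
  obtain s where s: "s \<in> sphere 0 1" "z = of_real r * s"
    using circle_point_radial[of z] z by (auto simp: r_def)
  have r: "0 < r" "r < 1" using False z by (auto simp: r_def)
  define p where "p = (\<lambda>t::real. of_real t * s)"
  define \<phi> where "\<phi> = (\<lambda>t::real. - 1/2 * ln (1 - t) - 2 * K * (1 - t) powr (1/2))"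
  have np: "norm (p t) = t" if "0 \<le> t" for t using that s by (simp add: p_def norm_mult)
  have "norm ((l \<circ> p) r - (l \<circ> p) 0) \<le> \<phi> r - \<phi> 0"
  proof (rule differentiable_bound_general[OF r(1)])
    show "continuous_on {0..r} (l \<circ> p)"
      unfolding o_def by (rule continuous_on_compose2[OF holomorphic_on_imp_continuous_on[OF hol]])
        (use r np in \<open>auto simp: p_def intro!: continuous_intros\<close>)
    show "continuous_on {0..r} \<phi>"
      unfolding \<phi>_def by (intro continuous_intros) (use r in auto)
    fix t assume t: "0 < t" "t < r"
    have pt: "norm (p t) = t" using np t by simp
    have "(l has_field_derivative deriv l (p t)) (at (p t))"
      by (rule holomorphic_derivI[OF hol]) (use pt t r in auto)
    moreover have "(p has_vector_derivative s) (at t)"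
      unfolding p_def has_vector_derivative_def
      by (auto intro!: derivative_eq_intros simp: scaleR_conv_of_real)
    ultimately show "((l \<circ> p) has_vector_derivative s * deriv l (p t)) (at t)"
      using field_vector_diff_chain_at by blast
    have "((\<lambda>t. (1 - t) powr (1/2)) has_real_derivative 1/2 * (1 - t) powr (1/2 - 1) * (-1)) (at t)"
      by (rule DERIV_chain2[where f = "\<lambda>y. y powr (1/2)"], rule has_real_derivative_powr)
         (use t r in \<open>auto intro!: derivative_eq_intros\<close>)
    moreover have "((\<lambda>t. ln (1 - t)) has_real_derivative - (1 / (1 - t))) (at t)"
      using t r by (auto intro!: derivative_eq_intros)
    ultimately have "(\<phi> has_real_derivative - 1/2 * - (1 / (1 - t)) - 2 * K * (1/2 * (1 - t) powr (1/2 - 1) * (-1))) (at t)"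
      unfolding \<phi>_def by (intro DERIV_diff DERIV_cmult)
    then show "(\<phi> has_vector_derivative 1/2 / (1 - t) + K * (1 - t) powr (-1/2)) (at t)"
      by (simp add: has_real_derivative_iff_has_vector_derivative)
    show "norm (s * deriv l (p t)) \<le> 1/2 / (1 - t) + K * (1 - t) powr (-1/2)"
      using bd[of "p t"] pt t r s by (simp add: norm_mult)
  qed
  also have "\<phi> r - \<phi> 0 \<le> - 1/2 * ln (1 - r) + 2 * K"
    using K by (simp add: \<phi>_def)
  finally show ?thesis unfolding r_def[symmetric] by (simp add: p_def s(2)[symmetric])
qed (use K in simp)

lemma norm_exp_diff_le:
  fixes x y :: complex
  assumes "norm x \<le> R" "norm y \<le> R"
  shows "norm (exp x - exp y) \<le> exp R * norm (x - y)"
proof (rule field_differentiable_bound[where S = "cball 0 R" and f' = exp])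
  show "norm (exp z) \<le> exp R" if "z \<in> cball 0 R" for z :: complex
    using that complex_Re_le_cmod[of z] by (simp add: order_trans)
qed (use assms in \<open>auto intro: DERIV_exp has_field_derivative_at_within\<close>)

text \<open>Kellogg's theorem by a bootstrap: any modulus of continuity of the tangent angle gives
  \<open>F' = O((1 - |z|) powr (-1/2))\<close>, hence a Hoelder condition on \<open>F\<close>, hence one on the tangent angle along
  the circle, hence boundedness of \<open>log F'\<close>, and then the full exponent.\<close>

theorem Kellogg:
  fixes F \<eta> :: "complex \<Rightarrow> complex" and D :: "complex \<times> complex \<Rightarrow> complex"
  assumes F: "continuous_on (cball 0 1) F" and hol: "F holomorphic_on ball 0 1"
    and inj: "inj_on F (cball 0 1)"
    and \<eta>: "\<And>s. s \<in> sphere 0 1 \<Longrightarrow> \<eta> s \<in> sphere 0 1"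
    and D: "continuous_on (sphere 0 1 \<times> sphere 0 1) D" "\<And>p. p \<in> sphere 0 1 \<times> sphere 0 1 \<Longrightarrow> D p \<noteq> 0"
    and chord: "\<And>s t. s \<in> sphere 0 1 \<Longrightarrow> t \<in> sphere 0 1 \<Longrightarrow> F t - F s = D (\<eta> s, \<eta> t) * (\<eta> t - \<eta> s)"
    and \<alpha>: "0 < \<alpha>" "\<alpha> < 1" and H: "0 \<le> H"
    and dh: "\<And>s t. s \<in> sphere 0 1 \<Longrightarrow> t \<in> sphere 0 1 \<Longrightarrow> norm (D (s, s) - D (t, t)) \<le> H * dist s t powr \<alpha>"
  obtains G C where "continuous_on (cball 0 1) G" "0 \<le> C"
    "\<And>z. norm z < 1 \<Longrightarrow> (F has_field_derivative G z) (at z)"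
    "\<And>z. z \<in> cball 0 1 \<Longrightarrow> G z \<noteq> 0"
    "\<And>z w. z \<in> cball 0 1 \<Longrightarrow> w \<in> cball 0 1 \<Longrightarrow> norm (G z - G w) \<le> C * dist z w powr \<alpha>"
proof -
  let ?C = "sphere (0::complex) 1"
  have inj': "inj_on F (ball 0 1)" using inj by (rule inj_on_subset) auto
  have CC: "compact (?C \<times> ?C)" "?C \<times> ?C \<noteq> {}" by (auto intro!: compact_Times exI[of _ 1])
  have cnD: "continuous_on (?C \<times> ?C) (\<lambda>p. norm (D p))" by (intro continuous_intros D)
  obtain p where p: "p \<in> ?C \<times> ?C" "\<And>q. q \<in> ?C \<times> ?C \<Longrightarrow> norm (D p) \<le> norm (D q)"
    using continuous_attains_inf[OF CC cnD] by blast
  obtain p' where p': "p' \<in> ?C \<times> ?C" "\<And>q. q \<in> ?C \<times> ?C \<Longrightarrow> norm (D q) \<le> norm (D p')"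
    using continuous_attains_sup[OF CC cnD] by blast
  \<comment> \<open>The minimum of the chord factor bounds distances of \<open>\<eta>\<close> by
    distances of \<open>F\<close>, so every modulus of continuity of \<open>F\<close> on the circle
    passes to \<open>\<eta>\<close>.\<close>
  define c where "c = norm (D p)"
  have c: "0 < c" using D(2)[OF p(1)] by (simp add: c_def)
  have \<eta>F: "dist (\<eta> s) (\<eta> t) \<le> norm (F s - F t) / c" if "s \<in> ?C" "t \<in> ?C" for s t
  proof -
    have "c * dist (\<eta> s) (\<eta> t) \<le> norm (D (\<eta> s, \<eta> t)) * dist (\<eta> s) (\<eta> t)"
      unfolding c_def using that \<eta> by (intro mult_right_mono p(2)) auto
    also have "\<dots> = norm (F t - F s)" using chord[OF that] by (simp add: norm_mult dist_norm norm_minus_commute)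
    finally show ?thesis using c by (simp add: field_simps norm_minus_commute)
  qed
  have c\<eta>: "continuous_on ?C \<eta>"
    unfolding continuous_on_def
  proof
    fix s assume s: "s \<in> ?C"
    have "continuous_on ?C F" by (rule continuous_on_subset[OF F]) auto
    then have "((\<lambda>t. F t - F s) \<longlongrightarrow> F s - F s) (at s within ?C)"
      using s by (intro tendsto_diff tendsto_const) (auto simp: continuous_on_def)
    then have "((\<lambda>t. norm (F t - F s) / c) \<longlongrightarrow> norm (F s - F s) / c) (at s within ?C)"
      by (rule tendsto_divide[OF tendsto_norm tendsto_const]) (use c in simp)
    then have lim: "((\<lambda>t. norm (F t - F s) / c) \<longlongrightarrow> 0) (at s within ?C)" by simp
    show "(\<eta> \<longlongrightarrow> \<eta> s) (at s within ?C)"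
      by (rule metric_tendsto_imp_tendsto[OF lim])
         (use \<eta>F[OF _ s] c in \<open>auto simp: eventually_at_topological intro!: exI[of _ UNIV]\<close>)
  qed
  obtain b where b: "continuous_on ?C b"
    "\<And>s. s \<in> ?C \<Longrightarrow> cis (b s) = D (\<eta> s, \<eta> s) / cnj (D (\<eta> s, \<eta> s)) * (\<eta> s / s)^2"
    "\<And>z. norm z < 1 \<Longrightarrow> z \<noteq> 0 \<Longrightarrow> ((\<lambda>s. of_real (b s) / (s - z)^2) has_contour_integral
        2 * pi * (deriv (deriv F) z / deriv F z)) (circlepath 0 1)"
  proof (rule tangent_angle[OF F hol inj c\<eta> _ D(1)])
    show "\<eta> s \<in> ?C" if "s \<in> ?C" for s by (rule \<eta>[OF that])
    show "D p \<noteq> 0" if "p \<in> ?C \<times> ?C" for p by (rule D(2)[OF that])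
    show "F t - F s = D (\<eta> s, \<eta> t) * (\<eta> t - \<eta> s)" if "s \<in> ?C" "t \<in> ?C" for s t by (rule chord[OF that])
  qed (rule that; assumption)
  have dFnz: "deriv F z \<noteq> 0" if "norm z < 1" for z
    using holomorphic_injective_imp_regular[OF hol _ inj', of z] that by simp
  have hdF: "deriv F holomorphic_on ball 0 1" by (rule holomorphic_deriv[OF hol]) simp
  have "simply_connected (ball (0::complex) 1)" by (simp add: convex_imp_simply_connected)
  then obtain l where l: "l holomorphic_on ball 0 1" "\<And>z. z \<in> ball 0 1 \<Longrightarrow> deriv F z = exp (l z)"
    using simply_connected_eq_holomorphic_log[of "ball 0 1"] hdF dFnz by (metis mem_ball_0 open_ball)
  have ldiff: "deriv (deriv F) z / deriv F z = deriv l z" if z: "norm z < 1" for z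
  proof -
    have "(l has_field_derivative deriv l z) (at z)"
      by (rule holomorphic_derivI[OF l(1)]) (use z in auto)
    then have "((\<lambda>z. exp (l z)) has_field_derivative exp (l z) * deriv l z) (at z)"
      by (auto intro!: derivative_eq_intros)
    then have "(deriv F has_field_derivative exp (l z) * deriv l z) (at z)"
      by (rule has_field_derivative_transform_within_open[where S = "ball 0 1"]) (use l(2) z in auto)
    then show ?thesis using l(2)[of z] z by (simp add: DERIV_imp_deriv)
  qed
  have lbd: "norm (deriv l z) \<le> 108 * (N / (1 - norm z) + M / (1 - a) * (1 - norm z) powr (a - 1))"
    if "0 \<le> a" "a < 1" "0 \<le> N" "0 \<le> M"
      "\<And>s t. s \<in> ?C \<Longrightarrow> t \<in> ?C \<Longrightarrow> \<bar>b s - b t\<bar> \<le> N + M * dist s t powr a" "norm z < 1" for a N M z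
    using norm_log_derivative_le[OF hol inj' b(1) b(3) that] ldiff[OF that(6)] by simp
  have F_Hoelder: "\<exists>K\<ge>0. \<forall>z\<in>cball 0 1. \<forall>w\<in>cball 0 1. norm (F z - F w) \<le> K * dist z w powr a"
    if a: "0 < a" "a \<le> 1" and K: "0 \<le> K" "\<And>z. norm z < 1 \<Longrightarrow> norm (deriv F z) \<le> K * (1 - norm z) powr (a - 1)" for a K
    using Hardy_Littlewood[OF _ _ F hol K(2) a K(1)] a K(1)
    by (intro exI[of _ "4 * K / a"]) auto
  have b_Hoelder: "\<exists>M\<ge>0. \<forall>s\<in>?C. \<forall>t\<in>?C. \<bar>b s - b t\<bar> \<le> 0 + M * dist s t powr (a * \<alpha>)"
    if a: "0 < a" "a \<le> 1" and K: "0 \<le> K" "\<And>z w. z \<in> cball 0 1 \<Longrightarrow> w \<in> cball 0 1 \<Longrightarrow> norm (F z - F w) \<le> K * dist z w powr a" for a K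
  proof -
    have 1: "dist (\<eta> s) (\<eta> t) \<le> K / c * dist s t powr a" if "s \<in> ?C" "t \<in> ?C" for s t
    proof -
      have "dist (\<eta> s) (\<eta> t) \<le> norm (F s - F t) / c" by (rule \<eta>F[OF that])
      also have "\<dots> \<le> K * dist s t powr a / c" using c that by (intro divide_right_mono K(2)) auto
      finally show ?thesis by simp
    qed
    obtain M where "0 \<le> M" "\<And>s t. s \<in> ?C \<Longrightarrow> t \<in> ?C \<Longrightarrow> \<bar>b s - b t\<bar> \<le> M * dist s t powr (a * \<alpha>)"
    proof (rule tangent_angle_Hoelder[where d = "\<lambda>s. D (s, s)" and c = c and B = "norm (D p')",
          OF b(1) b(2) \<eta> a \<alpha>(1) less_imp_le[OF \<alpha>(2)] _ H c 1 dh])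
      show "0 \<le> K / c" using K(1) c by simp
      show "c \<le> norm (D (s, s))" "norm (D (s, s)) \<le> norm (D p')" if "s \<in> ?C" for s
        using that p(2) p'(2) by (auto simp: c_def)
    qed (assumption | rule that)+
    then show ?thesis by (intro exI[of _ M]) auto
  qed
  have l_bd: "\<exists>K\<ge>0. \<forall>z. norm z < 1 \<longrightarrow> norm (deriv l z) \<le> K * (1 - norm z) powr (a - 1)"
    if a: "0 < a" "a < 1" and "0 \<le> M" "\<forall>s\<in>?C. \<forall>t\<in>?C. \<bar>b s - b t\<bar> \<le> 0 + M * dist s t powr a" for a M
    using lbd[of a 0 M] that by (intro exI[of _ "108 * (M / (1 - a))"]) (auto simp: mult.assoc)
  have l_Hoelder: "\<exists>K\<ge>0. \<forall>z\<in>ball 0 1. \<forall>w\<in>ball 0 1. norm (l z - l w) \<le> K * dist z w powr a"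
    if a: "0 < a" "a < 1" and K: "0 \<le> K" "\<forall>z. norm z < 1 \<longrightarrow> norm (deriv l z) \<le> K * (1 - norm z) powr (a - 1)" for a K
  proof -
    have "norm (l z - l w) \<le> 4 * K / a * dist z w powr a" if "z \<in> ball 0 1" "w \<in> ball 0 1" for z w
      by (rule Hardy_Littlewood[where T = "ball 0 1", OF _ _ holomorphic_on_imp_continuous_on[OF l(1)] l(1)])
         (use a K that in auto)
    then show ?thesis using a K(1) by (intro exI[of _ "4 * K / a"]) auto
  qed

  \<comment> \<open>\<open>1/216\<close> turns the singular term
    \<open>108 * N / (1 - norm z)\<close> into \<open>1/2 / (1 - norm z)\<close>, the case of
    \<open>log_growth\<close>. Any coefficient below 1 would leave a positive Hoelder exponent for
    \<open>F\<close>.\<close>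
  obtain M0 where M0: "0 \<le> M0" "\<And>s t. s \<in> ?C \<Longrightarrow> t \<in> ?C \<Longrightarrow> \<bar>b s - b t\<bar> \<le> 1/216 + M0 * dist s t powr (1/2)"
    using continuous_on_circle_almost_Hoelder[OF b(1), of "1/216" "1/2"] by auto
  have g: "norm (l z - l 0) \<le> - 1/2 * ln (1 - norm z) + 2 * (216 * M0)" if z: "norm z < 1" for z
  proof (rule log_growth[OF l(1) _ _ z])
    fix x :: complex assume x: "norm x < 1"
    define y where "y = 1 - norm x"
    have "norm (deriv l x) \<le> 108 * ((1/216) / y + M0 / (1 - 1/2) * y powr (1/2 - 1))"
      unfolding y_def by (rule lbd[OF _ _ _ M0 x]) auto
    also have "\<dots> = 1/2 / y + 216 * M0 * y powr (-1/2)" by (simp add: algebra_simps)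
    finally show "norm (deriv l x) \<le> 1/2 / (1 - norm x) + 216 * M0 * (1 - norm x) powr (-1/2)"
      by (simp only: y_def)
  qed (use M0 in simp)
  define K0 where "K0 = exp (norm (l 0) + 432 * M0)"
  have "norm (deriv F z) \<le> K0 * (1 - norm z) powr (1/2 - 1)" if z: "norm z < 1" for z
  proof -
    have "norm (deriv F z) = exp (Re (l z))" using l(2)[of z] z by simp
    also have "Re (l z) \<le> norm (l z)" by (rule complex_Re_le_cmod)
    also have "norm (l z) \<le> norm (l 0) + norm (l z - l 0)" by (metis norm_triangle_sub add.commute)
    also have "\<dots> \<le> (norm (l 0) + 432 * M0) + (- 1/2) * ln (1 - norm z)" using g[OF z] by simp
    also have "exp \<dots> = K0 * (1 - norm z) powr (1/2 - 1)"
      using z by (subst exp_add) (simp add: K0_def powr_def)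
    finally show ?thesis by simp
  qed
  then obtain K1 where K1: "0 \<le> K1" "\<And>z w. z \<in> cball 0 1 \<Longrightarrow> w \<in> cball 0 1 \<Longrightarrow> norm (F z - F w) \<le> K1 * dist z w powr (1/2)"
    using F_Hoelder[of "1/2" K0] by (auto simp: K0_def)
  \<comment> \<open>The exponent drops to \<open>\<alpha> / 2\<close> because \<open>\<eta>\<close>
    is so far only Hoelder of order 1/2; once \<open>F\<close> is Lipschitz, so is
    \<open>\<eta>\<close>, and nothing is lost.\<close>
  obtain M1 where M1: "0 \<le> M1" "\<forall>s\<in>?C. \<forall>t\<in>?C. \<bar>b s - b t\<bar> \<le> 0 + M1 * dist s t powr (1/2 * \<alpha>)"
    using b_Hoelder[OF _ _ K1] by auto
  have a1: "0 < 1/2 * \<alpha>" "1/2 * \<alpha> < 1" using \<alpha> by auto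
  obtain K2 where K2: "0 \<le> K2" "\<forall>z. norm z < 1 \<longrightarrow> norm (deriv l z) \<le> K2 * (1 - norm z) powr (1/2 * \<alpha> - 1)"
    using l_bd[OF a1 M1] by blast
  obtain K3 where K3: "0 \<le> K3" "\<forall>z\<in>ball 0 1. \<forall>w\<in>ball 0 1. norm (l z - l w) \<le> K3 * dist z w powr (1/2 * \<alpha>)"
    using l_Hoelder[OF a1 K2] by blast
  define R where "R = norm (l 0) + K3"
  have lR: "norm (l z) \<le> R" if z: "norm z < 1" for z
  proof -
    have "norm (l z - l 0) \<le> K3 * dist z 0 powr (1/2 * \<alpha>)"
      using bspec[OF bspec[OF K3(2), of z], of 0] z by simp
    also have "\<dots> \<le> K3 * 1" using z a1 K3(1) by (intro mult_left_mono powr_le1) auto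
    finally show ?thesis using norm_triangle_sub[of "l z" "l 0"] by (simp add: R_def)
  qed
  have "norm (deriv F z) \<le> exp R * (1 - norm z) powr (1 - 1)" if z: "norm z < 1" for z
  proof -
    have "norm (deriv F z) = exp (Re (l z))" using l(2)[of z] z by simp
    also have "\<dots> \<le> exp R" using complex_Re_le_cmod[of "l z"] lR[OF z] by simp
    finally show ?thesis using z by simp
  qed
  then obtain K4 where K4: "0 \<le> K4" "\<And>z w. z \<in> cball 0 1 \<Longrightarrow> w \<in> cball 0 1 \<Longrightarrow> norm (F z - F w) \<le> K4 * dist z w powr 1"
    using F_Hoelder[of 1 "exp R"] by auto
  obtain M2 where M2: "0 \<le> M2" "\<forall>s\<in>?C. \<forall>t\<in>?C. \<bar>b s - b t\<bar> \<le> 0 + M2 * dist s t powr \<alpha>"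
    using b_Hoelder[OF _ _ K4] by auto
  obtain K5 where K5: "0 \<le> K5" "\<forall>z. norm z < 1 \<longrightarrow> norm (deriv l z) \<le> K5 * (1 - norm z) powr (\<alpha> - 1)"
    using l_bd[OF \<alpha> M2] by blast
  obtain K6 where K6: "0 \<le> K6" "\<forall>z\<in>ball 0 1. \<forall>w\<in>ball 0 1. norm (l z - l w) \<le> K6 * dist z w powr \<alpha>"
    using l_Hoelder[OF \<alpha> K5] by blast
  \<comment> \<open>The logarithm is extended to the circle rather than the derivative itself, so
    the boundary values \<open>exp (m z)\<close> cannot vanish.\<close>
  obtain m where m: "continuous_on (cball 0 1) m" "\<And>z. norm z < 1 \<Longrightarrow> m z = l z"
    "\<And>z w. z \<in> cball 0 1 \<Longrightarrow> w \<in> cball 0 1 \<Longrightarrow> norm (m z - m w) \<le> K6 * dist z w powr \<alpha>"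
    using Hoelder_extension[OF \<alpha>(1), of l K6] K6(2) by auto
  have mR: "norm (m z) \<le> R" if "z \<in> cball 0 1" for z
  proof -
    have "norm (m z) \<le> R" if "z \<in> closure (ball 0 1)" for z
      by (rule continuous_on_closure_norm_le[where f = m, OF _ _ that])
         (use m lR in auto)
    then show ?thesis using that by simp
  qed
  show ?thesis
  proof (rule that[of "\<lambda>z. exp (m z)" "exp R * K6"])
    show "continuous_on (cball 0 1) (\<lambda>z. exp (m z))" by (intro continuous_intros m(1))
    show "0 \<le> exp R * K6" using K6 by simp
    show "(F has_field_derivative exp (m z)) (at z)" if z: "norm z < 1" for z
      using holomorphic_derivI[OF hol, of z] l(2)[of z] m(2)[OF z] z by simp
    fix z w :: complex assume zw: "z \<in> cball 0 1" "w \<in> cball 0 1"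
    have "norm (exp (m z) - exp (m w)) \<le> exp R * norm (m z - m w)"
      by (rule norm_exp_diff_le[OF mR[OF zw(1)] mR[OF zw(2)]])
    also have "\<dots> \<le> exp R * (K6 * dist z w powr \<alpha>)" by (intro mult_left_mono m(3) zw) simp
    finally show "norm (exp (m z) - exp (m w)) \<le> exp R * K6 * dist z w powr \<alpha>" by simp
  qed simp
qed

section \<open>Regularity of the inner map up to the circle\<close>

lemma has_field_derivative_within_unique:
  fixes f :: "complex \<Rightarrow> complex"
  assumes "(f has_field_derivative a) (at x within S)" "(f has_field_derivative b) (at x within S)"
    and S: "connected S" "x \<in> S" "y \<in> S" "y \<noteq> x"
  shows "a = b"
proof -
  have "x islimpt S" by (rule connected_imp_perfect) (use S in auto)
  then have "at x within S \<noteq> bot" using trivial_limit_within by blast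
  then show ?thesis
    using assms(1,2) unfolding has_field_derivative_iff by (rule tendsto_unique)
qed

text \<open>The second derivative is a Cauchy integral of \<open>f\<close> with a kernel of order 3;
  integration by parts along the circle replaces \<open>f\<close> by its tangential derivative
  \<open>g\<close>. The Hoelder condition on \<open>g\<close> bounds the growth, and
  \<open>Hardy_Littlewood\<close> extends the first derivative. On the circle the extension is a
  tangential derivative too, hence equal to \<open>g\<close>.\<close>

lemma Hoelder_boundary_derivative_extends:
  fixes f g :: "complex \<Rightarrow> complex"
  assumes f: "continuous_on (cball 0 1) f" and hol: "f holomorphic_on ball 0 1"
    and g: "\<And>s. s \<in> sphere 0 1 \<Longrightarrow> (f has_field_derivative g s) (at s within sphere 0 1)"
    and \<alpha>: "0 < \<alpha>" "\<alpha> < 1" and K: "0 \<le> K"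
    and gh: "\<And>s t. s \<in> sphere 0 1 \<Longrightarrow> t \<in> sphere 0 1 \<Longrightarrow> norm (g s - g t) \<le> K * dist s t powr \<alpha>"
    and cg: "continuous_on (sphere 0 1) g"
  obtains G C where "continuous_on (cball 0 1) G" "0 \<le> C"
    "\<And>z. z \<in> cball 0 1 \<Longrightarrow> (f has_field_derivative G z) (at z within cball 0 1)"
    "\<And>s. s \<in> sphere 0 1 \<Longrightarrow> G s = g s"
    "\<And>z w. z \<in> cball 0 1 \<Longrightarrow> w \<in> cball 0 1 \<Longrightarrow> norm (G z - G w) \<le> C * dist z w powr \<alpha>"
proof -
  let ?C = "sphere (0::complex) 1"
  have cf: "continuous_on ?C f" by (rule continuous_on_subset[OF f]) auto
  have hdf: "deriv f holomorphic_on ball 0 1" by (rule holomorphic_deriv[OF hol]) simp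
  have bd: "norm (deriv (deriv f) z) \<le> 108 * (K / (1 - \<alpha>)) * (1 - norm z) powr (\<alpha> - 1)" if z: "norm z < 1" for z
  proof -
    have nz: "s - z \<noteq> 0" if "s \<in> ?C" for s using that z by auto
    have 1: "((\<lambda>s. f s / (s - z)^3) has_contour_integral pi * \<i> * deriv (deriv f) z) (circlepath 0 1)"
      using Cauchy_has_contour_integral_higher_derivative_circlepath[OF f hol, of z 2] z
      by (simp add: numeral_2_eq_2 numeral_3_eq_3)
    have 2: "((\<lambda>s. g s / (s - z)^2 - 2 * (f s / (s - z)^3)) has_contour_integral 0) (circlepath 0 1)"
    proof (rule Cauchy_theorem_primitive[where S = ?C and f = "\<lambda>s. f s / (s - z)^2"])
      fix s assume s: "s \<in> ?C"
      have "((\<lambda>s. (s - z)^2) has_field_derivative 2 * (s - z)) (at s within ?C)"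
        by (auto intro!: derivative_eq_intros)
      from DERIV_divide[OF g[OF s] this]
      have "((\<lambda>s. f s / (s - z)^2) has_field_derivative
          (g s * (s - z)^2 - f s * (2 * (s - z))) / ((s - z)^2 * (s - z)^2)) (at s within ?C)"
        using nz[OF s] by simp
      moreover have e: "(g s * d^2 - f s * (2 * d)) / (d^2 * d^2) = g s / d^2 - 2 * (f s / d^3)"
        if "d \<noteq> 0" for d
        using that by (simp add: field_simps power2_eq_square power3_eq_cube)
      ultimately show "((\<lambda>s. f s / (s - z)^2) has_field_derivative g s / (s - z)^2 - 2 * (f s / (s - z)^3))
          (at s within ?C)" by (simp only: e[OF nz[OF s]])
    qed auto
    have "((\<lambda>s. g s / (s - z)^2) has_contour_integral 2 * pi * \<i> * deriv (deriv f) z) (circlepath 0 1)"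
      using has_contour_integral_add[OF 2 has_contour_integral_lmul[OF 1, of 2]] by (simp add: mult.assoc)
    from contour_integral_unique[OF this]
    have "norm (2 * pi * \<i> * deriv (deriv f) z) = norm (contour_integral (circlepath 0 1) (\<lambda>s. g s / (s - z)^2))" by simp
    also have "\<dots> \<le> 216 * pi * (0 / (1 - norm z) + K / (1 - \<alpha>) * (1 - norm z) powr (\<alpha> - 1))"
      by (rule norm_Cauchy_square_integral_le) (use \<alpha> K gh cg z in auto)
    finally have "2 * pi * norm (deriv (deriv f) z) \<le> 2 * pi * (108 * (K / (1 - \<alpha>)) * (1 - norm z) powr (\<alpha> - 1))"
      by (simp add: norm_mult)
    then show ?thesis by (rule mult_left_le_imp_le) simp
  qed
  define C where "C = 4 * (108 * (K / (1 - \<alpha>))) / \<alpha>"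
  have C: "0 \<le> C" using K \<alpha> by (simp add: C_def)
  have "norm (deriv f z - deriv f w) \<le> C * dist z w powr \<alpha>" if "norm z < 1" "norm w < 1" for z w
    unfolding C_def
    by (rule Hardy_Littlewood[where T = "ball 0 1", OF _ _ holomorphic_on_imp_continuous_on[OF hdf] hdf bd])
       (use that \<alpha> K in auto)
  from Hoelder_extension[OF \<alpha>(1) this]
  obtain G where G: "continuous_on (cball 0 1) G" "\<And>z. norm z < 1 \<Longrightarrow> G z = deriv f z"
    "\<And>z w. z \<in> cball 0 1 \<Longrightarrow> w \<in> cball 0 1 \<Longrightarrow> norm (G z - G w) \<le> C * dist z w powr \<alpha>" by blast
  have "(f has_field_derivative G z) (at z)" if "norm z < 1" for z
    using holomorphic_derivI[OF hol, of z] G(2)[OF that] that by simp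
  then have dG: "(f has_field_derivative G z) (at z within cball 0 1)" if "z \<in> cball 0 1" for z
    using has_field_derivative_within_cball[OF f G(1) _ that] by blast
  show ?thesis
  proof (rule that[OF G(1) C dG _ G(3)])
    fix s assume s: "s \<in> ?C"
    have "(f has_field_derivative G s) (at s within ?C)"
      by (rule has_field_derivative_subset[OF dG]) (use s in auto)
    then show "G s = g s"
      by (rule has_field_derivative_within_unique[OF _ g[OF s], where y = "- s"])
         (use s in \<open>auto intro: connected_sphere\<close>)
  qed auto
qed

text \<open>By openness, a small disc around \<open>z\<close> already takes every value near
  \<open>F z\<close>. Along the radius to \<open>a\<close> the values approach
  \<open>F a = F z\<close>, so they are taken a second time, far from \<open>z\<close>.\<close>

lemma injective_boundary_image_disjoint:
  fixes F :: "complex \<Rightarrow> complex"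
  assumes F: "continuous_on (cball 0 1) F" and hol: "F holomorphic_on ball 0 1" and inj: "inj_on F (ball 0 1)"
  shows "F ` sphere 0 1 \<inter> F ` ball 0 1 = {}"
proof -
  have False if a: "norm a = 1" and z: "norm z < 1" and eq: "F a = F z" for a z
  proof -
    define r where "r = (1 - norm z) / 2"
    have r: "0 < r" "norm z + r < 1" using z by (auto simp: r_def field_simps)
    have sub: "ball z r \<subseteq> ball 0 1"
    proof
      fix x assume "x \<in> ball z r"
      then have "norm (x - z) < r" by (simp add: dist_norm norm_minus_commute)
      then show "x \<in> ball 0 1" using r norm_triangle_sub[of x z] by simp
    qed
    have op: "open (F ` ball z r)"
      by (rule open_mapping_thm3[OF holomorphic_on_subset[OF hol sub] _ inj_on_subset[OF inj sub]]) simp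
    define t where "t = (\<lambda>n::nat. complex_of_real (1 - 1 / real (Suc n)) * a)"
    have nt: "norm (t n) = 1 - 1 / real (Suc n)" for n
      unfolding t_def norm_mult norm_of_real a by (simp add: field_simps)
    have tl: "t \<longlonglongrightarrow> a"
      unfolding t_def
      using tendsto_mult[OF tendsto_of_real[OF LIMSEQ_inverse_real_of_nat_add_minus[of 1], where ?'a = complex] tendsto_const[of a]]
      by (simp add: inverse_eq_divide del: of_nat_Suc)
    have "(\<lambda>n. F (t n)) \<longlonglongrightarrow> F a"
      by (rule continuous_on_tendsto_compose[OF F tl]) (use a nt in \<open>auto simp del: of_nat_Suc\<close>)
    moreover have "F a \<in> F ` ball z r" unfolding eq using r by (intro imageI) simp
    ultimately have "eventually (\<lambda>n. F (t n) \<in> F ` ball z r) sequentially"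
      using op topological_tendstoD by blast
    moreover have "eventually (\<lambda>n. norm (t n) > norm z + r) sequentially"
      by (rule order_tendstoD(1)[OF tendsto_norm[OF tl]]) (use a r in simp)
    ultimately have "eventually (\<lambda>n. False) sequentially"
    proof eventually_elim
      case (elim n)
      obtain x where x: "x \<in> ball z r" "F (t n) = F x" using elim(1) by blast
      have "t n = x" by (rule inj_onD[OF inj x(2)]) (use x sub nt in \<open>auto simp del: of_nat_Suc\<close>)
      moreover have "norm (x - z) < r" using x(1) by (simp add: dist_norm norm_minus_commute)
      ultimately show False using elim(2) norm_triangle_sub[of x z] by simp
    qed
    then show False by simp
  qed
  then show ?thesis by fastforce
qed

section \<open>Matching conformal maps\<close>

lemma open_ext_open: "open ext_open"
proof -
  have "ext_open = - cball 0 1" by (auto simp: ext_open_def)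
  then show ?thesis by (metis closed_cball open_Compl)
qed

lemma closure_ext_open: "closure ext_open = ext_closed"
proof
  have "ext_closed = - ball 0 1" by (auto simp: ext_closed_def)
  then have "closed ext_closed" by (metis closed_Compl open_ball)
  moreover have "ext_open \<subseteq> ext_closed" by (auto simp: ext_open_def ext_closed_def)
  ultimately show "closure ext_open \<subseteq> ext_closed" by (rule closure_minimal[rotated])
  show "ext_closed \<subseteq> closure ext_open"
  proof
    fix z assume z: "z \<in> ext_closed"
    define t where "t = (\<lambda>n::nat. (1 + 1 / of_nat (Suc n)) * z)"
    have "(\<lambda>n. (1 + 1 / of_nat (Suc n)) * z) \<longlonglongrightarrow> (1 + 0) * z"
      by (intro tendsto_intros lim_1_over_n[THEN LIMSEQ_Suc])
    then have "t \<longlonglongrightarrow> z" by (simp add: t_def)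
    moreover have "t n \<in> ext_open" for n
    proof -
      have "(1 + 1 / of_nat (Suc n) :: complex) = of_real (1 + 1 / real (Suc n))" by simp
      then have "norm (t n) = (1 + 1 / real (Suc n)) * norm z"
        unfolding t_def by (simp only: norm_mult norm_of_real) (simp add: add_nonneg_nonneg)
      moreover have "(1 + 1 / real (Suc n)) * norm z > 1 * 1"
        using z by (intro mult_less_le_imp_less) (auto simp: ext_closed_def)
      ultimately show ?thesis by (simp add: ext_open_def)
    qed
    ultimately show "z \<in> closure ext_open" unfolding closure_sequential by blast
  qed
qed

text \<open>Inverting both planes turns the exterior map into a map of the unit disc that fixes \<open>0\<close>.\<close>

definition inverted :: "(complex \<Rightarrow> complex) \<Rightarrow> complex \<Rightarrow> complex" where
  "inverted \<phi> x = (if x = 0 then 0 else 1 / \<phi> (1 / x))"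

locale matching_pair =
  fixes f \<phi> :: "complex \<Rightarrow> complex"
  assumes f: "continuous_on (cball 0 1) f" "f holomorphic_on ball 0 1" "inj_on f (cball 0 1)" "f 0 = 0"
    and \<phi>: "\<phi> holomorphic_on ext_open" "inj_on \<phi> ext_open" "filterlim \<phi> at_infinity at_infinity"
      "continuous_on ext_closed \<phi>"
    and matching: "matching f \<phi>"
begin

abbreviation "F \<equiv> inverted \<phi>"

lemma frontier_f: "frontier (f ` ball 0 1) = f ` sphere 0 1"
proof -
  have "open (f ` ball 0 1)"
    by (rule open_mapping_thm3[OF f(2) _ inj_on_subset[OF f(3)]]) auto
  moreover have "closure (f ` ball 0 1) = f ` cball 0 1"
  proof
    show "closure (f ` ball 0 1) \<subseteq> f ` cball 0 1"
      by (intro closure_minimal compact_imp_closed compact_continuous_image f(1)) auto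
    show "f ` cball 0 1 \<subseteq> closure (f ` ball 0 1)"
      using continuous_image_closure_subset[OF f(1), of "ball 0 1"] by simp
  qed
  moreover have "f ` cball 0 1 - f ` ball 0 1 = f ` (cball 0 1 - ball 0 1)"
    by (rule inj_on_image_set_diff[OF f(3), symmetric]) auto
  moreover have "cball (0::complex) 1 - ball 0 1 = sphere 0 1" by auto
  ultimately show ?thesis by (simp add: frontier_def interior_open)
qed

lemma open_exterior_image: "open (\<phi> ` ext_open)"
  by (rule open_mapping_thm3[OF \<phi>(1) open_ext_open \<phi>(2)])

lemma frontier_\<phi>: "frontier (\<phi> ` ext_open) = f ` sphere 0 1"
  using matching frontier_f by (simp add: matching_def disc_def)

text \<open>The inner domain is open, so its disjointness from the exterior domain extends to the
  closure of the latter, which contains the boundary values of \<open>\<phi>\<close>.\<close>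

lemma \<phi>_notin_disc_image:
  assumes "z \<in> ext_closed"
  shows "\<phi> z \<notin> f ` ball 0 1"
proof -
  have "open (f ` ball 0 1)"
    by (rule open_mapping_thm3[OF f(2) _ inj_on_subset[OF f(3)]]) auto
  moreover have "f ` ball 0 1 \<inter> \<phi> ` ext_open = {}"
    using matching by (simp add: matching_def disc_def)
  ultimately have "f ` ball 0 1 \<inter> closure (\<phi> ` ext_open) = {}"
    by (simp add: open_Int_closure_eq_empty)
  moreover have "\<phi> z \<in> closure (\<phi> ` ext_open)"
    using continuous_image_closure_subset[OF \<phi>(4), of ext_open] assms closure_ext_open by auto
  ultimately show ?thesis by auto
qed

lemma \<phi>_nonzero: "z \<in> ext_closed \<Longrightarrow> \<phi> z \<noteq> 0"
  using \<phi>_notin_disc_image[of z] f(4) imageI[of 0 "ball 0 1" f] by auto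

lemma f_nonzero: "s \<in> sphere 0 1 \<Longrightarrow> f s \<noteq> 0"
  using inj_onD[OF f(3), of s 0] f(4) by auto

lemma inverse_in_ext: "x \<noteq> 0 \<Longrightarrow> norm x \<le> 1 \<Longrightarrow> 1 / x \<in> ext_closed"
  "x \<noteq> 0 \<Longrightarrow> norm x < 1 \<Longrightarrow> 1 / x \<in> ext_open" for x :: complex
  by (auto simp: ext_closed_def ext_open_def norm_divide field_simps)

lemma holomorphic_F: "F holomorphic_on ball 0 1"
proof (rule no_isolated_singularity'[where K = "{0}"])
  have "(\<lambda>x. 1 / \<phi> (1 / x)) holomorphic_on ball 0 1 - {0}"
  proof (intro holomorphic_on_divide holomorphic_on_const)
    show "(\<lambda>x. \<phi> (1 / x)) holomorphic_on ball 0 1 - {0}"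
      by (rule holomorphic_on_compose_gen[OF _ \<phi>(1), unfolded o_def, of "\<lambda>x. 1 / x"])
         (auto intro!: holomorphic_intros inverse_in_ext)
  qed (use \<phi>_nonzero inverse_in_ext in auto)
  then show "F holomorphic_on ball 0 1 - {0}"
    by (rule holomorphic_transform) (auto simp: inverted_def)
  fix z :: complex assume "z \<in> {0}"
  have "filterlim (\<lambda>x::complex. 1 / x) at_infinity (at 0)"
    using filterlim_inverse_at_infinity[where ?'a = complex] by (simp only: inverse_eq_divide[abs_def])
  then have "filterlim (\<lambda>x. \<phi> (1 / x)) at_infinity (at 0)"
    by (rule filterlim_compose[OF \<phi>(3)])
  then have "((\<lambda>x. inverse (\<phi> (1 / x))) \<longlongrightarrow> 0) (at 0)"
    by (rule filterlim_compose[OF tendsto_inverse_0])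
  then have "(F \<longlongrightarrow> 0) (at 0)"
    by (rule Lim_transform_eventually) (auto simp: eventually_at_filter inverted_def inverse_eq_divide)
  then have "(F \<longlongrightarrow> 0) (at 0 within ball 0 1)" by (rule tendsto_within_subset) simp
  then show "(F \<longlongrightarrow> F z) (at z within ball 0 1)" using \<open>z \<in> {0}\<close> by (simp add: inverted_def)
qed auto

lemma continuous_F: "continuous_on (cball 0 1) F"
proof (rule continuous_on_cball_puncture)
  show "continuous_on (ball 0 1) F" by (rule holomorphic_on_imp_continuous_on[OF holomorphic_F])
  have "continuous_on (cball 0 1 - {0}) (\<lambda>x. 1 / \<phi> (1 / x))"
  proof (intro continuous_on_divide continuous_on_const)
    show "continuous_on (cball 0 1 - {0}) (\<lambda>x. \<phi> (1 / x))"
      by (rule continuous_on_compose2[OF \<phi>(4)]) (auto intro!: continuous_intros inverse_in_ext)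
  qed (use \<phi>_nonzero inverse_in_ext in auto)
  then show "continuous_on (cball 0 1 - {0}) F"
    by (rule continuous_on_eq) (auto simp: inverted_def)
qed

lemma F_nonzero: "x \<in> cball 0 1 \<Longrightarrow> x \<noteq> 0 \<Longrightarrow> F x \<noteq> 0"
  using \<phi>_nonzero inverse_in_ext(1)[of x] by (simp add: inverted_def)

lemma inj_F_ball: "inj_on F (ball 0 1)"
proof (rule inj_onI)
  fix x y :: complex assume xy: "x \<in> ball 0 1" "y \<in> ball 0 1" "F x = F y"
  consider "x = 0" | "y = 0" | "x \<noteq> 0" "y \<noteq> 0" by blast
  then show "x = y"
  proof cases
    case 1
    then have "F y = 0" using xy by (simp add: inverted_def)
    then show ?thesis using 1 xy(2) F_nonzero[of y] by auto
  next
    case 2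
    then have "F x = 0" using xy by (simp add: inverted_def)
    then show ?thesis using 2 xy(1) F_nonzero[of x] by auto
  next
    case 3
    then have "\<phi> (1 / x) = \<phi> (1 / y)" using xy(3) by (simp add: inverted_def)
    then have "1 / x = 1 / y" by (rule inj_onD[OF \<phi>(2)]) (use 3 xy inverse_in_ext in auto)
    then show ?thesis by simp
  qed
qed

text \<open>A boundary value of \<open>\<phi>\<close> lies in the closure of the exterior domain,
  and not in the domain by \<open>injective_boundary_image_disjoint\<close>; so it lies in the
  frontier, which matching identifies with the curve.\<close>

lemma F_sphere_subset: "F ` sphere 0 1 \<subseteq> (\<lambda>s. 1 / f s) ` sphere 0 1"
proof
  fix y assume "y \<in> F ` sphere 0 1"
  then obtain x where x: "norm x = 1" "y = F x" by auto
  have x0: "x \<noteq> 0" using x by auto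
  have "\<phi> (1 / x) \<notin> \<phi> ` ext_open"
  proof
    assume "\<phi> (1 / x) \<in> \<phi> ` ext_open"
    then obtain z where z: "1 < norm z" "\<phi> (1 / x) = \<phi> z" by (auto simp: ext_open_def)
    have z0: "z \<noteq> 0" using z by auto
    have "F x = F (1 / z)" using z x0 z0 by (simp add: inverted_def)
    moreover have "1 / z \<in> ball 0 1" using z by (simp add: norm_divide divide_simps)
    ultimately have "F x \<in> F ` ball 0 1" by (metis imageI)
    moreover have "F x \<in> F ` sphere 0 1" using x by (intro imageI) simp
    ultimately show False
      using injective_boundary_image_disjoint[OF continuous_F holomorphic_F inj_F_ball] by blast
  qed
  moreover have "\<phi> (1 / x) \<in> closure (\<phi> ` ext_open)"
    using continuous_image_closure_subset[OF \<phi>(4), of ext_open] inverse_in_ext(1)[of x] x x0 closure_ext_open by auto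
  ultimately have "\<phi> (1 / x) \<in> f ` sphere 0 1"
    using frontier_\<phi> open_exterior_image by (auto simp: frontier_def interior_open)
  then show "y \<in> (\<lambda>s. 1 / f s) ` sphere 0 1" using x x0 by (auto simp: inverted_def)
qed

lemma F_ball_disjoint: "F ` ball 0 1 \<inter> (\<lambda>s. 1 / f s) ` sphere 0 1 = {}"
proof -
  have "F x \<noteq> 1 / f s" if x: "x \<in> ball 0 1" and s: "s \<in> sphere 0 1" for x s
  proof
    assume eq: "F x = 1 / f s"
    have x0: "x \<noteq> 0" using eq f_nonzero[OF s] by (auto simp: inverted_def)
    then have "f s = \<phi> (1 / x)" using eq f_nonzero[OF s] by (simp add: inverted_def field_simps)
    moreover have "\<phi> (1 / x) \<in> \<phi> ` ext_open" using inverse_in_ext(2)[OF x0] x by (intro imageI) simp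
    moreover have "f s \<in> frontier (\<phi> ` ext_open)" unfolding frontier_\<phi> using s by (rule imageI)
    ultimately show False using open_exterior_image by (auto simp: frontier_def interior_open)
  qed
  then show ?thesis by blast
qed

lemma inj_F: "inj_on F (cball 0 1)"
proof (rule inj_on_cball_of_Jordan_boundary[OF continuous_F holomorphic_F inj_F_ball])
  show "continuous_on (sphere 0 1) (\<lambda>s. 1 / f s)"
    using f_nonzero by (intro continuous_intros continuous_on_subset[OF f(1)]) auto
  show "inj_on (\<lambda>s. 1 / f s) (sphere 0 1)"
    using f(3) f_nonzero by (auto simp: inj_on_def)
qed (rule F_sphere_subset F_ball_disjoint)+

text \<open>Every point of the curve is a limit of exterior values. Their preimages might escape to
  infinity, but after inversion that is the point 0 of a compact disc, whose image is
  closed.\<close>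

lemma F_sphere: "F ` sphere 0 1 = (\<lambda>s. 1 / f s) ` sphere 0 1"
proof
  show "(\<lambda>s. 1 / f s) ` sphere 0 1 \<subseteq> F ` sphere 0 1"
  proof
    fix y assume "y \<in> (\<lambda>s. 1 / f s) ` sphere 0 1"
    then obtain s where s: "s \<in> sphere 0 1" "y = 1 / f s" by blast
    have "f s \<in> closure (\<phi> ` ext_open)"
      using frontier_\<phi> imageI[OF s(1), of f] by (auto simp: frontier_def)
    then obtain w where w: "\<And>n. w n \<in> \<phi> ` ext_open" "w \<longlonglongrightarrow> f s"
      unfolding closure_sequential by blast
    have lim: "(\<lambda>n. 1 / w n) \<longlonglongrightarrow> y"
      unfolding s(2) by (intro tendsto_intros w) (rule f_nonzero[OF s(1)])
    have mem: "1 / w n \<in> F ` cball 0 1" for n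
    proof -
      obtain z where z: "1 < norm z" "w n = \<phi> z" using w(1)[of n] by (auto simp: ext_open_def)
      have "z \<noteq> 0" using z by auto
      then have "1 / w n = F (1 / z)" using z by (simp add: inverted_def)
      moreover have "F (1 / z) \<in> F ` cball 0 1"
        by (rule imageI) (use z in \<open>simp add: norm_divide divide_simps\<close>)
      ultimately show ?thesis by simp
    qed
    have "closed (F ` cball 0 1)"
      by (intro compact_imp_closed compact_continuous_image continuous_F compact_cball)
    then have "y \<in> F ` cball 0 1" using mem lim by (rule closed_sequentially)
    then obtain x where x: "y = F x" "x \<in> cball 0 1" by (rule imageE)
    have "y \<notin> F ` ball 0 1" using F_ball_disjoint imageI[OF s(1), of "\<lambda>s. 1 / f s"] s(2) by auto
    then have "x \<notin> ball 0 1" using x(1) by auto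
    then have "x \<in> sphere 0 1" using x(2) by simp
    then show "y \<in> F ` sphere 0 1" unfolding x(1) by (rule imageI)
  qed
qed (rule F_sphere_subset)

end

section \<open>Hoelder continuous functions on the circle\<close>

lemma lip_circleE:
  assumes "lip_circle \<alpha> v"
  obtains C where "0 \<le> C" "\<And>x y. x \<in> sphere 0 1 \<Longrightarrow> y \<in> sphere 0 1 \<Longrightarrow> norm (v x - v y) \<le> C * dist x y powr \<alpha>"
proof -
  obtain C where C: "\<And>x y. x \<in> sphere 0 1 \<Longrightarrow> y \<in> sphere 0 1 \<Longrightarrow> norm (v x - v y) \<le> C * dist x y powr \<alpha>"
    using assms unfolding lip_circle_def circle_def by blast
  show ?thesis
  proof (rule that[of "\<bar>C\<bar>"])
    fix x y :: complex assume "x \<in> sphere 0 1" "y \<in> sphere 0 1"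
    from C[OF this] show "norm (v x - v y) \<le> \<bar>C\<bar> * dist x y powr \<alpha>"
      by (rule order_trans) (intro mult_right_mono, auto)
  qed simp
qed

lemma lip_circleI:
  assumes "\<And>x y. x \<in> sphere 0 1 \<Longrightarrow> y \<in> sphere 0 1 \<Longrightarrow> norm (v x - v y) \<le> C * dist x y powr \<alpha>"
  shows "lip_circle \<alpha> v"
  using assms unfolding lip_circle_def circle_def by blast

lemma lip_circle_cong:
  assumes "\<And>x. x \<in> sphere 0 1 \<Longrightarrow> u x = v x"
  shows "lip_circle \<alpha> u \<longleftrightarrow> lip_circle \<alpha> v"
  using assms by (simp add: lip_circle_def circle_def)

lemma continuous_on_lip_circle:
  assumes v: "lip_circle \<alpha> v" and \<alpha>: "0 < \<alpha>"
  shows "continuous_on (sphere 0 1) v"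
  unfolding continuous_on_def
proof
  fix x :: complex assume x: "x \<in> sphere 0 1"
  obtain C where C: "0 \<le> C" "\<And>x y. x \<in> sphere 0 1 \<Longrightarrow> y \<in> sphere 0 1 \<Longrightarrow> norm (v x - v y) \<le> C * dist x y powr \<alpha>"
    using lip_circleE[OF v] by blast
  have "((\<lambda>y. dist y x) \<longlongrightarrow> 0) (at x within sphere 0 1)"
    using tendsto_dist[OF tendsto_ident_at tendsto_const[of x], of x "sphere 0 1"] by simp
  then have "((\<lambda>y. C * dist y x powr \<alpha>) \<longlongrightarrow> C * 0 powr \<alpha>) (at x within sphere 0 1)"
    by (intro tendsto_mult tendsto_const tendsto_powr') (use \<alpha> in auto)
  then have lim: "((\<lambda>y. C * dist y x powr \<alpha>) \<longlongrightarrow> 0) (at x within sphere 0 1)" using \<alpha> by simp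
  have ev: "eventually (\<lambda>y. y \<in> sphere 0 1) (at x within sphere 0 1)"
    by (simp add: eventually_at_filter)
  show "(v \<longlongrightarrow> v x) (at x within sphere 0 1)"
    by (rule metric_tendsto_imp_tendsto[OF lim], rule eventually_mono[OF ev])
       (use C x in \<open>auto simp: dist_norm\<close>)
qed

lemma bounded_lip_circle:
  assumes "lip_circle \<alpha> v" "0 < \<alpha>"
  obtains B where "0 \<le> B" "\<And>x. x \<in> sphere 0 1 \<Longrightarrow> norm (v x) \<le> B"
proof -
  have "bounded (v ` sphere 0 1)"
    by (intro compact_imp_bounded compact_continuous_image continuous_on_lip_circle[OF assms] compact_sphere)
  then obtain B where B: "\<And>x. x \<in> sphere 0 1 \<Longrightarrow> norm (v x) \<le> B"
    unfolding bounded_iff by (metis imageI)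
  then show ?thesis using that[of B] order_trans[OF norm_ge_zero B[of 1]] by simp
qed

lemma lip_circle_mult:
  assumes u: "lip_circle \<alpha> u" and v: "lip_circle \<alpha> v" and \<alpha>: "0 < \<alpha>"
  shows "lip_circle \<alpha> (\<lambda>x. u x * v x)"
proof -
  obtain C where C: "0 \<le> C" "\<And>x y. x \<in> sphere 0 1 \<Longrightarrow> y \<in> sphere 0 1 \<Longrightarrow> norm (u x - u y) \<le> C * dist x y powr \<alpha>"
    using lip_circleE[OF u] by blast
  obtain D where D: "0 \<le> D" "\<And>x y. x \<in> sphere 0 1 \<Longrightarrow> y \<in> sphere 0 1 \<Longrightarrow> norm (v x - v y) \<le> D * dist x y powr \<alpha>"
    using lip_circleE[OF v] by blast
  obtain A where A: "0 \<le> A" "\<And>x. x \<in> sphere 0 1 \<Longrightarrow> norm (u x) \<le> A" using bounded_lip_circle[OF u \<alpha>] by blast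
  obtain B where B: "0 \<le> B" "\<And>x. x \<in> sphere 0 1 \<Longrightarrow> norm (v x) \<le> B" using bounded_lip_circle[OF v \<alpha>] by blast
  show ?thesis
  proof (rule lip_circleI)
    fix x y :: complex assume xy: "x \<in> sphere 0 1" "y \<in> sphere 0 1"
    have "u x * v x - u y * v y = u x * (v x - v y) + (u x - u y) * v y" by (simp add: algebra_simps)
    then have "norm (u x * v x - u y * v y) \<le> norm (u x) * norm (v x - v y) + norm (u x - u y) * norm (v y)"
      by (metis norm_triangle_ineq norm_mult)
    also have "\<dots> \<le> A * (D * dist x y powr \<alpha>) + (C * dist x y powr \<alpha>) * B"
      using A B C(1) D(1) by (intro add_mono mult_mono A B C D xy) auto
    finally show "norm (u x * v x - u y * v y) \<le> (A * D + C * B) * dist x y powr \<alpha>"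
      by (simp add: algebra_simps)
  qed
qed

lemma lip_circle_inverse:
  assumes u: "lip_circle \<alpha> u" and nz: "\<And>x. x \<in> sphere 0 1 \<Longrightarrow> u x \<noteq> 0" and \<alpha>: "0 < \<alpha>"
  shows "lip_circle \<alpha> (\<lambda>x. 1 / u x)"
proof -
  obtain C where C: "0 \<le> C" "\<And>x y. x \<in> sphere 0 1 \<Longrightarrow> y \<in> sphere 0 1 \<Longrightarrow> norm (u x - u y) \<le> C * dist x y powr \<alpha>"
    using lip_circleE[OF u] by blast
  have "continuous_on (sphere 0 1) (\<lambda>x. 1 / u x)"
    by (intro continuous_intros continuous_on_lip_circle[OF u \<alpha>]) (use nz in auto)
  then have "bounded ((\<lambda>x. 1 / u x) ` sphere 0 1)"
    by (intro compact_imp_bounded compact_continuous_image compact_sphere)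
  then obtain B where B: "\<And>x. x \<in> sphere 0 1 \<Longrightarrow> norm (1 / u x) \<le> B"
    unfolding bounded_iff by (metis imageI)
  have B0: "0 \<le> B" using order_trans[OF norm_ge_zero B[of 1]] by simp
  show ?thesis
  proof (rule lip_circleI)
    fix x y :: complex assume xy: "x \<in> sphere 0 1" "y \<in> sphere 0 1"
    have "1 / u x - 1 / u y = (1 / u x) * (1 / u y) * (u y - u x)"
      using nz[OF xy(1)] nz[OF xy(2)] by (simp add: field_simps)
    then have "norm (1 / u x - 1 / u y) = norm (1 / u x) * norm (1 / u y) * norm (u x - u y)"
      by (simp only: norm_mult norm_minus_commute)
    also have "\<dots> \<le> B * B * (C * dist x y powr \<alpha>)"
      using B0 by (intro mult_mono B C xy) auto
    finally show "norm (1 / u x - 1 / u y) \<le> (B * B * C) * dist x y powr \<alpha>" by simp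
  qed
qed

lemma lip_circle_divide:
  assumes "lip_circle \<alpha> u" "lip_circle \<alpha> v" "\<And>x. x \<in> sphere 0 1 \<Longrightarrow> v x \<noteq> 0" "0 < \<alpha>"
  shows "lip_circle \<alpha> (\<lambda>x. u x / v x)"
  using lip_circle_mult[OF assms(1) lip_circle_inverse[OF assms(2-4)] assms(4)] by simp

lemma lip_circle_Lipschitz:
  assumes "\<And>x y. x \<in> sphere 0 1 \<Longrightarrow> y \<in> sphere 0 1 \<Longrightarrow> dist (u x) (u y) \<le> C * dist x y"
    and C: "0 \<le> C" and \<alpha>: "0 < \<alpha>" "\<alpha> \<le> 1"
  shows "lip_circle \<alpha> u"
proof (rule lip_circleI)
  fix x y :: complex assume xy: "x \<in> sphere 0 1" "y \<in> sphere 0 1"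
  have "norm (u x - u y) \<le> C * dist x y powr 1" using assms(1)[OF xy] by (simp add: dist_norm)
  also have "\<dots> \<le> C * (2 * dist x y powr \<alpha>)"
    using dist_circle_le_2[OF xy] \<alpha> by (intro mult_left_mono powr_le_twice_powr C) auto
  finally show "norm (u x - u y) \<le> (C * 2) * dist x y powr \<alpha>" by simp
qed

lemma lip_circle_ident: "0 < \<alpha> \<Longrightarrow> \<alpha> \<le> 1 \<Longrightarrow> lip_circle \<alpha> (\<lambda>x. x)"
  by (rule lip_circle_Lipschitz[of _ 1]) auto

lemma lip_circle_compose:
  assumes v: "lip_circle \<alpha> v" and k: "\<And>x. x \<in> sphere 0 1 \<Longrightarrow> k x \<in> sphere 0 1"
    and L: "\<And>x y. x \<in> sphere 0 1 \<Longrightarrow> y \<in> sphere 0 1 \<Longrightarrow> dist (k x) (k y) \<le> L * dist x y"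
    and L0: "0 \<le> L" and \<alpha>: "0 < \<alpha>"
  shows "lip_circle \<alpha> (\<lambda>x. v (k x))"
proof -
  obtain C where C: "0 \<le> C" "\<And>x y. x \<in> sphere 0 1 \<Longrightarrow> y \<in> sphere 0 1 \<Longrightarrow> norm (v x - v y) \<le> C * dist x y powr \<alpha>"
    using lip_circleE[OF v] by blast
  show ?thesis
  proof (rule lip_circleI)
    fix x y :: complex assume xy: "x \<in> sphere 0 1" "y \<in> sphere 0 1"
    have "norm (v (k x) - v (k y)) \<le> C * dist (k x) (k y) powr \<alpha>" by (intro C k xy)
    also have "\<dots> \<le> C * (L * dist x y) powr \<alpha>"
      using L[OF xy] \<alpha> C(1) by (intro mult_left_mono powr_mono2) auto
    also have "\<dots> = (C * L powr \<alpha>) * dist x y powr \<alpha>" using L0 by (simp add: powr_mult)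
    finally show "norm (v (k x) - v (k y)) \<le> (C * L powr \<alpha>) * dist x y powr \<alpha>" .
  qed
qed

text \<open>\<open>f1\<close> and \<open>F1\<close> are the derivatives on the closed disc. As
  parameters they are continuous and zero free up to the circle, where the two-sided
  \<open>deriv\<close> is not determined by these maps.\<close>

locale smooth_pair = matching_pair +
  fixes \<alpha> :: real and f1 F1 :: "complex \<Rightarrow> complex"
  assumes \<alpha>: "0 < \<alpha>" "\<alpha> < 1"
    and f1: "continuous_on (cball 0 1) f1" "\<And>z. z \<in> cball 0 1 \<Longrightarrow> f1 z \<noteq> 0" "lip_circle \<alpha> f1"
      "\<And>z. z \<in> cball 0 1 \<Longrightarrow> (f has_field_derivative f1 z) (at z within cball 0 1)"
    and F1: "continuous_on (cball 0 1) F1" "\<And>z. z \<in> cball 0 1 \<Longrightarrow> F1 z \<noteq> 0" "lip_circle \<alpha> F1"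
      "\<And>z. z \<in> cball 0 1 \<Longrightarrow> (inverted \<phi> has_field_derivative F1 z) (at z within cball 0 1)"

lemma (in matching_pair) smooth_pair_exists:
  assumes \<alpha>: "0 < \<alpha>" "\<alpha> < 1"
    and g: "\<And>s. s \<in> sphere 0 1 \<Longrightarrow> (f has_field_derivative g s) (at s within sphere 0 1)"
      "\<And>s. s \<in> sphere 0 1 \<Longrightarrow> g s \<noteq> 0" "lip_circle \<alpha> g"
  obtains f1 F1 where "smooth_pair f \<phi> \<alpha> f1 F1" "\<And>s. s \<in> sphere 0 1 \<Longrightarrow> f1 s = g s"
proof -
  let ?C = "sphere (0::complex) 1"
  obtain K where K: "0 \<le> K" "\<And>x y. x \<in> ?C \<Longrightarrow> y \<in> ?C \<Longrightarrow> norm (g x - g y) \<le> K * dist x y powr \<alpha>"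
    using lip_circleE[OF g(3)] by blast
  obtain f1 C where f1: "continuous_on (cball 0 1) f1" "0 \<le> C"
    "\<And>z. z \<in> cball 0 1 \<Longrightarrow> (f has_field_derivative f1 z) (at z within cball 0 1)"
    "\<And>s. s \<in> ?C \<Longrightarrow> f1 s = g s"
    "\<And>z w. z \<in> cball 0 1 \<Longrightarrow> w \<in> cball 0 1 \<Longrightarrow> norm (f1 z - f1 w) \<le> C * dist z w powr \<alpha>"
    using Hoelder_boundary_derivative_extends[OF f(1,2) g(1) \<alpha> K continuous_on_lip_circle[OF g(3) \<alpha>(1)]] by blast
  have f1nz: "f1 z \<noteq> 0" if z: "z \<in> cball 0 1" for z
  proof (cases "norm z = 1")
    case True then show ?thesis using f1(4)[of z] g(2)[of z] by simp
  next
    case False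
    then have zb: "z \<in> ball 0 1" using z by simp
    have "at z within cball 0 1 = at z" by (rule at_within_interior) (use zb in simp)
    then have "deriv f z = f1 z" using f1(3)[OF z] DERIV_imp_deriv by metis
    moreover have "deriv f z \<noteq> 0"
      by (rule holomorphic_injective_imp_regular[OF f(2) _ inj_on_subset[OF f(3)] zb]) auto
    ultimately show ?thesis by simp
  qed
  obtain D where D: "continuous_on (cball 0 1 \<times> cball 0 1) D" "\<And>x. x \<in> cball 0 1 \<Longrightarrow> D (x, x) = f1 x"
    "\<And>x y. x \<in> cball 0 1 \<Longrightarrow> y \<in> cball 0 1 \<Longrightarrow> f y - f x = D (x, y) * (y - x)"
    using divided_difference_cball[OF f1(1,3)] by blast
  obtain c L where L: "0 < c" "0 < L"
    "\<And>x y. x \<in> cball 0 1 \<Longrightarrow> y \<in> cball 0 1 \<Longrightarrow> c * dist x y \<le> dist (f x) (f y)"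
    "\<And>x y. x \<in> cball 0 1 \<Longrightarrow> y \<in> cball 0 1 \<Longrightarrow> dist (f x) (f y) \<le> L * dist x y"
    by (rule bilipschitz_cball[OF f1(1,3) f(3) f1nz]) (assumption | rule that; assumption)+
  have f1l: "lip_circle \<alpha> f1" using lip_circle_cong[of f1 g] f1(4) g(3) by simp
  have fl: "lip_circle \<alpha> f"
    by (rule lip_circle_Lipschitz[of _ L]) (use L \<alpha> in auto)
  \<comment> \<open>The chord factor of the inverted curve: a difference of \<open>1 / f\<close> is
    \<open>E\<close> times the chord of the circle. \<open>\<eta>\<close> is the boundary
    correspondence from \<open>F\<close> to this parametrisation, so \<open>Kellogg\<close> applies
    to \<open>F\<close> with \<open>E\<close>.\<close>
  define E where "E = (\<lambda>p. - D p / (f (fst p) * f (snd p)))"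
  define \<eta> where "\<eta> = (\<lambda>s. inv_into ?C (\<lambda>s. 1 / f s) (F s))"
  have \<eta>: "\<eta> s \<in> ?C" "1 / f (\<eta> s) = F s" if "s \<in> ?C" for s
  proof -
    have "F s \<in> (\<lambda>s. 1 / f s) ` ?C" using F_sphere imageI[OF that, of F] by simp
    then show "\<eta> s \<in> ?C" "1 / f (\<eta> s) = F s"
      unfolding \<eta>_def by (rule inv_into_into, rule f_inv_into_f)
  qed
  have El: "lip_circle \<alpha> (\<lambda>s. - (f1 s / (f s * f s)))"
  proof -
    have "lip_circle \<alpha> (\<lambda>s. f1 s / (f s * f s))"
      by (intro lip_circle_divide lip_circle_mult f1l fl \<alpha>) (use f_nonzero in auto)
    then show ?thesis by (simp add: lip_circle_def norm_minus_commute)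
  qed
  obtain H where H: "0 \<le> H" "\<And>x y. x \<in> ?C \<Longrightarrow> y \<in> ?C \<Longrightarrow>
      norm (- (f1 x / (f x * f x)) - - (f1 y / (f y * f y))) \<le> H * dist x y powr \<alpha>"
    using lip_circleE[OF El] by blast
  have "\<exists>F1 C. continuous_on (cball 0 1) F1 \<and> (\<forall>z. norm z < 1 \<longrightarrow> (F has_field_derivative F1 z) (at z))
      \<and> (\<forall>z\<in>cball 0 1. F1 z \<noteq> 0) \<and> (\<forall>z\<in>cball 0 1. \<forall>w\<in>cball 0 1. norm (F1 z - F1 w) \<le> C * dist z w powr \<alpha>)"
  proof (rule Kellogg[OF continuous_F holomorphic_F inj_F _ _ _ _ \<alpha> H(1)])
    show "\<eta> s \<in> ?C" if "s \<in> ?C" for s by (rule \<eta>[OF that])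
    show "continuous_on (?C \<times> ?C) E"
      unfolding E_def using f_nonzero
      by (intro continuous_intros continuous_on_subset[OF D(1)] continuous_on_compose2[OF f(1)]) auto
    show "E p \<noteq> 0" if p: "p \<in> ?C \<times> ?C" for p
    proof -
      obtain x y where xy: "p = (x, y)" "x \<in> ?C" "y \<in> ?C" using p by blast
      have "D (x, y) \<noteq> 0"
      proof (cases "x = y")
        case True then show ?thesis using D(2)[of x] f1nz[of x] xy by simp
      next
        case False
        then have "f y - f x \<noteq> 0" using inj_onD[OF f(3), of x y] xy by auto
        then show ?thesis using D(3)[of x y] xy by auto
      qed
      then show ?thesis using xy f_nonzero by (simp add: E_def)
    qed
    show "F t - F s = E (\<eta> s, \<eta> t) * (\<eta> t - \<eta> s)" if st: "s \<in> ?C" "t \<in> ?C" for s t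
    proof -
      have nz: "f (\<eta> s) \<noteq> 0" "f (\<eta> t) \<noteq> 0" using f_nonzero \<eta>(1) st by auto
      have d: "f (\<eta> t) - f (\<eta> s) = D (\<eta> s, \<eta> t) * (\<eta> t - \<eta> s)" by (rule D(3)) (use \<eta>(1) st in auto)
      have "F t - F s = - (f (\<eta> t) - f (\<eta> s)) / (f (\<eta> s) * f (\<eta> t))"
        unfolding \<eta>(2)[OF st(1), symmetric] \<eta>(2)[OF st(2), symmetric] using nz by (simp add: field_simps)
      then show ?thesis unfolding d E_def by simp
    qed
    show "norm (E (s, s) - E (t, t)) \<le> H * dist s t powr \<alpha>" if "s \<in> ?C" "t \<in> ?C" for s t
      using H(2)[OF that] D(2)[of s] D(2)[of t] that by (simp add: E_def)
  qed blast
  then obtain F1 C' where F1: "continuous_on (cball 0 1) F1" "\<And>z. norm z < 1 \<Longrightarrow> (F has_field_derivative F1 z) (at z)"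
    "\<And>z. z \<in> cball 0 1 \<Longrightarrow> F1 z \<noteq> 0"
    "\<And>z w. z \<in> cball 0 1 \<Longrightarrow> w \<in> cball 0 1 \<Longrightarrow> norm (F1 z - F1 w) \<le> C' * dist z w powr \<alpha>" by blast
  have "smooth_pair f \<phi> \<alpha> f1 F1"
  proof (unfold_locales)
    show "lip_circle \<alpha> F1" by (rule lip_circleI[of _ C']) (use F1(4) in auto)
    show "(F has_field_derivative F1 z) (at z within cball 0 1)" if "z \<in> cball 0 1" for z
      using has_field_derivative_within_cball[OF continuous_F F1(1) F1(2) that] .
  qed (fact \<alpha> f1(1) f1nz f1l f1(3) F1(1) F1(3))+
  then show ?thesis using f1(4) by (rule that)
qed

section \<open>The conformal welding\<close>

text \<open>The lower Lipschitz bound makes the inverse of \<open>p\<close> continuous at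
  \<open>p s\<close>, so both difference quotients can be taken along it and divided. This serves
  \<open>bderiv\<close>, which differentiates within the curve only.\<close>

lemma has_field_derivative_of_parametrized:
  fixes p q \<Psi> :: "complex \<Rightarrow> complex"
  assumes p: "(p has_field_derivative p') (at s within S)" and q: "(q has_field_derivative q') (at s within S)"
    and p': "p' \<noteq> 0" and s: "s \<in> S" and c: "0 < c"
    and low: "\<And>t. t \<in> S \<Longrightarrow> c * dist t s \<le> dist (p t) (p s)"
    and \<Psi>: "\<And>t. t \<in> S \<Longrightarrow> \<Psi> (p t) = q t"
  shows "(\<Psi> has_field_derivative q' / p') (at (p s) within p ` S)"
proof -
  define r where "r = inv_into S p"
  have r: "r w \<in> S" "p (r w) = w" if "w \<in> p ` S" for w
    using that by (auto simp: r_def inv_into_into f_inv_into_f)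
  have ev: "eventually (\<lambda>w. w \<in> p ` S \<and> w \<noteq> p s) (at (p s) within p ` S)"
    by (auto simp: eventually_at_filter)
  have rs: "filterlim r (at s within S) (at (p s) within p ` S)"
    unfolding filterlim_at
  proof
    show "eventually (\<lambda>w. r w \<in> S \<and> r w \<noteq> s) (at (p s) within p ` S)"
      using ev by (rule eventually_mono) (use r in auto)
    have "((\<lambda>w. dist w (p s) / c) \<longlongrightarrow> dist (p s) (p s) / c) (at (p s) within p ` S)"
      by (intro tendsto_intros) (use c in auto)
    then have lim: "((\<lambda>w. dist w (p s) / c) \<longlongrightarrow> 0) (at (p s) within p ` S)" by simp
    show "(r \<longlongrightarrow> s) (at (p s) within p ` S)"
    proof (rule metric_tendsto_imp_tendsto[OF lim], rule eventually_mono[OF ev])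
      fix w assume w: "w \<in> p ` S \<and> w \<noteq> p s"
      have "c * dist (r w) s \<le> dist w (p s)" using low[OF r(1)] r(2) w by auto
      then show "dist (r w) s \<le> dist (dist w (p s) / c) 0" using c by (simp add: field_simps)
    qed
  qed
  have P: "((\<lambda>w. (p (r w) - p s) / (r w - s)) \<longlongrightarrow> p') (at (p s) within p ` S)"
    by (rule filterlim_compose[OF p[unfolded has_field_derivative_iff] rs])
  have Q: "((\<lambda>w. (q (r w) - q s) / (r w - s)) \<longlongrightarrow> q') (at (p s) within p ` S)"
    by (rule filterlim_compose[OF q[unfolded has_field_derivative_iff] rs])
  have "((\<lambda>w. (q (r w) - q s) / (r w - s) / ((p (r w) - p s) / (r w - s))) \<longlongrightarrow> q' / p') (at (p s) within p ` S)"
    by (rule tendsto_divide[OF Q P p'])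
  then show ?thesis
    unfolding has_field_derivative_iff
  proof (rule Lim_transform_eventually)
    show "eventually (\<lambda>w. (q (r w) - q s) / (r w - s) / ((p (r w) - p s) / (r w - s))
        = (\<Psi> w - \<Psi> (p s)) / (w - p s)) (at (p s) within p ` S)"
    proof (rule eventually_mono[OF ev])
      fix w assume w: "w \<in> p ` S \<and> w \<noteq> p s"
      then have "r w \<noteq> s" "\<Psi> w = q (r w)" "\<Psi> (p s) = q s" using r \<Psi>[OF r(1)] \<Psi>[OF s] by auto
      then show "(q (r w) - q s) / (r w - s) / ((p (r w) - p s) / (r w - s))
        = (\<Psi> w - \<Psi> (p s)) / (w - p s)" using r(2) w by simp
    qed
  qed
qed

context smooth_pair
begin

text \<open>\<open>u s\<close> is the reciprocal of the value of \<open>\<gamma>\<close>-inverse at \<open>s\<close>.\<close>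

definition u :: "complex \<Rightarrow> complex" where
  "u s = inv_into (sphere 0 1) F (1 / f s)"

lemma u: "s \<in> sphere 0 1 \<Longrightarrow> u s \<in> sphere 0 1" "s \<in> sphere 0 1 \<Longrightarrow> F (u s) = 1 / f s"
proof -
  assume "s \<in> sphere 0 1"
  then have "1 / f s \<in> F ` sphere 0 1" unfolding F_sphere by (rule imageI)
  then show "u s \<in> sphere 0 1" "F (u s) = 1 / f s"
    unfolding u_def by (rule inv_into_into, rule f_inv_into_f)
qed

lemma u_surj:
  assumes "x \<in> sphere 0 1"
  obtains s where "s \<in> sphere 0 1" "u s = x"
proof -
  have "F x \<in> (\<lambda>s. 1 / f s) ` sphere 0 1" using F_sphere imageI[OF assms, of F] by simp
  then obtain s where s: "F x = 1 / f s" "s \<in> sphere 0 1" by (rule imageE)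
  have "u s = x"
    by (rule inj_onD[OF inj_F]) (use u[OF s(2)] s assms in auto)
  then show ?thesis using s that by blast
qed

lemma f_bilipschitz:
  obtains c C where "0 < c" "0 < C"
    "\<And>x y. x \<in> cball 0 1 \<Longrightarrow> y \<in> cball 0 1 \<Longrightarrow> c * dist x y \<le> dist (f x) (f y)"
    "\<And>x y. x \<in> cball 0 1 \<Longrightarrow> y \<in> cball 0 1 \<Longrightarrow> dist (f x) (f y) \<le> C * dist x y"
  by (rule bilipschitz_cball[OF f1(1,4) f(3) f1(2)]) (assumption | rule that; assumption)+

lemma F_bilipschitz:
  obtains c C where "0 < c" "0 < C"
    "\<And>x y. x \<in> cball 0 1 \<Longrightarrow> y \<in> cball 0 1 \<Longrightarrow> c * dist x y \<le> dist (F x) (F y)"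
    "\<And>x y. x \<in> cball 0 1 \<Longrightarrow> y \<in> cball 0 1 \<Longrightarrow> dist (F x) (F y) \<le> C * dist x y"
  by (rule bilipschitz_cball[OF F1(1,4) inj_F F1(2)]) (assumption | rule that; assumption)+

lemma f_sphere_bounds:
  obtains m M where "0 < m" "0 < M" "\<And>s. s \<in> sphere 0 1 \<Longrightarrow> m \<le> norm (f s)" "\<And>s. s \<in> sphere 0 1 \<Longrightarrow> norm (f s) \<le> M"
proof -
  obtain c C where cC: "0 < c" "0 < C"
    "\<And>x y. x \<in> cball 0 1 \<Longrightarrow> y \<in> cball 0 1 \<Longrightarrow> c * dist x y \<le> dist (f x) (f y)"
    "\<And>x y. x \<in> cball 0 1 \<Longrightarrow> y \<in> cball 0 1 \<Longrightarrow> dist (f x) (f y) \<le> C * dist x y"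
    by (rule f_bilipschitz) (rule that; assumption)
  show ?thesis
  proof (rule that[OF cC(1,2)])
    fix s :: complex assume "s \<in> sphere 0 1"
    then show "c \<le> norm (f s)" "norm (f s) \<le> C" using cC(3)[of s 0] cC(4)[of s 0] f(4) by simp_all
  qed
qed

text \<open>On the circle, \<open>1 / f\<close> and \<open>F\<close> are two bi-Lipschitz
  parametrisations of the inverted curve, and \<open>u\<close> is the passage between them.\<close>

lemma u_bilipschitz:
  obtains c C where "0 < c" "0 < C"
    "\<And>x y. x \<in> sphere 0 1 \<Longrightarrow> y \<in> sphere 0 1 \<Longrightarrow> c * dist x y \<le> dist (u x) (u y)"
    "\<And>x y. x \<in> sphere 0 1 \<Longrightarrow> y \<in> sphere 0 1 \<Longrightarrow> dist (u x) (u y) \<le> C * dist x y"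
proof -
  obtain c C where f_bl: "0 < c" "0 < C"
    "\<And>x y. x \<in> cball 0 1 \<Longrightarrow> y \<in> cball 0 1 \<Longrightarrow> c * dist x y \<le> dist (f x) (f y)"
    "\<And>x y. x \<in> cball 0 1 \<Longrightarrow> y \<in> cball 0 1 \<Longrightarrow> dist (f x) (f y) \<le> C * dist x y" by (rule f_bilipschitz) (rule that; assumption)
  obtain k K where F_bl: "0 < k" "0 < K"
    "\<And>x y. x \<in> cball 0 1 \<Longrightarrow> y \<in> cball 0 1 \<Longrightarrow> k * dist x y \<le> dist (F x) (F y)"
    "\<And>x y. x \<in> cball 0 1 \<Longrightarrow> y \<in> cball 0 1 \<Longrightarrow> dist (F x) (F y) \<le> K * dist x y" by (rule F_bilipschitz) (rule that; assumption)
  obtain m M where mM: "0 < m" "0 < M" "\<And>s. s \<in> sphere 0 1 \<Longrightarrow> m \<le> norm (f s)" "\<And>s. s \<in> sphere 0 1 \<Longrightarrow> norm (f s) \<le> M"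
    by (rule f_sphere_bounds) (rule that; assumption)
  have eq: "dist (F (u x)) (F (u y)) = dist (f x) (f y) / (norm (f x) * norm (f y))"
    if "x \<in> sphere 0 1" "y \<in> sphere 0 1" for x y
  proof -
    have "F (u x) - F (u y) = - (f x - f y) / (f x * f y)"
      using u(2)[OF that(1)] u(2)[OF that(2)] f_nonzero[OF that(1)] f_nonzero[OF that(2)] by (simp add: field_simps)
    then show ?thesis by (simp add: dist_norm norm_divide norm_mult norm_minus_commute)
  qed
  show ?thesis
  proof (rule that[of "c / (M * M) / K" "C / (m * m) / k"])
    show "0 < c / (M * M) / K" "0 < C / (m * m) / k" using f_bl(1,2) F_bl(1,2) mM(1,2) by auto
    fix x y :: complex assume xy: "x \<in> sphere 0 1" "y \<in> sphere 0 1"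
    have xy': "x \<in> cball 0 1" "y \<in> cball 0 1" "u x \<in> cball 0 1" "u y \<in> cball 0 1" using xy u(1)[OF xy(1)] u(1)[OF xy(2)] by auto
    have "c * dist x y / (M * M) \<le> dist (f x) (f y) / (norm (f x) * norm (f y))"
      using f_bl(1) mM f_bl(3)[OF xy'(1,2)] mM(3)[OF xy(1)] mM(3)[OF xy(2)] mM(4)[OF xy(1)] mM(4)[OF xy(2)]
      by (intro frac_le mult_mono mult_pos_pos) auto
    also have "\<dots> \<le> K * dist (u x) (u y)" using F_bl(4)[OF xy'(3,4)] eq[OF xy] by simp
    finally have "c * dist x y / (M * M) / K \<le> dist (u x) (u y)"
      using F_bl(2) by (subst pos_divide_le_eq) (auto simp: mult.commute)
    then show "c / (M * M) / K * dist x y \<le> dist (u x) (u y)" by (simp add: mult_ac)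
    have "k * dist (u x) (u y) \<le> dist (f x) (f y) / (norm (f x) * norm (f y))"
      using F_bl(3)[OF xy'(3,4)] eq[OF xy] by simp
    also have "\<dots> \<le> C * dist x y / (m * m)"
      using f_bl(2) mM f_bl(4)[OF xy'(1,2)] mM(3)[OF xy(1)] mM(3)[OF xy(2)]
      by (intro frac_le mult_mono mult_pos_pos) auto
    finally have "dist (u x) (u y) \<le> C * dist x y / (m * m) / k"
      using F_bl(1) by (subst pos_le_divide_eq) (auto simp: mult.commute)
    then show "dist (u x) (u y) \<le> C / (m * m) / k * dist x y" by (simp add: mult_ac)
  qed
qed

lemma f_derivative_sphere: "s \<in> sphere 0 1 \<Longrightarrow> (f has_field_derivative f1 s) (at s within sphere 0 1)"
  by (rule has_field_derivative_subset[OF f1(4)]) auto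

lemma u_derivative:
  assumes s: "s \<in> sphere 0 1"
  shows "(u has_field_derivative - f1 s / ((f s)^2 * F1 (u s))) (at s within sphere 0 1)"
proof -
  let ?C = "sphere (0::complex) 1"
  obtain k K where F_bl: "0 < k" "0 < K"
    "\<And>x y. x \<in> cball 0 1 \<Longrightarrow> y \<in> cball 0 1 \<Longrightarrow> k * dist x y \<le> dist (F x) (F y)"
    "\<And>x y. x \<in> cball 0 1 \<Longrightarrow> y \<in> cball 0 1 \<Longrightarrow> dist (F x) (F y) \<le> K * dist x y" by (rule F_bilipschitz) (rule that; assumption)
  have us: "u s \<in> ?C" by (rule u(1)[OF s])
  have "(inv_into ?C F has_field_derivative 1 / F1 (u s)) (at (F (u s)) within F ` ?C)"
  proof (rule has_field_derivative_of_parametrized[where q = "\<lambda>x. x" and c = k])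
    show "(F has_field_derivative F1 (u s)) (at (u s) within ?C)"
      by (rule has_field_derivative_subset[OF F1(4)]) (use us in auto)
    show "inv_into ?C F (F t) = t" if "t \<in> ?C" for t
      by (rule inv_into_f_f[OF inj_on_subset[OF inj_F] that]) auto
  qed (use us F1(2) F_bl in \<open>auto simp: less_imp_le\<close>)
  then have 1: "(inv_into ?C F has_field_derivative 1 / F1 (u s)) (at (1 / f s) within (\<lambda>s. 1 / f s) ` ?C)"
    by (simp only: u(2)[OF s] F_sphere)
  have "((\<lambda>s. 1 / f s) has_field_derivative - f1 s / (f s)^2) (at s within ?C)"
    using DERIV_divide[OF DERIV_const f_derivative_sphere[OF s] f_nonzero[OF s], of 1]
    by (simp add: power2_eq_square)
  from DERIV_image_chain[OF 1 this] show ?thesis by (simp add: o_def u_def[abs_def] mult.commute)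
qed

definition \<psi> :: "complex \<Rightarrow> complex" where "\<psi> = inv_into ext_closed \<phi>"

lemma inj_\<phi>: "inj_on \<phi> ext_closed"
proof (rule inj_onI)
  fix x y assume xy: "x \<in> ext_closed" "y \<in> ext_closed" "\<phi> x = \<phi> y"
  have nz: "x \<noteq> 0" "y \<noteq> 0" using xy(1,2) by (auto simp: ext_closed_def)
  have "F (1 / x) = F (1 / y)" using xy(3) nz by (simp add: inverted_def)
  then have "1 / x = 1 / y"
    by (rule inj_onD[OF inj_F]) (use xy nz in \<open>auto simp: ext_closed_def norm_divide divide_simps\<close>)
  then show "x = y" using nz by simp
qed

lemma \<psi>_f:
  assumes s: "s \<in> sphere 0 1"
  shows "\<psi> (f s) = 1 / u s"
proof -
  have us: "u s \<in> sphere 0 1" by (rule u(1)[OF s])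
  then have nz: "u s \<noteq> 0" by auto
  have "\<phi> (1 / u s) \<noteq> 0" by (rule \<phi>_nonzero[OF inverse_in_ext(1)]) (use us nz in auto)
  then have "f s = \<phi> (1 / u s)"
    using u(2)[OF s] nz f_nonzero[OF s] by (simp add: inverted_def field_simps)
  then show ?thesis unfolding \<psi>_def
    using inv_into_f_f[OF inj_\<phi> inverse_in_ext(1)[OF nz]] us by simp
qed

lemma bderivI:
  assumes "(k has_field_derivative d) (at w within S)" "connected S" "w \<in> S" "y \<in> S" "y \<noteq> w"
  shows "bderiv k S w = d"
  unfolding bderiv_def using assms by (blast intro: has_field_derivative_within_unique)

lemma fder_f: "s \<in> sphere 0 1 \<Longrightarrow> fder f s = f1 s"
  unfolding fder_def circle_def
  by (rule bderivI[where y = "- s", OF f_derivative_sphere]) (auto intro: connected_sphere)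

text \<open>In the parameter \<open>s\<close> the function \<open>\<psi>\<close> on the curve is
  \<open>1 / u s\<close>, so its slope along the curve is that of \<open>1 / u\<close> divided by
  \<open>f1 s\<close>.\<close>

lemma bderiv_\<psi>:
  assumes s: "s \<in> sphere 0 1"
  shows "bderiv \<psi> (f ` circle) (f s) = 1 / ((f s)^2 * F1 (u s) * (u s)^2)"
proof -
  let ?C = "sphere (0::complex) 1"
  obtain c C where f_bl: "0 < c" "0 < C"
    "\<And>x y. x \<in> cball 0 1 \<Longrightarrow> y \<in> cball 0 1 \<Longrightarrow> c * dist x y \<le> dist (f x) (f y)"
    "\<And>x y. x \<in> cball 0 1 \<Longrightarrow> y \<in> cball 0 1 \<Longrightarrow> dist (f x) (f y) \<le> C * dist x y" by (rule f_bilipschitz) (rule that; assumption)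
  have nz: "u s \<noteq> 0" "f1 s \<noteq> 0" "F1 (u s) \<noteq> 0" "f s \<noteq> 0"
    using u(1)[OF s] f1(2)[of s] F1(2)[of "u s"] f_nonzero[OF s] s by auto
  have q: "((\<lambda>s. 1 / u s) has_field_derivative f1 s / ((f s)^2 * F1 (u s) * (u s)^2)) (at s within ?C)"
    using DERIV_divide[OF DERIV_const u_derivative[OF s] nz(1), of 1] by (simp add: power2_eq_square)
  have "(\<psi> has_field_derivative f1 s / ((f s)^2 * F1 (u s) * (u s)^2) / f1 s) (at (f s) within f ` ?C)"
    by (rule has_field_derivative_of_parametrized[OF f_derivative_sphere[OF s] q nz(2) s f_bl(1)])
       (use s f_bl(3) in \<open>auto simp: \<psi>_f\<close>)
  then have "(\<psi> has_field_derivative 1 / ((f s)^2 * F1 (u s) * (u s)^2)) (at (f s) within f ` ?C)"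
    using nz(2) by simp
  then show ?thesis unfolding circle_def
  proof (rule bderivI)
    show "connected (f ` ?C)"
      by (intro connected_continuous_image continuous_on_subset[OF f(1)] connected_sphere) auto
    show "f (- s) \<in> f ` ?C" "f s \<in> f ` ?C" by (rule imageI, use s in simp)+
    show "f (- s) \<noteq> f s" using inj_onD[OF f(3), of "- s" s] s by auto
  qed
qed

lemma v0_eq:
  assumes s: "s \<in> sphere 0 1"
  shows "(1 / s) * (\<psi> (f s) / (fder f s * bderiv \<psi> (f ` circle) (f s))) = u s * F1 (u s) * (f s)^2 / (s * f1 s)"
proof -
  have "u s \<noteq> 0" using u(1)[OF s] by auto
  then show ?thesis unfolding \<psi>_f[OF s] fder_f[OF s] bderiv_\<psi>[OF s]
    by (simp add: power2_eq_square)
qed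

end

section \<open>Exterior functions give elements of the kernel\<close>

lemma dist_inverse_circle:
  fixes a b :: complex
  assumes "norm a = 1" "norm b = 1"
  shows "dist (1 / a) (1 / b) = dist a b"
proof -
  have "a \<noteq> 0" "b \<noteq> 0" using assms by auto
  then have "1 / a - 1 / b = (b - a) / (a * b)" by (simp add: field_simps)
  then show ?thesis using assms by (simp add: dist_norm norm_divide norm_mult norm_minus_commute)
qed

context smooth_pair
begin

text \<open>Substituting \<open>w = f s\<close> turns \<open>I_op f v z\<close> into minus the Cauchy integral over the boundary curve, at the
  point \<open>f z\<close>, of the function with value \<open>density v s\<close> at \<open>f s\<close>.\<close>

definition density :: "(complex \<Rightarrow> complex) \<Rightarrow> complex \<Rightarrow> complex" where
  "density v s = s * f1 s * v s / (f s)^2"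

lemma I_op_eq:
  "I_op f v z = - (1 / (2 * pi * \<i>)) *
    contour_integral (circlepath 0 1) (\<lambda>s. density v s * f1 s / (f s - f z))"
proof -
  have "contour_integral (circlepath 0 1) (\<lambda>s. (s * fder f s / f s)^2 * (v s / (f s - f z)) / s)
      = contour_integral (circlepath 0 1) (\<lambda>s. density v s * f1 s / (f s - f z))"
  proof (rule contour_integral_cong[OF refl])
    fix s assume "s \<in> path_image (circlepath 0 1)"
    then have s: "s \<in> sphere 0 1" by simp
    then have "s \<noteq> 0" by auto
    then have "(s * a / b)^2 * (w / d) / s = s * a * w / b^2 * a / d" for a b w d :: complex
      by (cases "b = 0"; cases "d = 0") (simp_all add: field_simps power2_eq_square)
    then show "(s * fder f s / f s)^2 * (v s / (f s - f z)) / s = density v s * f1 s / (f s - f z)"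
      unfolding fder_f[OF s] density_def .
  qed
  then show ?thesis by (simp add: I_op_def)
qed

lemma lip_u: "lip_circle \<alpha> u"
proof -
  obtain c C where C: "0 < c" "0 < C"
    "\<And>x y. x \<in> sphere 0 1 \<Longrightarrow> y \<in> sphere 0 1 \<Longrightarrow> c * dist x y \<le> dist (u x) (u y)"
    "\<And>x y. x \<in> sphere 0 1 \<Longrightarrow> y \<in> sphere 0 1 \<Longrightarrow> dist (u x) (u y) \<le> C * dist x y"
    by (rule u_bilipschitz) (rule that; assumption)
  show ?thesis by (rule lip_circle_Lipschitz[OF C(4)]) (use C(2) \<alpha> in auto)
qed

lemma lip_compose_u:
  assumes "lip_circle \<alpha> k"
  shows "lip_circle \<alpha> (\<lambda>s. k (u s))"
proof -
  obtain c C where C: "0 < c" "0 < C"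
    "\<And>x y. x \<in> sphere 0 1 \<Longrightarrow> y \<in> sphere 0 1 \<Longrightarrow> c * dist x y \<le> dist (u x) (u y)"
    "\<And>x y. x \<in> sphere 0 1 \<Longrightarrow> y \<in> sphere 0 1 \<Longrightarrow> dist (u x) (u y) \<le> C * dist x y"
    by (rule u_bilipschitz) (rule that; assumption)
  show ?thesis by (rule lip_circle_compose[OF assms u(1) C(4)]) (use C(2) \<alpha> in auto)
qed

lemma lip_compose_inverse:
  assumes "lip_circle \<alpha> k"
  shows "lip_circle \<alpha> (\<lambda>s. k (1 / s))"
  by (rule lip_circle_compose[OF assms, of _ 1])
     (use \<alpha> in \<open>auto simp: norm_divide dist_inverse_circle\<close>)

lemma lip_f: "lip_circle \<alpha> f"
proof -
  obtain c C where C: "0 < c" "0 < C"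
    "\<And>x y. x \<in> cball 0 1 \<Longrightarrow> y \<in> cball 0 1 \<Longrightarrow> c * dist x y \<le> dist (f x) (f y)"
    "\<And>x y. x \<in> cball 0 1 \<Longrightarrow> y \<in> cball 0 1 \<Longrightarrow> dist (f x) (f y) \<le> C * dist x y"
    by (rule f_bilipschitz) (rule that; assumption)
  show ?thesis by (rule lip_circle_Lipschitz[of _ C]) (use C \<alpha> in auto)
qed

lemma F1_derivative: "norm z < 1 \<Longrightarrow> (F has_field_derivative F1 z) (at z)"
  using F1(4)[of z] at_within_interior[of z "cball 0 1"] by (simp add: less_imp_le)

lemma f1_derivative: "norm z < 1 \<Longrightarrow> (f has_field_derivative f1 z) (at z)"
  using f1(4)[of z] at_within_interior[of z "cball 0 1"] by (simp add: less_imp_le)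

lemma holomorphic_F1: "F1 holomorphic_on ball 0 1"
  by (rule holomorphic_on_subset[OF derivative_is_holomorphic[of "ball 0 1" F]]) (use F1_derivative in auto)

lemma holomorphic_f1: "f1 holomorphic_on ball 0 1"
  by (rule holomorphic_on_subset[OF derivative_is_holomorphic[of "ball 0 1" f]]) (use f1_derivative in auto)

lemma F_quotient:
  obtains Q where "continuous_on (cball 0 1) Q" "Q holomorphic_on ball 0 1"
    "\<And>x. x \<in> cball 0 1 \<Longrightarrow> Q x \<noteq> 0" "\<And>x. F x = x * Q x"
proof -
  have F0: "F 0 = 0" by (simp add: inverted_def)
  obtain Q where Q: "continuous_on (cball 0 1) Q" "Q holomorphic_on ball 0 1" "Q 0 = deriv F 0"
    "\<And>z. F z = z * Q z"
    using quotient_by_identity[OF continuous_F holomorphic_F F0] by metis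
  show ?thesis
  proof (rule that[OF Q(1,2) _ Q(4)])
    fix x :: complex assume x: "x \<in> cball 0 1"
    show "Q x \<noteq> 0"
    proof (cases "x = 0")
      case True
      then show ?thesis using Q(3) DERIV_imp_deriv[OF F1_derivative[of 0]] F1(2)[of 0] by simp
    next
      case False
      then show ?thesis using F_nonzero[OF x False] Q(4)[of x] by auto
    qed
  qed
qed

text \<open>For \<open>x \<noteq> 0\<close> the point is that the exterior value
  \<open>1 / F x\<close> is never a value of \<open>f\<close> in the disc; the product form includes
  infinity, \<open>x = 0\<close>.\<close>

lemma f_times_F_ne_1:
  assumes x: "x \<in> cball 0 1" and z: "z \<in> ball 0 1"
  shows "f z * F x \<noteq> 1"
proof
  assume eq: "f z * F x = 1"
  have x0: "x \<noteq> 0" using eq by (auto simp: inverted_def)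
  then have "f z = \<phi> (1 / x)"
    using eq \<phi>_nonzero[OF inverse_in_ext(1), of x] x by (simp add: inverted_def)
  moreover have "\<phi> (1 / x) \<notin> f ` ball 0 1" by (rule \<phi>_notin_disc_image[OF inverse_in_ext(1)]) (use x x0 in auto)
  ultimately show False using z by (metis imageI)
qed

text \<open>Under \<open>w = 1 / F x\<close> the Cauchy kernel times the density becomes
  \<open>- p x dx\<close> at \<open>x = u s\<close>. As \<open>p\<close> is continuous on the closed
  disc and holomorphic inside, it has a primitive up to the circle, which pulls back along
  \<open>u\<close>; so the orientation of \<open>u\<close> never enters.\<close>

lemma kernel_of_exterior_function:
  assumes h: "HolC_ext h" "lip_circle \<alpha> h"
    and v: "\<And>s. s \<in> sphere 0 1 \<Longrightarrow> v s = u s * F1 (u s) * (f s)^2 / (s * f1 s) * h (1 / u s)"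
  shows "lip_circle \<alpha> v" "z \<in> disc \<Longrightarrow> I_op f v z = 0"
proof -
  let ?C = "sphere (0::complex) 1"
  have u0: "u s \<noteq> 0" if "s \<in> ?C" for s using u(1)[OF that] by auto
  have "lip_circle \<alpha> (\<lambda>s. u s * F1 (u s) * (f s * f s) / (s * f1 s) * h (1 / u s))"
    by (intro lip_circle_mult lip_circle_divide lip_u lip_compose_u[OF F1(3)] lip_f lip_circle_ident f1(3)
        lip_compose_u[OF lip_compose_inverse[OF h(2)]])
       (use \<alpha> f1(2) in auto)
  then show "lip_circle \<alpha> v"
    using lip_circle_cong[of v "\<lambda>s. u s * F1 (u s) * (f s * f s) / (s * f1 s) * h (1 / u s)"] v
    by (simp add: power2_eq_square)
  assume "z \<in> disc"
  then have z: "z \<in> ball 0 1" by (simp add: disc_def)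
  obtain Q where Q: "continuous_on (cball 0 1) Q" "Q holomorphic_on ball 0 1"
    "\<And>x. x \<in> cball 0 1 \<Longrightarrow> Q x \<noteq> 0" "\<And>x. F x = x * Q x" by (rule F_quotient) (rule that; assumption)
  obtain L where L: "(h \<longlongrightarrow> L) at_infinity" using h(1) by (auto simp: HolC_ext_def)
  have hh: "h holomorphic_on ext_open" "continuous_on ext_closed h" using h(1) by (auto simp: HolC_ext_def)
  \<comment> \<open>The limit \<open>L\<close> required by \<open>HolC_ext\<close> fills in the
    point at infinity and makes the singularity at 0 removable.\<close>
  define k where "k = (\<lambda>x::complex. if x = 0 then L else h (1 / x))"
  have hk: "k holomorphic_on ball 0 1"
  proof (rule no_isolated_singularity'[where K = "{0}"])
    have "(\<lambda>x. h (1 / x)) holomorphic_on ball 0 1 - {0}"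
      by (rule holomorphic_on_compose_gen[OF _ hh(1), unfolded o_def, of "\<lambda>x. 1 / x"])
         (auto intro!: holomorphic_intros inverse_in_ext)
    then show "k holomorphic_on ball 0 1 - {0}"
      by (rule holomorphic_transform) (auto simp: k_def)
    fix w :: complex assume "w \<in> {0}"
    have "filterlim (\<lambda>x::complex. 1 / x) at_infinity (at 0)"
      using filterlim_inverse_at_infinity[where ?'a = complex] by (simp only: inverse_eq_divide[abs_def])
    then have "((\<lambda>x. h (1 / x)) \<longlongrightarrow> L) (at 0)" by (rule filterlim_compose[OF L])
    then have "(k \<longlongrightarrow> L) (at 0)"
      by (rule Lim_transform_eventually) (auto simp: eventually_at_filter k_def)
    then have "(k \<longlongrightarrow> L) (at 0 within ball 0 1)" by (rule tendsto_within_subset) simp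
    then show "(k \<longlongrightarrow> k w) (at w within ball 0 1)" using \<open>w \<in> {0}\<close> by (simp add: k_def)
  qed auto
  have ck: "continuous_on (cball 0 1) k"
  proof (rule continuous_on_cball_puncture[OF holomorphic_on_imp_continuous_on[OF hk]])
    have "continuous_on (cball 0 1 - {0}) (\<lambda>x. h (1 / x))"
      by (rule continuous_on_compose2[OF hh(2)]) (auto intro!: continuous_intros inverse_in_ext)
    then show "continuous_on (cball 0 1 - {0}) k"
      by (rule continuous_on_eq) (auto simp: k_def)
  qed
  \<comment> \<open>The transformed kernel has denominator \<open>F x * (1 - f z * F x)\<close>. The
    zero of \<open>F\<close> at 0 cancels against the factor \<open>x\<close> of the density, and
    \<open>Q\<close> is what remains of \<open>F\<close>.\<close>
  define p where "p = (\<lambda>x. (F1 x)^2 * k x / (Q x * (1 - f z * F x)))"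
  have den: "Q x * (1 - f z * F x) \<noteq> 0" if "x \<in> cball 0 1" for x
    using Q(3)[OF that] f_times_F_ne_1[OF that z] by simp
  have cp: "continuous_on (cball 0 1) p"
    unfolding p_def using den by (intro continuous_intros F1(1) ck Q(1) continuous_F) auto
  have hp: "p holomorphic_on ball 0 1"
    unfolding p_def using den by (intro holomorphic_intros holomorphic_F1 hk Q(2) holomorphic_F) auto
  obtain P where P: "\<And>x. x \<in> cball 0 1 \<Longrightarrow> (P has_field_derivative p x) (at x within cball 0 1)"
    using holomorphic_convex_primitive[of "cball 0 1" "{}" p] cp hp
    by (auto simp: holomorphic_on_imp_differentiable_at)
  have "((\<lambda>s. density v s * f1 s / (f s - f z)) has_contour_integral 0) (circlepath 0 1)"
  proof (rule Cauchy_theorem_primitive[where S = ?C and f = "\<lambda>s. - P (u s)"])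
    fix s assume s: "s \<in> ?C"
    have us: "u s \<in> ?C" by (rule u(1)[OF s])
    have "(P has_field_derivative p (u s)) (at (u s) within u ` ?C)"
      by (rule has_field_derivative_subset[OF P]) (use us u(1) in auto)
    from DERIV_minus[OF DERIV_image_chain[OF this u_derivative[OF s]]]
    have d: "((\<lambda>s. - P (u s)) has_field_derivative - (p (u s) * (- f1 s / ((f s)^2 * F1 (u s))))) (at s within ?C)"
      by (simp add: o_def)
    have nz: "s \<noteq> 0" "f s \<noteq> 0" "f1 s \<noteq> 0" "F1 (u s) \<noteq> 0" "Q (u s) \<noteq> 0" "u s \<noteq> 0"
      using s us f_nonzero[OF s] f1(2)[of s] F1(2)[of "u s"] Q(3)[of "u s"] u0 by auto
    have Qf: "Q (u s) = 1 / (f s * u s)" using Q(4)[of "u s"] u(2)[OF s] nz by (simp add: field_simps)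
    have fz: "f s - f z \<noteq> 0" using inj_onD[OF f(3), of s z] s z by auto
    have ku: "k (u s) = h (1 / u s)" using nz by (simp add: k_def)
    have d1: "1 - f z * F (u s) = (f s - f z) / f s" using u(2)[OF s] nz by (simp add: field_simps)
    have "p (u s) = (F1 (u s))^2 * h (1 / u s) * (f s)^2 * u s / (f s - f z)"
      unfolding p_def ku d1 Qf using nz fz by (simp add: field_simps power2_eq_square)
    then have "- (p (u s) * (- f1 s / ((f s)^2 * F1 (u s)))) = F1 (u s) * h (1 / u s) * u s * f1 s / (f s - f z)"
      using nz fz by (simp add: field_simps power2_eq_square)
    moreover have "density v s = u s * F1 (u s) * h (1 / u s)"
      unfolding density_def v[OF s] using nz by (simp add: field_simps)
    ultimately show "((\<lambda>s. - P (u s)) has_field_derivative density v s * f1 s / (f s - f z)) (at s within ?C)"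
      using d by (simp add: mult_ac)
  qed auto
  then show "I_op f v z = 0" unfolding I_op_eq by (simp add: contour_integral_unique)
qed

end

section \<open>Elements of the kernel give exterior functions\<close>

text \<open>A rate that is uniform in \<open>s\<close> upgrades radial convergence to full
  continuity: a nearby point \<open>y\<close> is compared with its projection \<open>sgn y\<close>,
  and \<open>sgn y\<close> with \<open>x\<close> through the continuity of
  \<open>\<beta>\<close>.\<close>

lemma continuous_on_radial_extension:
  fixes B \<beta> :: "complex \<Rightarrow> complex"
  assumes B: "continuous_on (ball 0 1) B" and \<beta>: "continuous_on (sphere 0 1) \<beta>" and a: "0 < a"
    and bd: "\<And>s r. s \<in> sphere 0 1 \<Longrightarrow> 1/2 \<le> r \<Longrightarrow> r < 1 \<Longrightarrow> norm (B (of_real r * s) - \<beta> s) \<le> C * (1 - r) powr a"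
  shows "continuous_on (cball 0 1) (\<lambda>x. if norm x < 1 then B x else \<beta> x)"
  unfolding continuous_on_def
proof
  fix x :: complex assume x: "x \<in> cball 0 1"
  define E where "E = (\<lambda>x. if norm x < 1 then B x else \<beta> x)"
  have "(E \<longlongrightarrow> E x) (at x within cball 0 1)"
  proof (cases "norm x < 1")
    case True
    then have xb: "x \<in> ball 0 1" by simp
    have "(B \<longlongrightarrow> B x) (at x)" using B xb by (simp add: continuous_on_eq_continuous_at isCont_def)
    moreover have "eventually (\<lambda>y. B y = E y) (at x)"
      by (rule eventually_mono[OF eventually_at_in_open'[OF open_ball xb]]) (simp add: E_def)
    ultimately have "(E \<longlongrightarrow> B x) (at x)" by (rule Lim_transform_eventually)
    then show ?thesis using True at_within_interior[of x "cball 0 1"] by (simp add: E_def)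
  next
    case False
    then have x1: "norm x = 1" using x by simp
    define g where "g = (\<lambda>y. \<bar>C\<bar> * \<bar>1 - norm y\<bar> powr a + norm (\<beta> (sgn y) - \<beta> x))"
    have x0: "x \<noteq> 0" using x1 by auto
    have sx: "sgn x = x" using x1 by (simp add: sgn_div_norm)
    have "((\<lambda>y. \<beta> (sgn y)) \<longlongrightarrow> \<beta> (sgn x)) (at x within cball 0 1)"
    proof (rule continuous_on_tendsto_compose[OF \<beta>])
      show "(sgn \<longlongrightarrow> sgn x) (at x within cball 0 1)"
        by (rule tendsto_sgn[OF tendsto_ident_at x0])
      show "sgn x \<in> sphere 0 1" using x0 by (simp add: norm_sgn)
      have "eventually (\<lambda>y. y \<in> - {0}) (at x)" by (rule eventually_at_in_open') (use x0 in auto)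
      then have "eventually (\<lambda>y. y \<noteq> 0) (at x within cball 0 1)"
        by (auto simp: eventually_at_filter elim: eventually_mono)
      then show "eventually (\<lambda>y. sgn y \<in> sphere 0 1) (at x within cball 0 1)"
        by (rule eventually_mono) (simp add: norm_sgn)
    qed
    then have "(g \<longlongrightarrow> \<bar>C\<bar> * \<bar>1 - norm x\<bar> powr a + norm (\<beta> (sgn x) - \<beta> x)) (at x within cball 0 1)"
      unfolding g_def
      by (intro tendsto_add tendsto_mult tendsto_const tendsto_powr' tendsto_norm tendsto_diff tendsto_rabs tendsto_ident_at)
         (use a in auto)
    then have lim: "(g \<longlongrightarrow> 0) (at x within cball 0 1)" using x1 sx by simp
    have "eventually (\<lambda>y. y \<in> - cball 0 (1/2)) (at x)"
      by (rule eventually_at_in_open') (use x1 in \<open>auto intro: open_Compl\<close>)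
    then have ev: "eventually (\<lambda>y. 1/2 < norm y \<and> norm y \<le> 1) (at x within cball 0 1)"
      unfolding eventually_at_filter by (rule eventually_mono) auto
    show ?thesis
    proof (rule metric_tendsto_imp_tendsto[OF lim], rule eventually_mono[OF ev])
      fix y :: complex assume y: "1/2 < norm y \<and> norm y \<le> 1"
      then have y0: "y \<noteq> 0" by auto
      have ys: "sgn y \<in> sphere 0 1" using y0 by (simp add: norm_sgn)
      have yd: "of_real (norm y) * sgn y = y" using y0 by (simp add: sgn_div_norm scaleR_conv_of_real)
      have 1: "norm (E y - \<beta> (sgn y)) \<le> \<bar>C\<bar> * \<bar>1 - norm y\<bar> powr a"
      proof (cases "norm y < 1")
        case True
        have "norm (B (of_real (norm y) * sgn y) - \<beta> (sgn y)) \<le> C * (1 - norm y) powr a"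
          by (rule bd[OF ys]) (use y True in auto)
        also have "\<dots> \<le> \<bar>C\<bar> * (1 - norm y) powr a" by (intro mult_right_mono) auto
        finally show ?thesis using True yd by (simp add: E_def)
      next
        case False
        then have "norm y = 1" using y by simp
        then show ?thesis by (simp add: E_def sgn_div_norm)
      qed
      have "E x = \<beta> x" using x1 by (simp add: E_def)
      then have "dist (E y) (E x) \<le> norm (E y - \<beta> (sgn y)) + norm (\<beta> (sgn y) - \<beta> x)"
        using norm_triangle_ineq[of "E y - \<beta> (sgn y)" "\<beta> (sgn y) - \<beta> x"] by (simp add: dist_norm)
      also have "\<dots> \<le> g y" using 1 by (simp add: g_def)
      also have "\<dots> \<le> dist (g y) 0" by simp
      finally show "dist (E y) (E x) \<le> dist (g y) 0" .
    qed
  qed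
  then show "((\<lambda>x. if norm x < 1 then B x else \<beta> x) \<longlongrightarrow> (if norm x < 1 then B x else \<beta> x)) (at x within cball 0 1)"
    by (simp add: E_def)
qed

context smooth_pair
begin

text \<open>Division by the divided difference turns the integrand into \<open>T w / (w - z)\<close>
  with \<open>T z = 1\<close>, so Cauchy's formula yields the index of the curve about
  \<open>f z\<close>.\<close>

lemma Cauchy_integral_one:
  assumes z: "norm z < 1"
  shows "((\<lambda>s. f1 s / (f s - f z)) has_contour_integral 2 * pi * \<i>) (circlepath 0 1)"
proof -
  have zc: "z \<in> cball 0 1" using z by simp
  obtain D where D: "continuous_on (cball 0 1 \<times> cball 0 1) D" "\<And>x. x \<in> cball 0 1 \<Longrightarrow> D (x, x) = f1 x"
    "\<And>x y. x \<in> cball 0 1 \<Longrightarrow> y \<in> cball 0 1 \<Longrightarrow> f y - f x = D (x, y) * (y - x)"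
    using divided_difference_cball[OF f1(1,4)] by blast
  have Dnz: "D (z, w) \<noteq> 0" if w: "w \<in> cball 0 1" for w
  proof (cases "w = z")
    case True then show ?thesis using D(2)[OF zc] f1(2)[OF zc] by simp
  next
    case False
    then have "f w - f z \<noteq> 0" using inj_onD[OF f(3), of w z] w zc by auto
    then show ?thesis using D(3)[OF zc w] by auto
  qed
  define T where "T = (\<lambda>w. f1 w / D (z, w))"
  have cT: "continuous_on (cball 0 1) T"
    unfolding T_def using Dnz zc
    by (intro continuous_intros f1(1) continuous_on_compose2[OF D(1)]) auto
  have hT: "T holomorphic_on ball 0 1"
  proof (rule no_isolated_singularity[where K = "{z}"])
    show "continuous_on (ball 0 1) T" by (rule continuous_on_subset[OF cT]) auto
    have "(\<lambda>w. f1 w * (w - z) / (f w - f z)) holomorphic_on ball 0 1 - {z}"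
    proof (intro holomorphic_intros)
      show "f1 holomorphic_on ball 0 1 - {z}" "f holomorphic_on ball 0 1 - {z}"
        by (rule holomorphic_on_subset[OF holomorphic_f1] holomorphic_on_subset[OF f(2)], blast)+
      show "f w - f z \<noteq> 0" if "w \<in> ball 0 1 - {z}" for w
        using inj_onD[OF f(3), of w z] that zc by auto
    qed
    then show "T holomorphic_on ball 0 1 - {z}"
    proof (rule holomorphic_transform)
      fix w assume w: "w \<in> ball 0 1 - {z}"
      then have "f w - f z = D (z, w) * (w - z)" by (intro D(3) zc) auto
      moreover have "w - z \<noteq> 0" using w by auto
      ultimately show "f1 w * (w - z) / (f w - f z) = T w" by (simp add: T_def)
    qed
  qed auto
  have "((\<lambda>w. T w / (w - z)) has_contour_integral 2 * pi * \<i> * T z) (circlepath 0 1)"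
    using Cauchy_integral_circlepath[OF cT hT, of z] z by simp
  moreover have "T z = 1" using D(2)[OF zc] f1(2)[OF zc] by (simp add: T_def)
  moreover have "T w / (w - z) = f1 w / (f w - f z)" if "w \<in> path_image (circlepath 0 1)" for w
  proof -
    have w: "w \<in> cball 0 1" using that by simp
    show ?thesis using D(3)[OF zc w] by (simp add: T_def)
  qed
  ultimately show ?thesis by (metis (no_types, lifting) has_contour_integral_eq mult.right_neutral)
qed

lemma f_times_F_ne_1':
  assumes x: "x \<in> ball 0 1" and z: "z \<in> cball 0 1"
  shows "f z * F x \<noteq> 1"
proof (cases "norm z = 1")
  case True
  then have zs: "z \<in> sphere 0 1" by simp
  show ?thesis
  proof
    assume "f z * F x = 1"
    then have "F x = 1 / f z" using f_nonzero[OF zs] by (simp add: field_simps)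
    then show False using F_ball_disjoint x zs by blast
  qed
next
  case False
  then show ?thesis using f_times_F_ne_1[of x z] x z by simp
qed

text \<open>For \<open>x \<noteq> 0\<close> this is the index of the curve about the exterior point
  \<open>1 / F x\<close>. The denominator has no zero on the closed disc, so Cauchy's theorem
  applies in the coordinate \<open>s\<close>.\<close>

lemma Cauchy_integral_zero:
  assumes x: "norm x < 1"
  shows "((\<lambda>s. f1 s * F x / (f s * F x - 1)) has_contour_integral 0) (circlepath 0 1)"
proof (rule Cauchy_theorem_convex[where S = "cball 0 1" and K = "{}"])
  have nz: "f z * F x - 1 \<noteq> 0" if "z \<in> cball 0 1" for z
    using f_times_F_ne_1'[of x z] x that by simp
  show "continuous_on (cball 0 1) (\<lambda>s. f1 s * F x / (f s * F x - 1))"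
    using nz by (intro continuous_intros f1(1) f(1)) auto
  have "(\<lambda>s. f1 s * F x / (f s * F x - 1)) holomorphic_on ball 0 1"
    using nz by (intro holomorphic_intros holomorphic_f1 f(2)) auto
  then show "(\<lambda>s. f1 s * F x / (f s * F x - 1)) field_differentiable at z" if "z \<in> interior (cball 0 1) - {}" for z
    using that by (auto simp: holomorphic_on_imp_differentiable_at)
qed auto

text \<open>Minus the Cauchy integral over the boundary curve at the exterior point \<open>1 / F x\<close>, written so that it
  makes sense at \<open>x = 0\<close>, the point at infinity.\<close>

definition exterior_integral :: "(complex \<Rightarrow> complex) \<Rightarrow> complex \<Rightarrow> complex" where
  "exterior_integral A x = - (1 / (2 * pi * \<i>)) *
    contour_integral (circlepath 0 1) (\<lambda>s. A s * f1 s * F x / (f s * F x - 1))"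

lemma continuous_f_sphere: "continuous_on (sphere 0 1) f" "continuous_on (sphere 0 1) f1"
  by (rule continuous_on_subset[OF f(1)], force) (rule continuous_on_subset[OF f1(1)], force)

lemma holomorphic_exterior_integral:
  assumes A: "continuous_on (sphere 0 1) A"
  shows "exterior_integral A holomorphic_on ball 0 1"
proof -
  let ?e = "circlepath 0 1"
  note vd = vector_derivative_unit_circlepath
  have es: "?e t \<in> sphere 0 1" for t by (simp add: circlepath)
  have ce: "continuous_on S ?e" for S :: "real set"
    unfolding circlepath by (intro continuous_intros)
  have nz: "f (?e t) * F x - 1 \<noteq> 0" if "x \<in> ball 0 1" for x t
    using f_times_F_ne_1'[of x "?e t"] es[of t] that by simp
  define N where "N = (\<lambda>t. A (?e t) * f1 (?e t) * (2 * pi * \<i> * ?e t))"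
  have cN: "continuous_on S N" for S :: "real set"
    unfolding N_def
    by (intro continuous_intros ce continuous_on_compose2[OF A ce] continuous_on_compose2[OF continuous_f_sphere(2) ce])
       (use es in auto)
  have cfe: "continuous_on S (\<lambda>t. f (?e t))" for S :: "real set"
    by (rule continuous_on_compose2[OF continuous_f_sphere(1) ce]) (use es in auto)
  have "(\<lambda>x. integral (cbox 0 1) (\<lambda>t. N t * F x / (f (?e t) * F x - 1))) holomorphic_on ball 0 1"
  proof (rule leibniz_rule_holomorphic[where fx = "\<lambda>x t. - (N t * F1 x) / (f (?e t) * F x - 1)^2"])
    fix x t assume x: "x \<in> ball (0::complex) 1"
    have dF: "(F has_field_derivative F1 x) (at x within ball 0 1)"
      by (rule has_field_derivative_at_within[OF F1_derivative]) (use x in simp)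
    have "((\<lambda>x. N t * F x / (f (?e t) * F x - 1)) has_field_derivative
        ((N t * F1 x) * (f (?e t) * F x - 1) - (N t * F x) * (f (?e t) * F1 x))
         / ((f (?e t) * F x - 1) * (f (?e t) * F x - 1))) (at x within ball 0 1)"
      by (rule DERIV_divide) (use nz[OF x] in \<open>auto intro!: derivative_eq_intros dF\<close>)
    moreover have "(N t * F1 x) * (f (?e t) * F x - 1) - (N t * F x) * (f (?e t) * F1 x) = - (N t * F1 x)"
      by (simp add: algebra_simps)
    ultimately show "((\<lambda>x. N t * F x / (f (?e t) * F x - 1)) has_field_derivative
        - (N t * F1 x) / (f (?e t) * F x - 1)^2) (at x within ball 0 1)"
      by (simp add: power2_eq_square)
  next
    fix x :: complex assume x: "x \<in> ball 0 1"
    show "(\<lambda>t. N t * F x / (f (?e t) * F x - 1)) integrable_on cbox 0 1"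
      using nz[OF x] by (intro integrable_continuous continuous_intros cN cfe) auto
  next
    show "continuous_on (ball 0 1 \<times> cbox 0 1) (\<lambda>(x, t). - (N t * F1 x) / (f (?e t) * F x - 1)^2)"
      unfolding case_prod_unfold
      using nz
      by (intro continuous_intros continuous_on_compose2[OF cN[of UNIV]] continuous_on_compose2[OF cfe[of UNIV]]
          continuous_on_compose2[OF F1(1)] continuous_on_compose2[OF continuous_F]) auto
  qed simp
  moreover have "exterior_integral A = (\<lambda>x. - (1 / (2 * pi * \<i>)) *
      integral (cbox 0 1) (\<lambda>t. N t * F x / (f (?e t) * F x - 1)))"
    unfolding exterior_integral_def contour_integral_integral vd N_def by (simp add: mult_ac)
  ultimately show ?thesis by (simp only:) (intro holomorphic_intros)
qed

text \<open>The exterior point \<open>w = 1 / F (r * u s0)\<close> and the interior point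
  \<open>f (r * s0)\<close> are \<open>O(1 - r)\<close> apart, and both stay at distance at least a
  constant times \<open>dist s s0 + (1 - r)\<close> from \<open>f s\<close>. With
  \<open>A s0\<close> subtracted, the difference of the two Cauchy integrands is thus of order
  \<open>(1 - r) * (dist s s0 + (1 - r)) powr (\<alpha> - 2)\<close>. The interior integral is 0 by
  hypothesis, and the subtracted constant produces the jump \<open>A s0\<close>.\<close>

lemma exterior_integral_boundary:
  assumes A: "lip_circle \<alpha> A"
    and zero: "\<And>z. z \<in> ball 0 1 \<Longrightarrow> contour_integral (circlepath 0 1) (\<lambda>s. A s * f1 s / (f s - f z)) = 0"
  obtains C where "\<And>s r. s \<in> sphere 0 1 \<Longrightarrow> 1/2 \<le> r \<Longrightarrow> r < 1 \<Longrightarrow>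
    norm (exterior_integral A (of_real r * u s) - A s) \<le> C * (1 - r) powr \<alpha>"
proof -
  let ?C = "sphere (0::complex) 1"
  obtain a where a: "0 \<le> a" "\<And>x y. x \<in> ?C \<Longrightarrow> y \<in> ?C \<Longrightarrow> norm (A x - A y) \<le> a * dist x y powr \<alpha>"
    using lip_circleE[OF A] by blast
  have cA: "continuous_on ?C A" by (rule continuous_on_lip_circle[OF A \<alpha>(1)])
  obtain g where g: "0 \<le> g" "\<And>x. x \<in> ?C \<Longrightarrow> norm (f1 x) \<le> g" using bounded_lip_circle[OF f1(3) \<alpha>(1)] by blast
  obtain c C where f_bl: "0 < c" "0 < C"
    "\<And>x y. x \<in> cball 0 1 \<Longrightarrow> y \<in> cball 0 1 \<Longrightarrow> c * dist x y \<le> dist (f x) (f y)"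
    "\<And>x y. x \<in> cball 0 1 \<Longrightarrow> y \<in> cball 0 1 \<Longrightarrow> dist (f x) (f y) \<le> C * dist x y"
    by (rule f_bilipschitz) (rule that; assumption)
  obtain k K where F_bl: "0 < k" "0 < K"
    "\<And>x y. x \<in> cball 0 1 \<Longrightarrow> y \<in> cball 0 1 \<Longrightarrow> k * dist x y \<le> dist (F x) (F y)"
    "\<And>x y. x \<in> cball 0 1 \<Longrightarrow> y \<in> cball 0 1 \<Longrightarrow> dist (F x) (F y) \<le> K * dist x y"
    by (rule F_bilipschitz) (rule that; assumption)
  obtain l L where u_bl: "0 < l" "0 < L"
    "\<And>x y. x \<in> ?C \<Longrightarrow> y \<in> ?C \<Longrightarrow> l * dist x y \<le> dist (u x) (u y)"
    "\<And>x y. x \<in> ?C \<Longrightarrow> y \<in> ?C \<Longrightarrow> dist (u x) (u y) \<le> L * dist x y"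
    by (rule u_bilipschitz) (rule that; assumption)
  have F0: "F 0 = 0" by (simp add: inverted_def)
  have FK: "norm (F x) \<le> K" if "x \<in> cball 0 1" for x
  proof -
    have "norm (F x) \<le> K * norm x" using F_bl(4)[of x 0] that F0 by simp
    also have "\<dots> \<le> K * 1" using that F_bl(2) by (intro mult_left_mono) auto
    finally show ?thesis by simp
  qed
  have Fk: "k / 2 \<le> norm (F x)" if "x \<in> cball 0 1" "1/2 \<le> norm x" for x
  proof -
    have "k * (1/2) \<le> k * norm x" using that F_bl(1) by (intro mult_left_mono) auto
    also have "\<dots> \<le> norm (F x)" using F_bl(3)[of x 0] that F0 by simp
    finally show ?thesis by simp
  qed
  \<comment> \<open>Capped at 1 because \<open>u\<close> scales only the first summand of
    \<open>dist s s0 + \<delta>\<close>.\<close>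
  define m where "m = min l 1"
  have m: "0 < m" "m \<le> l" "m \<le> 1" using u_bl(1) by (auto simp: m_def)
  \<comment> \<open>\<open>c1\<close> and \<open>c2\<close> bound the distances of the interior and
    the exterior point from \<open>f s\<close> below; the 3 comes from
    \<open>dist_radial_le\<close>, and \<open>K * K\<close> from the denominators in a difference of
    \<open>1 / F\<close>. \<open>C3\<close> bounds the distance between the two points;
    \<open>k/2\<close> is a lower bound of \<open>F\<close> at radius at least 1/2.\<close>
  define c1 where "c1 = c / 3"
  define c2 where "c2 = k * m / 3 / (K * K)"
  define C3 where "C3 = C + K / (k/2 * (k/2))"
  have pos: "0 < c1" "0 < c2" "0 < C3"
    using f_bl(1,2) F_bl(1,2) m(1) by (auto simp: c1_def c2_def C3_def intro!: add_pos_pos)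
  define M where "M = a * g * C3 / (c1 * c2)"
  have M0: "0 \<le> M" using a(1) g(1) pos by (simp add: M_def)
  show ?thesis
  proof (rule that[of "24 * pi * M / (1 - \<alpha>) / (2 * pi)"])
    fix s0 :: complex and r :: real assume s0: "s0 \<in> ?C" and r: "1/2 \<le> r" "r < 1"
    define \<delta> where "\<delta> = 1 - r"
    define x where "x = of_real r * u s0"
    define z where "z = of_real r * s0"
    define w where "w = 1 / F x"
    have \<delta>: "0 < \<delta>" using r by (simp add: \<delta>_def)
    have us0: "u s0 \<in> ?C" by (rule u(1)[OF s0])
    have nx: "norm x = r" "norm z = r" using us0 s0 r by (simp_all add: x_def z_def norm_mult)
    then have xb: "x \<in> ball 0 1" "z \<in> ball 0 1" "x \<in> cball 0 1" "z \<in> cball 0 1" using r by auto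
    have x0: "x \<noteq> 0" using nx r by auto
    have Fx: "F x \<noteq> 0" by (rule F_nonzero[OF xb(3) x0])
    have rad: "dist x (u s0) = \<delta>" "dist z s0 = \<delta>"
    proof -
      have "norm (of_real r * t - t) = \<delta>" if "norm t = 1" for t :: complex
      proof -
        have "of_real r * t - t = of_real (r - 1) * t" by (simp add: algebra_simps)
        then show ?thesis using that r by (simp only: norm_mult norm_of_real) (simp add: \<delta>_def)
      qed
      then show "dist x (u s0) = \<delta>" "dist z s0 = \<delta>" using us0 s0 by (simp_all add: x_def z_def dist_norm)
    qed
    have low1: "c1 * (dist s s0 + \<delta>) \<le> norm (f s - f z)" if s: "s \<in> ?C" for s
    proof -
      have "dist s s0 + \<delta> \<le> 3 * norm (s - z)"
        unfolding \<delta>_def z_def by (rule dist_radial_le[OF s0 s]) (use r in auto)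
      then have "c * (dist s s0 + \<delta>) \<le> c * (3 * norm (s - z))" using f_bl(1) by (intro mult_left_mono) auto
      moreover have "c * norm (s - z) \<le> norm (f s - f z)" using f_bl(3)[of s z] s xb by (simp add: dist_norm)
      ultimately show ?thesis unfolding c1_def by simp
    qed
    have low2: "c2 * (dist s s0 + \<delta>) \<le> norm (f s - w)" if s: "s \<in> ?C" for s
    proof -
      have us: "u s \<in> ?C" by (rule u(1)[OF s])
      have "m * (dist s s0 + \<delta>) \<le> dist (u s) (u s0) + \<delta>"
      proof -
        have "m * dist s s0 \<le> l * dist s s0" using m by (intro mult_right_mono) auto
        moreover have "m * \<delta> \<le> 1 * \<delta>" using m \<delta> by (intro mult_right_mono) auto
        ultimately show ?thesis using u_bl(3)[OF s s0] by (simp add: distrib_left)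
      qed
      also have "\<dots> \<le> 3 * norm (u s - x)"
        unfolding \<delta>_def x_def by (rule dist_radial_le[OF us0 us]) (use r in auto)
      finally have "k * (m * (dist s s0 + \<delta>)) \<le> k * (3 * norm (u s - x))" using F_bl(1) by (intro mult_left_mono) auto
      then have 1: "k * m / 3 * (dist s s0 + \<delta>) \<le> norm (F (u s) - F x)"
        using F_bl(3)[of "u s" x] us xb by (simp add: dist_norm)
      have Fus: "F (u s) \<noteq> 0" using u(2)[OF s] f_nonzero[OF s] by simp
      have fs: "f s = 1 / F (u s)" using u(2)[OF s] by simp
      have "f s - w = - (F (u s) - F x) / (F (u s) * F x)"
        unfolding fs w_def using Fus Fx by (simp add: field_simps)
      then have "norm (f s - w) = norm (F (u s) - F x) / (norm (F (u s)) * norm (F x))"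
        by (simp add: norm_divide norm_mult norm_minus_commute)
      moreover have "k * m / 3 * (dist s s0 + \<delta>) / (K * K) \<le> norm (F (u s) - F x) / (norm (F (u s)) * norm (F x))"
        using 1 FK[of "u s"] FK[of x] us xb Fus Fx F_bl(2) by (intro frac_le mult_mono mult_pos_pos) auto
      ultimately show ?thesis by (simp add: c2_def)
    qed
    have up: "norm (f z - w) \<le> C3 * \<delta>"
    proof -
      have 1: "norm (f z - f s0) \<le> C * \<delta>" using f_bl(4)[of z s0] s0 xb rad by (simp add: dist_norm)
      have Fus: "F (u s0) \<noteq> 0" using u(2)[OF s0] f_nonzero[OF s0] by simp
      have fs: "f s0 = 1 / F (u s0)" using u(2)[OF s0] by simp
      have "f s0 - w = (F x - F (u s0)) / (F (u s0) * F x)"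
        unfolding fs w_def using Fus Fx by (simp add: field_simps)
      then have "norm (f s0 - w) = norm (F x - F (u s0)) / (norm (F (u s0)) * norm (F x))"
        by (simp add: norm_divide norm_mult)
      also have "\<dots> \<le> K * \<delta> / (k/2 * (k/2))"
        using F_bl(4)[of x "u s0"] rad us0 xb Fk[of "u s0"] Fk[of x] nx r F_bl(1,2) \<delta>
        by (intro frac_le mult_mono mult_pos_pos) (auto simp: dist_norm)
      finally have 2: "norm (f s0 - w) \<le> K / (k/2 * (k/2)) * \<delta>" by (simp only: times_divide_eq_left)
      have "norm (f z - w) \<le> norm (f z - f s0) + norm (f s0 - w)"
        using norm_triangle_ineq[of "f z - f s0" "f s0 - w"] by simp
      then show ?thesis using 1 2 by (simp add: C3_def distrib_right)
    qed
    have nz1: "f s - f z \<noteq> 0" if "s \<in> ?C" for s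
      using low1[OF that] pos(1) \<delta> mult_pos_pos[OF pos(1) add_nonneg_pos[OF zero_le_dist \<delta>, of s s0]] by auto
    have nz2: "f s - w \<noteq> 0" if "s \<in> ?C" for s
      using low2[OF that] pos(1) \<delta> mult_pos_pos[OF pos(2) add_nonneg_pos[OF zero_le_dist \<delta>, of s s0]] by auto
    have Fw: "F x / (f s * F x - 1) = 1 / (f s - w)" for s
      using Fx by (cases "f s = w") (simp_all add: w_def field_simps)
    have i1: "((\<lambda>s. A s * f1 s / (f s - f z)) has_contour_integral 0) (circlepath 0 1)"
    proof -
      have "(\<lambda>s. A s * f1 s / (f s - f z)) contour_integrable_on (circlepath 0 1)"
        by (rule contour_integrable_continuous_circlepath)
           (use nz1 in \<open>auto intro!: continuous_intros cA continuous_f_sphere\<close>)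
      from has_contour_integral_integral[OF this] show ?thesis by (simp add: zero[OF xb(2)])
    qed
    define J where "J = contour_integral (circlepath 0 1) (\<lambda>s. A s * f1 s / (f s - w))"
    have i2: "((\<lambda>s. A s * f1 s / (f s - w)) has_contour_integral J) (circlepath 0 1)"
    proof -
      have "(\<lambda>s. A s * f1 s / (f s - w)) contour_integrable_on (circlepath 0 1)"
        by (rule contour_integrable_continuous_circlepath)
           (use nz2 in \<open>auto intro!: continuous_intros cA continuous_f_sphere\<close>)
      from has_contour_integral_integral[OF this] show ?thesis by (simp add: J_def)
    qed
    have i3: "((\<lambda>s. f1 s / (f s - f z)) has_contour_integral 2 * pi * \<i>) (circlepath 0 1)"
      by (rule Cauchy_integral_one) (use xb in simp)
    have i4: "((\<lambda>s. f1 s / (f s - w)) has_contour_integral 0) (circlepath 0 1)"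
    proof -
      have "((\<lambda>s. f1 s * (F x / (f s * F x - 1))) has_contour_integral 0) (circlepath 0 1)"
        using Cauchy_integral_zero[of x] xb by simp
      then show ?thesis unfolding Fw by simp
    qed
    have ext: "exterior_integral A x = - (1 / (2 * pi * \<i>)) * J"
    proof -
      have "(\<lambda>s. A s * f1 s * F x / (f s * F x - 1)) = (\<lambda>s. A s * f1 s / (f s - w))"
      proof
        fix s
        have "A s * f1 s * F x / (f s * F x - 1) = A s * f1 s * (F x / (f s * F x - 1))" by simp
        then show "A s * f1 s * F x / (f s * F x - 1) = A s * f1 s / (f s - w)" unfolding Fw by simp
      qed
      then show ?thesis by (simp add: exterior_integral_def J_def)
    qed
    define q where "q = (\<lambda>s. (A s - A s0) * f1 s * ((f z - w) / ((f s - f z) * (f s - w))))"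
    have iq: "(q has_contour_integral - 2 * pi * \<i> * A s0 - J) (circlepath 0 1)"
    proof -
      have "((\<lambda>s. A s * f1 s / (f s - f z) - A s0 * (f1 s / (f s - f z))
           - (A s * f1 s / (f s - w) - A s0 * (f1 s / (f s - w)))) has_contour_integral
           (0 - A s0 * (2 * pi * \<i>) - (J - A s0 * 0))) (circlepath 0 1)"
        by (intro has_contour_integral_diff has_contour_integral_lmul i1 i2 i3 i4)
      then have "(q has_contour_integral (0 - A s0 * (2 * pi * \<i>) - (J - A s0 * 0))) (circlepath 0 1)"
      proof (rule has_contour_integral_eq)
        fix s assume "s \<in> path_image (circlepath 0 1)"
        then have s: "s \<in> ?C" by simp
        define d1 where "d1 = f s - f z"
        define d2 where "d2 = f s - w"
        have dn: "d1 \<noteq> 0" "d2 \<noteq> 0" using nz1[OF s] nz2[OF s] by (auto simp: d1_def d2_def)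
        have "f z - w = d2 - d1" by (simp add: d1_def d2_def)
        then have "q s = (A s - A s0) * f1 s * ((d2 - d1) / (d1 * d2))" by (simp add: q_def d1_def d2_def)
        also have "(d2 - d1) / (d1 * d2) = 1 / d1 - 1 / d2" using dn by (simp add: field_simps)
        finally have "q s = A s * f1 s / d1 - A s0 * (f1 s / d1) - (A s * f1 s / d2 - A s0 * (f1 s / d2))"
          by (simp add: algebra_simps)
        then show "A s * f1 s / (f s - f z) - A s0 * (f1 s / (f s - f z))
           - (A s * f1 s / (f s - w) - A s0 * (f1 s / (f s - w))) = q s" by (simp add: d1_def d2_def)
      qed
      then show ?thesis by (simp add: mult_ac)
    qed
    have "norm (contour_integral (circlepath 0 1) q) \<le> 24 * pi * (0 / \<delta> + M * \<delta> / (1 - \<alpha>) * \<delta> powr (\<alpha> - 1))"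
    proof (rule contour_integral_circle_kernel_bound[OF less_imp_le[OF \<alpha>(1)] \<alpha>(2) \<delta> order_refl _ s0])
      show "0 \<le> M * \<delta>" using M0 \<delta> by simp
      show "continuous_on ?C q"
        unfolding q_def using nz1 nz2 by (intro continuous_intros cA continuous_f_sphere) auto
      fix s assume s: "s \<in> ?C"
      define y where "y = dist s s0 + \<delta>"
      have y: "0 < y" "dist s s0 \<le> y" using \<delta> by (auto simp: y_def add_nonneg_pos)
      have "norm (q s) = norm (A s - A s0) * norm (f1 s) * (norm (f z - w) / (norm (f s - f z) * norm (f s - w)))"
        by (simp add: q_def norm_mult norm_divide)
      also have "\<dots> \<le> (a * y powr \<alpha>) * g * (C3 * \<delta> / ((c1 * y) * (c2 * y)))"
      proof (intro mult_mono frac_le)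
        have "norm (A s - A s0) \<le> a * dist s s0 powr \<alpha>" by (rule a(2)[OF s s0])
        also have "\<dots> \<le> a * y powr \<alpha>" using y a(1) \<alpha> by (intro mult_left_mono powr_mono2) auto
        finally show "norm (A s - A s0) \<le> a * y powr \<alpha>" .
      qed (use g(2)[OF s] g(1) a(1) up low1[OF s] low2[OF s] pos y \<delta> in \<open>auto simp: y_def\<close>)
      also have "\<dots> = M * \<delta> * (y powr \<alpha> / y^2)"
        using y pos by (simp add: M_def field_simps power2_eq_square)
      also have "y powr \<alpha> / y^2 = y powr (\<alpha> - 2)" using y by (simp add: powr_diff)
      finally show "norm (q s) \<le> 0 * (dist s s0 + \<delta>) powr - 2 + M * \<delta> * (dist s s0 + \<delta>) powr (\<alpha> - 2)"
        by (simp add: y_def)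
    qed
    also have "\<dots> = 24 * pi * M / (1 - \<alpha>) * \<delta> powr \<alpha>"
      using \<delta> by (simp add: powr_diff)
    finally have nq: "norm (- 2 * pi * \<i> * A s0 - J) \<le> 24 * pi * M / (1 - \<alpha>) * \<delta> powr \<alpha>"
      using contour_integral_unique[OF iq] by simp
    have "exterior_integral A x - A s0 = (1 / (2 * pi * \<i>)) * (- 2 * pi * \<i> * A s0 - J)"
      by (simp add: ext field_simps)
    then have "norm (exterior_integral A x - A s0) = norm (- 2 * pi * \<i> * A s0 - J) / (2 * pi)"
      by (simp only: norm_mult norm_divide) simp
    also have "\<dots> \<le> 24 * pi * M / (1 - \<alpha>) * \<delta> powr \<alpha> / (2 * pi)"
      using nq by (rule divide_right_mono) simp
    finally show "norm (exterior_integral A (of_real r * u s0) - A s0) \<le> 24 * pi * M / (1 - \<alpha>) / (2 * pi) * (1 - r) powr \<alpha>"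
      by (simp add: x_def \<delta>_def)
  qed
qed

end

context smooth_pair
begin

text \<open>The exterior integral extends to the closed disc with boundary values \<open>A\<close>,
  transported by the inverse \<open>w\<close> of \<open>u\<close>. Its zero at 0 permits division by
  \<open>x\<close>, and \<open>F1\<close> is zero free, so \<open>k\<close> is continuous up to the
  circle. The Hoelder condition on \<open>h\<close> concerns the circle, where \<open>k\<close> is a
  quotient of Hoelder functions.\<close>

lemma exterior_function_of_kernel:
  assumes v: "lip_circle \<alpha> v" and zero: "\<And>z. z \<in> disc \<Longrightarrow> I_op f v z = 0"
  obtains h where "HolC_ext h" "lip_circle \<alpha> h"
    "\<And>s. s \<in> sphere 0 1 \<Longrightarrow> v s = u s * F1 (u s) * (f s)^2 / (s * f1 s) * h (1 / u s)"
proof -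
  let ?C = "sphere (0::complex) 1"
  define A where "A = density v"
  have A: "lip_circle \<alpha> A"
  proof -
    have "lip_circle \<alpha> (\<lambda>s. s * f1 s * v s / (f s * f s))"
      by (intro lip_circle_mult lip_circle_divide lip_f lip_circle_ident f1(3) v)
         (use \<alpha> f_nonzero in auto)
    then show ?thesis by (simp add: A_def density_def[abs_def] power2_eq_square)
  qed
  have "contour_integral (circlepath 0 1) (\<lambda>s. A s * f1 s / (f s - f z)) = 0" if "z \<in> ball 0 1" for z
    using zero[of z] that by (simp add: I_op_eq A_def disc_def)
  then obtain C where C: "\<And>s r. s \<in> ?C \<Longrightarrow> 1/2 \<le> r \<Longrightarrow> r < 1 \<Longrightarrow>
      norm (exterior_integral A (of_real r * u s) - A s) \<le> C * (1 - r) powr \<alpha>"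
    using exterior_integral_boundary[OF A] by blast
  obtain l L where u_bl: "0 < l" "0 < L"
    "\<And>x y. x \<in> ?C \<Longrightarrow> y \<in> ?C \<Longrightarrow> l * dist x y \<le> dist (u x) (u y)"
    "\<And>x y. x \<in> ?C \<Longrightarrow> y \<in> ?C \<Longrightarrow> dist (u x) (u y) \<le> L * dist x y"
    by (rule u_bilipschitz) (rule that; assumption)
  define w where "w = inv_into ?C u"
  have u_img: "x \<in> u ` ?C" if "x \<in> ?C" for x
    using u_surj[OF that] by (metis imageI)
  have w: "w x \<in> ?C" "u (w x) = x" if "x \<in> ?C" for x
    using u_img[OF that] unfolding w_def by (rule inv_into_into, rule f_inv_into_f)
  have wu: "w (u s) = s" if "s \<in> ?C" for s
  proof -
    have "l * dist (w (u s)) s \<le> dist (u (w (u s))) (u s)" by (rule u_bl(3)[OF w(1)[OF u(1)[OF that]] that])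
    then show ?thesis using w(2)[OF u(1)[OF that]] u_bl(1) by (simp add: mult_le_0_iff)
  qed
  define \<beta> where "\<beta> = (\<lambda>x. A (w x))"
  have \<beta>: "lip_circle \<alpha> \<beta>"
    unfolding \<beta>_def
  proof (rule lip_circle_compose[OF A w(1)])
    fix x y assume xy: "x \<in> ?C" "y \<in> ?C"
    have "l * dist (w x) (w y) \<le> dist x y"
      using u_bl(3)[OF w(1)[OF xy(1)] w(1)[OF xy(2)]] w(2)[OF xy(1)] w(2)[OF xy(2)] by simp
    then show "dist (w x) (w y) \<le> 1 / l * dist x y" using u_bl(1) by (simp add: field_simps)
  qed (use u_bl(1) \<alpha> in auto)
  have hol: "exterior_integral A holomorphic_on ball 0 1"
    by (rule holomorphic_exterior_integral[OF continuous_on_lip_circle[OF A \<alpha>(1)]])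
  define E where "E = (\<lambda>x. if norm x < 1 then exterior_integral A x else \<beta> x)"
  have cE: "continuous_on (cball 0 1) E"
    unfolding E_def
  proof (rule continuous_on_radial_extension[OF holomorphic_on_imp_continuous_on[OF hol]
        continuous_on_lip_circle[OF \<beta> \<alpha>(1)] \<alpha>(1)])
    fix s :: complex and r :: real assume s: "s \<in> ?C" and r: "1/2 \<le> r" "r < 1"
    show "norm (exterior_integral A (of_real r * s) - \<beta> s) \<le> C * (1 - r) powr \<alpha>"
      using C[OF w(1)[OF s] r] w(2)[OF s] by (simp add: \<beta>_def)
  qed
  have hE: "E holomorphic_on ball 0 1"
    by (rule holomorphic_transform[OF hol]) (simp add: E_def)
  have E0: "E 0 = 0" by (simp add: E_def exterior_integral_def inverted_def)
  obtain Q where Q: "continuous_on (cball 0 1) Q" "Q holomorphic_on ball 0 1" "\<And>x. E x = x * Q x"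
    using quotient_by_identity[OF cE hE E0] by metis
  define k where "k = (\<lambda>x. Q x / F1 x)"
  have ck: "continuous_on (cball 0 1) k"
    unfolding k_def using F1(2) by (intro continuous_intros Q(1) F1(1)) auto
  have hk: "k holomorphic_on ball 0 1"
    unfolding k_def using F1(2) by (intro holomorphic_intros Q(2) holomorphic_F1) auto
  define h where "h = (\<lambda>\<zeta>. k (1 / \<zeta>))"
  show ?thesis
  proof (rule that[of h])
    have in_ball: "1 / \<zeta> \<in> ball 0 1" if "\<zeta> \<in> ext_open" for \<zeta>
      using that by (auto simp: ext_open_def norm_divide divide_simps)
    have in_cball: "1 / \<zeta> \<in> cball 0 1" "\<zeta> \<noteq> 0" if "\<zeta> \<in> ext_closed" for \<zeta>
      using that by (auto simp: ext_closed_def norm_divide divide_simps)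
    show "HolC_ext h"
      unfolding HolC_ext_def
    proof (intro conjI)
      show "h holomorphic_on ext_open"
        unfolding h_def
        by (rule holomorphic_on_compose_gen[OF _ hk, unfolded o_def, of "\<lambda>\<zeta>. 1 / \<zeta>"])
           (use in_ball in \<open>auto intro!: holomorphic_intros simp: ext_open_def\<close>)
      show "continuous_on ext_closed h"
        unfolding h_def
        by (rule continuous_on_compose2[OF ck]) (use in_cball in \<open>auto intro!: continuous_intros\<close>)
      have "isCont k 0"
        using ck continuous_on_interior[of "cball 0 1" k 0] by simp
      then have "((\<lambda>\<zeta>. k (1 / \<zeta>)) \<longlongrightarrow> k 0) at_infinity"
        by (rule isCont_tendsto_compose)
           (use tendsto_inverse_0[where ?'a = complex] in \<open>simp add: inverse_eq_divide[abs_def]\<close>)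
      then show "\<exists>L. (h \<longlongrightarrow> L) at_infinity" by (auto simp: h_def)
    qed
    have "lip_circle \<alpha> (\<lambda>x. \<beta> x / (x * F1 x))"
      by (intro lip_circle_divide lip_circle_mult \<beta> lip_circle_ident F1(3)) (use \<alpha> F1(2) in auto)
    moreover have "\<beta> x / (x * F1 x) = k x" if "x \<in> ?C" for x
    proof -
      have "x \<noteq> 0" using that by auto
      moreover have "\<beta> x = x * Q x" using Q(3)[of x] that by (simp add: E_def)
      ultimately show ?thesis by (simp add: k_def)
    qed
    ultimately have "lip_circle \<alpha> k" using lip_circle_cong[of "\<lambda>x. \<beta> x / (x * F1 x)" k] by simp
    then show "lip_circle \<alpha> h" unfolding h_def by (rule lip_compose_inverse)
    fix s assume s: "s \<in> ?C"
    have us: "u s \<in> ?C" by (rule u(1)[OF s])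
    have nz: "s \<noteq> 0" "u s \<noteq> 0" "f s \<noteq> 0" "f1 s \<noteq> 0" "F1 (u s) \<noteq> 0"
      using s us f_nonzero[OF s] f1(2)[of s] F1(2)[of "u s"] by auto
    have "A s = u s * Q (u s)"
      using Q(3)[of "u s"] us wu[OF s] by (simp add: E_def \<beta>_def)
    then have "Q (u s) = s * f1 s * v s / (f s)^2 / u s"
      using nz by (simp add: A_def density_def field_simps)
    then show "v s = u s * F1 (u s) * (f s)^2 / (s * f1 s) * h (1 / u s)"
      using nz by (simp add: h_def k_def)
  qed
qed

end

theorem theorem2:
  fixes \<alpha> :: real and f \<phi> :: "complex \<Rightarrow> complex"
  assumes "0 < \<alpha>" "\<alpha> < 1"
    and "class_S1 \<alpha> f"
    and "\<phi> holomorphic_on ext_open" "inj_on \<phi> ext_open"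
    and "filterlim \<phi> at_infinity at_infinity"
    and "continuous_on ext_closed \<phi>"
    and "matching f \<phi>"
  defines "\<psi> \<equiv> inv_into ext_closed \<phi>"
  defines "\<gamma>inv \<equiv> (\<lambda>z. \<psi> (f z))"
  defines "v0 \<equiv> (\<lambda>z. (1 / z) * (\<psi> (f z) / (fder f z * bderiv \<psi> (f ` circle) (f z))))"
  shows "\<forall>v. (lip_circle \<alpha> v \<and> (\<forall>z\<in>disc. I_op f v z = 0)) \<longleftrightarrow>
           (\<exists>h. HolC_ext h \<and> lip_circle \<alpha> h \<and> (\<forall>z\<in>circle. v z = v0 z * h (\<gamma>inv z)))"
proof -
  obtain g where g: "\<And>s. s \<in> sphere 0 1 \<Longrightarrow> (f has_field_derivative g s) (at s within sphere 0 1)"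
    "\<And>s. s \<in> sphere 0 1 \<Longrightarrow> g s \<noteq> 0" "lip_circle \<alpha> g"
    using assms(3) unfolding class_S1_def circle_def by blast
  interpret matching_pair f \<phi>
    using assms by unfold_locales (auto simp: class_S1_def class_S_def disc_def)
  obtain f1 F1 where "smooth_pair f \<phi> \<alpha> f1 F1"
    using smooth_pair_exists[OF assms(1,2) g] by metis
  then interpret smooth_pair f \<phi> \<alpha> f1 F1 .
  have v0: "v0 s = u s * F1 (u s) * (f s)^2 / (s * f1 s)" if "s \<in> sphere 0 1" for s
    using v0_eq[OF that] by (simp add: v0_def assms(9) \<psi>_def)
  have \<gamma>inv: "\<gamma>inv s = 1 / u s" if "s \<in> sphere 0 1" for s
    using \<psi>_f[OF that] by (simp add: \<gamma>inv_def assms(9) \<psi>_def)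
  show ?thesis
  proof (intro allI iffI)
    fix v assume v: "lip_circle \<alpha> v \<and> (\<forall>z\<in>disc. I_op f v z = 0)"
    then obtain h where h: "HolC_ext h" "lip_circle \<alpha> h"
      "\<And>s. s \<in> sphere 0 1 \<Longrightarrow> v s = u s * F1 (u s) * (f s)^2 / (s * f1 s) * h (1 / u s)"
      using exterior_function_of_kernel[of v] by metis
    then show "\<exists>h. HolC_ext h \<and> lip_circle \<alpha> h \<and> (\<forall>z\<in>circle. v z = v0 z * h (\<gamma>inv z))"
      by (intro exI[of _ h]) (auto simp: circle_def v0 \<gamma>inv)
  next
    fix v assume "\<exists>h. HolC_ext h \<and> lip_circle \<alpha> h \<and> (\<forall>z\<in>circle. v z = v0 z * h (\<gamma>inv z))"
    then obtain h where h: "HolC_ext h" "lip_circle \<alpha> h" "\<And>z. z \<in> circle \<Longrightarrow> v z = v0 z * h (\<gamma>inv z)"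
      by blast
    have "v s = u s * F1 (u s) * (f s)^2 / (s * f1 s) * h (1 / u s)" if "s \<in> sphere 0 1" for s
      using h(3)[of s] that v0 \<gamma>inv by (simp add: circle_def)
    from kernel_of_exterior_function[OF h(1,2) this]
    show "lip_circle \<alpha> v \<and> (\<forall>z\<in>disc. I_op f v z = 0)" by blast
  qed
qed

end
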